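(* Let $X$ be a non-empty compact Hausdorff space equipped with a continuous free action of a non-trivial compact Hausdorff group $G$. Then there does not exist a $G$-equivariant continuous map $X*G\to G$.
   Context: Actions are right actions; $G$ acts on itself by right multiplication. The join $X*G$ is the quotient of $X\times[0,1]\times G$ by the relations $(x,0,g)\sim(x',0,g)$ and $(x,1,g)\sim(x,1,g')$ for all $x,x'\in X$, $g,g'\in G$, equipped with the diagonal $G$-action $[(x,t,g)]h=[(xh,t,gh)]$. *)

theory Defs
  imports "HOL-Analysis.Analysis" "HOL-Algebra.Group"
begin

section \<open>Topological groups and their right actions\<close>

locale topological_group = group G for G :: "('g, 'r) monoid_scheme" (structure) +
  fixes T :: "'g topology"
  assumes topspace_eq_carrier: "topspace T = carrier G"
    and continuous_mult: "continuous_map (prod_topology T T) T (\<lambda>(g, h). g \<otimes> h)"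
    and continuous_inv: "continuous_map T T (\<lambda>g. inv g)"

text \<open>The library's \<^locale>\<open>group\<close> comes with left actions only. The closure condition
  that the action preserves the space is part of \<open>continuous_act\<close>.\<close>

locale continuous_right_action = topological_group G T
  for G :: "('g, 'r) monoid_scheme" (structure) and T :: "'g topology" +
  fixes X :: "'x topology" and act :: "'x \<Rightarrow> 'g \<Rightarrow> 'x"
  assumes continuous_act: "continuous_map (prod_topology X T) X (\<lambda>(x, g). act x g)"
    and act_one: "x \<in> topspace X \<Longrightarrow> act x \<one> = x"
    and act_mult: "\<lbrakk>x \<in> topspace X; g \<in> carrier G; h \<in> carrier G\<rbrakk>
      \<Longrightarrow> act (act x g) h = act x (g \<otimes> h)"

definition free_action :: "('g, 'r) monoid_scheme \<Rightarrow> 'x topology \<Rightarrow> ('x \<Rightarrow> 'g \<Rightarrow> 'x) \<Rightarrow> bool" where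
  "free_action G X act \<longleftrightarrow>
    (\<forall>x \<in> topspace X. \<forall>g \<in> carrier G. act x g = x \<longrightarrow> g = \<one>\<^bsub>G\<^esub>)"


section \<open>Quotient topology\<close>

text \<open>The points are the equivalence classes, and a set of classes is open iff its union,
  which is its preimage under the projection, is open.\<close>

definition quotient_topology :: "'a topology \<Rightarrow> ('a \<times> 'a) set \<Rightarrow> 'a set topology" where
  "quotient_topology X R = topology (\<lambda>U. U \<subseteq> topspace X // R \<and> openin X (\<Union>U))"

lemma openin_quotient_topology:
  assumes "equiv (topspace X) R"
  shows "openin (quotient_topology X R) U \<longleftrightarrow> U \<subseteq> topspace X // R \<and> openin X (\<Union>U)"
proof -
  have "\<Union>(U \<inter> V) = \<Union>U \<inter> \<Union>V"
    if "U \<subseteq> topspace X // R" "V \<subseteq> topspace X // R" for U V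
  proof -
    have "c = d" if "c \<in> U" "d \<in> V" "y \<in> c" "y \<in> d" for c d y
      using quotient_disj[OF assms, of c d] that
        \<open>U \<subseteq> topspace X // R\<close> \<open>V \<subseteq> topspace X // R\<close> by auto
    then show ?thesis
      by auto
  qed
  moreover have "openin X (\<Union>(\<Union>K))" if "\<forall>U\<in>K. openin X (\<Union>U)" for K
  proof -
    have "\<Union>(\<Union>K) = \<Union>(Union ` K)"
      by blast
    then show ?thesis
      using that by auto
  qed
  ultimately have "istopology (\<lambda>U. U \<subseteq> topspace X // R \<and> openin X (\<Union>U))"
    unfolding istopology_def by (simp add: openin_Int Sup_le_iff le_infI1)
  then show ?thesis
    by (simp add: quotient_topology_def)
qed

lemma topspace_quotient_topology:
  assumes "equiv (topspace X) R"
  shows "topspace (quotient_topology X R) = topspace X // R"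
proof
  show "topspace (quotient_topology X R) \<subseteq> topspace X // R"
    using openin_quotient_topology[OF assms] openin_topspace by blast
  have "openin (quotient_topology X R) (topspace X // R)"
    by (simp add: openin_quotient_topology[OF assms] Union_quotient[OF assms])
  then show "topspace X // R \<subseteq> topspace (quotient_topology X R)"
    by (rule openin_subset)
qed

lemma quotient_map_quotient_topology:
  assumes "equiv (topspace X) R"
  shows "quotient_map X (quotient_topology X R) (\<lambda>x. R `` {x})"
  unfolding quotient_map_def
proof (intro conjI allI impI)
  show "(\<lambda>x. R `` {x}) ` topspace X = topspace (quotient_topology X R)"
    by (auto simp: topspace_quotient_topology[OF assms] quotient_def)
  fix U
  assume U: "U \<subseteq> topspace (quotient_topology X R)"
  then have U': "U \<subseteq> topspace X // R"
    by (simp add: topspace_quotient_topology[OF assms])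
  have cls: "R `` {x} = c" if "c \<in> U" "x \<in> c" for c x
  proof -
    obtain y where "c = R `` {y}"
      using U' \<open>c \<in> U\<close> by (meson quotientE subsetD)
    then show ?thesis
      using equiv_class_eq[OF assms, of y x] \<open>x \<in> c\<close> by simp
  qed
  have "\<Union>U \<subseteq> topspace X"
    using U' Union_quotient[OF assms] by (metis Union_mono)
  have "{x \<in> topspace X. R `` {x} \<in> U} = \<Union>U"
  proof (intro equalityI subsetI)
    fix x assume "x \<in> {x \<in> topspace X. R `` {x} \<in> U}"
    then show "x \<in> \<Union>U"
      using equiv_class_self[OF assms, of x] by (intro UnionI[of "R `` {x}"]) simp_all
  next
    fix x assume "x \<in> \<Union>U"
    then obtain c where "c \<in> U" "x \<in> c" ..
    then show "x \<in> {x \<in> topspace X. R `` {x} \<in> U}"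
      using cls \<open>\<Union>U \<subseteq> topspace X\<close> by auto
  qed
  then show "openin X {x \<in> topspace X. R `` {x} \<in> U} \<longleftrightarrow> openin (quotient_topology X R) U"
    using U by (simp add: openin_quotient_topology[OF assms] topspace_quotient_topology[OF assms])
qed


section \<open>The join\<close>

abbreviation cylinder :: "'x topology \<Rightarrow> 'g topology \<Rightarrow> ('x \<times> real \<times> 'g) topology" where
  "cylinder X T \<equiv> prod_topology X (prod_topology (top_of_set {0..1}) T)"

text \<open>At \<open>t = 0\<close> the \<open>X\<close>-coordinate is forgotten, at \<open>t = 1\<close> the other one. These
  identifications together with the diagonal are already symmetric and transitive, so this is
  the equivalence relation they generate.\<close>

definition join_rel :: "'x topology \<Rightarrow> 'g topology \<Rightarrow> (('x \<times> real \<times> 'g) \<times> ('x \<times> real \<times> 'g)) set" where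
  "join_rel X T = Id_on (topspace (cylinder X T))
    \<union> {((x, 0, g), (x', 0, g)) | x x' g. x \<in> topspace X \<and> x' \<in> topspace X \<and> g \<in> topspace T}
    \<union> {((x, 1, g), (x, 1, g')) | x g g'. x \<in> topspace X \<and> g \<in> topspace T \<and> g' \<in> topspace T}"

lemma equiv_join_rel: "equiv (topspace (cylinder X T)) (join_rel X T)"
proof (rule equivI)
  show "join_rel X T \<subseteq> topspace (cylinder X T) \<times> topspace (cylinder X T)"
    by (auto simp: join_rel_def)
  show "refl_on (topspace (cylinder X T)) (join_rel X T)"
    by (auto simp: join_rel_def refl_on_def)
  show "sym (join_rel X T)"
    by (rule symI) (auto simp: join_rel_def)
  show "trans (join_rel X T)"
    by (rule transI) (auto simp: join_rel_def)
qed

definition join_topology :: "'x topology \<Rightarrow> 'g topology \<Rightarrow> ('x \<times> real \<times> 'g) set topology" where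
  "join_topology X T = quotient_topology (cylinder X T) (join_rel X T)"

text \<open>The diagonal action sends an equivalence class to its image under
  \<open>(x, t, g) \<mapsto> (xh, t, gh)\<close>; the image is again a full class, see \<open>join_act_class\<close>.\<close>

definition join_act :: "('g, 'r) monoid_scheme \<Rightarrow> ('x \<Rightarrow> 'g \<Rightarrow> 'x)
    \<Rightarrow> ('x \<times> real \<times> 'g) set \<Rightarrow> 'g \<Rightarrow> ('x \<times> real \<times> 'g) set" where
  "join_act G act c h = (\<lambda>(x, t, g). (act x h, t, g \<otimes>\<^bsub>G\<^esub> h)) ` c"

context continuous_right_action
begin

lemma act_closed: "\<lbrakk>x \<in> topspace X; g \<in> carrier G\<rbrakk> \<Longrightarrow> act x g \<in> topspace X"
  using continuous_map_image_subset_topspace[OF continuous_act]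
  by (force simp: topspace_eq_carrier)

lemma join_act_class:
  assumes "x \<in> topspace X" "t \<in> {0..1}" "g \<in> carrier G" "h \<in> carrier G"
  shows "join_act G act (join_rel X T `` {(x, t, g)}) h = join_rel X T `` {(act x h, t, g \<otimes> h)}"
proof -
  let ?d = "\<lambda>k (x, t :: real, g). (act x k, t, g \<otimes> k)"
  have fwd: "(?d k p, ?d k q) \<in> join_rel X T"
    if "(p, q) \<in> join_rel X T" "k \<in> carrier G" for p q k
    using that by (auto simp: join_rel_def act_closed topspace_eq_carrier)
  have cancel1: "?d h (?d (inv h) q) = q" if "q \<in> topspace (cylinder X T)" for q
    using that assms(4) by (auto simp: act_mult act_one topspace_eq_carrier m_assoc)
  have cancel2: "?d (inv h) (?d h (x, t, g)) = (x, t, g)"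
    using assms by (auto simp: act_mult act_one m_assoc)
  show ?thesis
  proof (intro equalityI subsetI)
    fix q assume "q \<in> join_act G act (join_rel X T `` {(x, t, g)}) h"
    then show "q \<in> join_rel X T `` {(act x h, t, g \<otimes> h)}"
      unfolding join_act_def using fwd[of "(x, t, g)" _ h] assms(4) by auto
  next
    fix q assume "q \<in> join_rel X T `` {(act x h, t, g \<otimes> h)}"
    then have q: "(?d h (x, t, g), q) \<in> join_rel X T"
      by simp
    have "((x, t, g), ?d (inv h) q) \<in> join_rel X T"
      using fwd[OF q inv_closed[OF assms(4)]] unfolding cancel2 .
    moreover have "q \<in> topspace (cylinder X T)"
      using q equiv_join_rel[of X T] by (auto simp: equiv_def join_rel_def)
    ultimately show "q \<in> join_act G act (join_rel X T `` {(x, t, g)}) h"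
      unfolding join_act_def by (intro image_eqI[where x = "?d (inv h) q"]) (auto simp only: cancel1 Image_singleton_iff)
  qed
qed

end

definition join_equivariant :: "('g, 'r) monoid_scheme \<Rightarrow> 'g topology \<Rightarrow> 'x topology
    \<Rightarrow> ('x \<Rightarrow> 'g \<Rightarrow> 'x) \<Rightarrow> (('x \<times> real \<times> 'g) set \<Rightarrow> 'g) \<Rightarrow> bool" where
  "join_equivariant G T X act f \<longleftrightarrow>
    (\<forall>c \<in> topspace (join_topology X T). \<forall>h \<in> carrier G. f (join_act G act c h) = f c \<otimes>\<^bsub>G\<^esub> h)"

end

(* An equivariant map X * G -> G, restricted to the join of a point with G, contracts G, so it is
   enough that a contractible compact group is trivial.

   Let a be close to 1 and f a continuous function on G with f (x a) = w f x for a constant w of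
   modulus 1, w = exp (i alpha), alpha not 0.  On the open set U_p where f (p x) is not small, the
   local 1-cochain t_p (x, y) = Arg (f (p y) / f (p x)) is closed; it is extended to all pairs by the
   constant alpha.  Translation by a preserves t_p, and t_p (x, x a) = alpha everywhere, so t_p is a
   connection with curvature d t_p supported off U_p.  If U_p, p in P, cover G, then the cup product
   of the d t_p vanishes on small tuples.  On the other hand, G being acyclic, the Gysin sequence of
   right multiplication by a shows that no such product has a basic primitive: averaging over the powers
   of a by a Banach limit and contracting with the prism from x to x a, one removes the factors one by
   one and ends with the constant 1 as a coboundary.  Every step loses some scale, so card P and the
   modulus of continuity of f must be known before a is chosen.  This is achieved by taking f in an
   eigenspace of a convolution operator, whose unit ball is equicontinuous; a contractible group is
   connected, so arbitrarily small a act nontrivially on this space. *)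

theory Submission
  imports Defs
begin

section \<open>Cochains on lists\<close>

text \<open>The model is the universal circle bundle: when the total space is contractible, no power
  of the Chern class of the base vanishes, whereas a base covered by \<open>n\<close> sets over
  which the bundle is flat has vanishing products of \<open>n\<close> such classes
  (Lusternik-Schnirelmann). The base is never formed, since the powers of \<open>a\<close> need be
  neither closed nor act like a circle. Basic cochains on the group itself, invariant under
  \<open>shift a\<close> and killed by the prism, stand for cochains of the quotient. For small
  \<open>a\<close> the prism from \<open>x\<close> to \<open>x a\<close> stays among small tuples
  and plays the part of contraction with the vector field that generates the action;
  \<open>prism_homotopy\<close> is its Cartan formula. The powers of \<open>a\<close> need not form
  a compact group over which to integrate. The Banach limit replaces that integral; it needs bounded
  cochains, but neither continuity nor measurability. The functions to which all this is applied
  come from a compact self-adjoint operator, treated by hand on continuous functions with an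
  invariant mean instead of on a Hilbert space.\<close>

text \<open>A function on lists carries cochains of all degrees at once: its restriction to lists of length
  \<open>k + 1\<close> is a \<open>k\<close>-cochain. The empty list belongs to the augmentation in degree \<open>-1\<close>.\<close>

fun coboundary :: "('a list \<Rightarrow> real) \<Rightarrow> 'a list \<Rightarrow> real" where
  "coboundary c [] = 0"
| "coboundary c (x # xs) = c xs - coboundary (\<lambda>ys. c (x # ys)) xs"

text \<open>Unrolled, this is the alternating sum over \<open>i\<close> of
  \<open>c [f x_0, ..., f x_i, g x_i, ..., g x_k]\<close>, the usual subdivision of a prism.
  Recursion on the first vertex turns the identities below into one-step inductions in which
  \<open>c\<close> is generalized.\<close>

fun prism :: "('a \<Rightarrow> 'b) \<Rightarrow> ('a \<Rightarrow> 'b) \<Rightarrow> ('b list \<Rightarrow> real) \<Rightarrow> 'a list \<Rightarrow> real" where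
  "prism f g c [] = 0"
| "prism f g c (x # xs) = c (f x # map g (x # xs)) - prism f g (\<lambda>ys. c (f x # ys)) xs"

fun cup :: "('a \<Rightarrow> 'a \<Rightarrow> real) \<Rightarrow> ('a list \<Rightarrow> real) \<Rightarrow> 'a list \<Rightarrow> real" where
  "cup t c (x # y # xs) = t x y * c (y # xs)"
| "cup t c _ = 0"

text \<open>The bound may depend on the degree. Boundedness is the only regularity asked of
  cochains: it is what a Banach limit needs.\<close>

definition bounded_cochain :: "('a list \<Rightarrow> real) \<Rightarrow> bool" where
  "bounded_cochain c \<longleftrightarrow> (\<forall>n. \<exists>B. \<forall>xs. length xs = n \<longrightarrow> \<bar>c xs\<bar> \<le> B)"

lemma coboundary_cong:
  "(\<And>ys. set ys \<subseteq> set xs \<Longrightarrow> length xs = Suc (length ys) \<Longrightarrow> c ys = c' ys)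
    \<Longrightarrow> coboundary c xs = coboundary c' xs"
proof (induction xs arbitrary: c c')
  case (Cons x xs)
  have "coboundary (\<lambda>ys. c (x # ys)) xs = coboundary (\<lambda>ys. c' (x # ys)) xs"
    by (rule Cons.IH) (rule Cons.prems, auto)
  then show ?case using Cons.prems[of xs] by auto
qed simp

lemma prism_cong:
  "(\<And>ys. set ys \<subseteq> f ` set xs \<union> g ` set xs \<Longrightarrow> length ys = Suc (length xs) \<Longrightarrow> c ys = c' ys)
    \<Longrightarrow> prism f g c xs = prism f g c' xs"
proof (induction xs arbitrary: c c')
  case (Cons x xs)
  have "prism f g (\<lambda>ys. c (f x # ys)) xs = prism f g (\<lambda>ys. c' (f x # ys)) xs"
    by (rule Cons.IH) (rule Cons.prems, auto)
  moreover have "c (f x # map g (x # xs)) = c' (f x # map g (x # xs))"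
    by (rule Cons.prems) auto
  ultimately show ?case by simp
qed simp

lemma coboundary_diff: "coboundary (\<lambda>ys. c ys - c' ys) xs = coboundary c xs - coboundary c' xs"
  by (induction xs arbitrary: c c') auto

lemma coboundary_scale: "coboundary (\<lambda>ys. k * c ys) xs = k * coboundary c xs"
  by (induction xs arbitrary: c) (auto simp: algebra_simps)

lemma coboundary_zero [simp]: "coboundary (\<lambda>ys. 0) xs = 0"
  by (induction xs) auto

lemma coboundary_map: "coboundary c (map f xs) = coboundary (\<lambda>ys. c (map f ys)) xs"
  by (induction xs arbitrary: c) auto

lemma prism_diff: "prism f g (\<lambda>ys. c ys - c' ys) xs = prism f g c xs - prism f g c' xs"
  by (induction xs arbitrary: c c') auto

lemma prism_scale: "prism f g (\<lambda>ys. k * c ys) xs = k * prism f g c xs"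
  by (induction xs arbitrary: c) (auto simp: algebra_simps)

lemma prism_zero [simp]: "prism f g (\<lambda>ys. 0) xs = 0"
  by (induction xs) auto

lemma coboundary_coboundary: "coboundary (coboundary c) xs = 0"
proof (induction xs arbitrary: c)
  case (Cons x xs)
  have "coboundary (\<lambda>ys. coboundary c (x # ys)) xs
      = coboundary c xs - coboundary (coboundary (\<lambda>zs. c (x # zs))) xs"
    by (simp add: coboundary_diff)
  then show ?case using Cons.IH by simp
qed simp

text \<open>Splitting off the first vertex leaves the same identity for
  \<open>\<lambda>ys. c (f x # ys)\<close>, and the remaining terms cancel. With the identity and
  \<open>shift a\<close> as the two maps it is a discrete Cartan formula.\<close>

lemma prism_homotopy:
  "prism f g (coboundary c) xs + coboundary (prism f g c) xs = c (map g xs) - c (map f xs)"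
proof (induction xs arbitrary: c)
  case (Cons x xs)
  note IH = Cons.IH[of "\<lambda>ys. c (f x # ys)"]
  have 1: "prism f g (\<lambda>ys. coboundary c (f x # ys)) xs
      = prism f g c xs - prism f g (coboundary (\<lambda>ys. c (f x # ys))) xs"
    by (simp add: prism_diff)
  have 2: "coboundary (\<lambda>ys. prism f g c (x # ys)) xs
     = coboundary (\<lambda>ys. c (f x # g x # map g ys)) xs
        - coboundary (prism f g (\<lambda>ys. c (f x # ys))) xs"
    by (simp add: coboundary_diff)
  have 3: "coboundary (\<lambda>ys. c (f x # g x # ys)) (map g xs)
      = coboundary (\<lambda>ys. c (f x # g x # map g ys)) xs"
    by (simp add: coboundary_map)
  show ?case using IH 1 2 3 by simp
qed simp

text \<open>The counterpart of a vector field contracted twice into a form. The surviving terms come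
  in two groups of opposite sign, which \<open>mp\<close> and \<open>2\<close> bring to the same
  shape \<open>prism s (s \<circ> s)\<close>. Hence a cochain obtained by contraction is itself
  killed by contraction.\<close>

lemma prism_prism: "prism (\<lambda>x. x) s (prism (\<lambda>x. x) s c) xs = 0"
proof (induction xs arbitrary: c)
  case (Cons x xs)
  have mp: "prism (\<lambda>x. x) s c (map s xs) = prism s (s \<circ> s) c xs" for xs and c :: "'a list \<Rightarrow> real"
    by (induction xs arbitrary: c) auto
  have 1: "prism (\<lambda>x. x) s (\<lambda>ys. prism (\<lambda>x. x) s c (x # ys)) xs
    = prism (\<lambda>x. x) s (\<lambda>ys. c (x # s x # map s ys)) xs
       - prism (\<lambda>x. x) s (prism (\<lambda>x. x) s (\<lambda>ys. c (x # ys))) xs"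
    by (simp add: prism_diff)
  have 2: "prism (\<lambda>x. x) s (\<lambda>ys. c' (map s ys)) xs = prism s (s \<circ> s) c' xs" for c' :: "'a list \<Rightarrow> real"
    by (induction xs arbitrary: c') (auto simp del: o_apply simp add: o_def)
  show ?case
    using Cons.IH[of "\<lambda>ys. c (x # ys)"] 1 mp[of "\<lambda>ys. c (x # s x # ys)" xs] 2[of "\<lambda>ys. c (x # s x # ys)"]
    by simp
qed simp

lemma bounded_cochain_prism:
  assumes "bounded_cochain c" shows "bounded_cochain (prism f g c)"
proof -
  have "\<exists>B. \<forall>xs. length xs = n \<longrightarrow> \<bar>prism f g c xs\<bar> \<le> B"
    if "\<And>k. \<exists>B. \<forall>xs. length xs = k \<longrightarrow> \<bar>c xs\<bar> \<le> B" for n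
  proof -
    from that obtain B where B: "\<And>xs. \<bar>c xs\<bar> \<le> B (length xs)" by metis
    have "\<bar>prism f g c xs\<bar> \<le> real (length xs) * B (Suc (length xs))"
      if "\<And>xs. \<bar>c xs\<bar> \<le> B (length xs)" for xs B
      using that
    proof (induction xs arbitrary: c B)
      case (Cons x xs)
      have "\<bar>prism f g (\<lambda>ys. c (f x # ys)) xs\<bar> \<le> real (length xs) * (\<lambda>n. B (Suc n)) (Suc (length xs))"
        by (rule Cons.IH) (metis Cons.prems length_Cons)
      moreover have "\<bar>c (f x # map g (x # xs))\<bar> \<le> B (Suc (Suc (length xs)))"
        using Cons.prems[of "f x # map g (x # xs)"] by simp
      ultimately show ?case by (simp add: algebra_simps abs_le_iff)
    qed simp
    from this[OF B] show ?thesis by (intro exI[of _ "real n * B (Suc n)"]) auto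
  qed
  then show ?thesis using assms unfolding bounded_cochain_def by blast
qed

lemma bounded_cochain_scale:
  assumes "bounded_cochain c" shows "bounded_cochain (\<lambda>xs. k * c xs)"
  unfolding bounded_cochain_def
proof
  fix n
  obtain B where "\<And>xs. length xs = n \<Longrightarrow> \<bar>c xs\<bar> \<le> B"
    using assms unfolding bounded_cochain_def by blast
  then have "\<bar>k * c xs\<bar> \<le> \<bar>k\<bar> * B" if "length xs = n" for xs
    using that by (simp add: abs_mult mult_left_mono)
  then show "\<exists>B. \<forall>xs. length xs = n \<longrightarrow> \<bar>k * c xs\<bar> \<le> B" by blast
qed

lemma bounded_cochain_diff:
  assumes "bounded_cochain c" "bounded_cochain c'" shows "bounded_cochain (\<lambda>xs. c xs - c' xs)"
  unfolding bounded_cochain_def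
proof
  fix n
  obtain B where B: "\<And>xs. length xs = n \<Longrightarrow> \<bar>c xs\<bar> \<le> B"
    using assms unfolding bounded_cochain_def by blast
  obtain B' where B': "\<And>xs. length xs = n \<Longrightarrow> \<bar>c' xs\<bar> \<le> B'"
    using assms unfolding bounded_cochain_def by blast
  have "\<bar>c xs - c' xs\<bar> \<le> B + B'" if "length xs = n" for xs
    using B[OF that] B'[OF that] by linarith
  then show "\<exists>B. \<forall>xs. length xs = n \<longrightarrow> \<bar>c xs - c' xs\<bar> \<le> B" by blast
qed

lemma bounded_cochain_coboundary:
  assumes "bounded_cochain c" shows "bounded_cochain (coboundary c)"
proof -
  have "\<exists>B. \<forall>xs. length xs = n \<longrightarrow> \<bar>coboundary c xs\<bar> \<le> B"
    if "\<And>k. \<exists>B. \<forall>xs. length xs = k \<longrightarrow> \<bar>c xs\<bar> \<le> B" for n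
  proof -
    from that obtain B where B: "\<And>xs. \<bar>c xs\<bar> \<le> B (length xs)" by metis
    have "\<bar>coboundary c xs\<bar> \<le> real (length xs) * B (length xs - 1)"
      if "\<And>xs. \<bar>c xs\<bar> \<le> B (length xs)" for xs B
      using that
    proof (induction xs arbitrary: c B)
      case (Cons x xs)
      have "\<bar>coboundary (\<lambda>ys. c (x # ys)) xs\<bar> \<le> real (length xs) * (\<lambda>n. B (Suc n)) (length xs - 1)"
        by (rule Cons.IH) (metis Cons.prems length_Cons)
      then have "\<bar>coboundary (\<lambda>ys. c (x # ys)) xs\<bar> \<le> real (length xs) * B (length xs)"
        by (cases xs) auto
      moreover have "\<bar>c xs\<bar> \<le> B (length xs)"
        using Cons.prems by simp
      ultimately show ?case by (simp add: algebra_simps abs_le_iff)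
    qed simp
    from this[OF B] show ?thesis by (intro exI[of _ "real n * B (n - 1)"]) auto
  qed
  then show ?thesis using assms unfolding bounded_cochain_def by blast
qed

lemma bounded_cochain_cup:
  assumes t: "\<And>x y. \<bar>t x y\<bar> \<le> C" and c: "bounded_cochain c"
  shows "bounded_cochain (cup t c)"
  unfolding bounded_cochain_def
proof
  fix n
  obtain B where B: "\<And>xs. length xs = n - 1 \<Longrightarrow> \<bar>c xs\<bar> \<le> B"
    using c unfolding bounded_cochain_def by blast
  have B0: "0 \<le> B" using B[of "replicate (n - 1) undefined"] by simp
  have C0: "0 \<le> C" using t[of undefined undefined] by simp
  have "\<bar>cup t c xs\<bar> \<le> C * B" if n: "length xs = n" for xs
  proof (cases "(t, c, xs)" rule: cup.cases)
    case (1 t' c' x y ys)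
    then show ?thesis using n t[of x y] B[of "y # ys"] B0 C0
      by (auto simp: abs_mult intro!: mult_mono)
  qed (use B0 C0 in auto)
  then show "\<exists>B. \<forall>xs. length xs = n \<longrightarrow> \<bar>cup t c xs\<bar> \<le> B" by blast
qed

text \<open>The product of the curvatures \<open>d t\<^sub>1, \<dots>, d t\<^sub>n\<close>, written as an iterated coboundary so that
  closedness is automatic; see \<open>curvatures_unfold\<close>.\<close>

fun curvatures :: "('a \<Rightarrow> 'a \<Rightarrow> real) list \<Rightarrow> 'a list \<Rightarrow> real" where
  "curvatures [] xs = (if length xs = 1 then 1 else 0)"
| "curvatures (t # ts) xs = coboundary (cup t (curvatures ts)) xs"

lemma curvatures_Cons: "curvatures (t # ts) = coboundary (cup t (curvatures ts))"
  by (rule ext) simp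

lemma coboundary_curvatures: "coboundary (curvatures ts) xs = 0"
proof (cases ts)
  case Nil
  have "coboundary (curvatures []) xs = 0"
  proof (cases xs)
    case (Cons x ys)
    show ?thesis
    proof (cases ys)
      case Nil
      then show ?thesis using Cons by simp
    next
      case (Cons y zs)
      have "coboundary (\<lambda>l. curvatures [] (x # y # l)) zs = coboundary (\<lambda>_. 0) zs"
        by (rule coboundary_cong) simp
      then show ?thesis using \<open>xs = x # ys\<close> Cons by simp
    qed
  qed simp
  then show ?thesis using Nil by simp
next
  case (Cons t ts')
  then show ?thesis by (simp only: curvatures_Cons coboundary_coboundary)
qed

lemma curvatures_Nil_arg [simp]: "curvatures ts [] = 0"
  by (cases ts) auto

text \<open>The graded Leibniz rule, whose second term is gone because \<open>c\<close> is
  closed.\<close>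

lemma coboundary_cup:
  assumes "\<And>xs. coboundary c xs = 0"
  shows "coboundary (cup t c) (x # y # z # zs) = (t y z - t x z + t x y) * c (z # zs)"
proof -
  have "coboundary (\<lambda>l. c (y # l)) (z # zs) = c (z # zs)"
    using assms[of "y # z # zs"] by simp
  then have "coboundary (\<lambda>l. cup t c (x # y # l)) (z # zs) = t x y * c (z # zs)"
    by (simp only: cup.simps coboundary_scale)
  then show ?thesis by (simp add: algebra_simps)
qed

lemma curvatures_unfold:
  "curvatures (t # ts) (x # y # z # zs) = (t y z - t x z + t x y) * curvatures ts (z # zs)"
  unfolding curvatures_Cons by (rule coboundary_cup[OF coboundary_curvatures])

lemma curvatures_short [simp]: "curvatures (t # ts) [x] = 0" "curvatures (t # ts) [x, y] = 0"
  by simp_all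

text \<open>By \<open>curvatures_unfold\<close> each factor reads three consecutive entries of the
  list, all of them in \<open>S\<close>, so one factor that is flat on \<open>S\<close> kills the
  whole product.\<close>

lemma curvatures_eq_0:
  assumes "t \<in> set ts" "\<And>x y z. \<lbrakk>x \<in> S; y \<in> S; z \<in> S\<rbrakk> \<Longrightarrow> t y z - t x z + t x y = 0"
    and "set xs \<subseteq> S"
  shows "curvatures ts xs = 0"
  using assms(1,3)
proof (induction ts arbitrary: xs)
  case (Cons u us)
  consider "xs = []" | x where "xs = [x]" | x y where "xs = [x, y]" | x y z zs where "xs = x # y # z # zs"
    by (metis list.exhaust)
  then show ?case
  proof cases
    case 4
    then show ?thesis
      using Cons assms(2)[of x y z] by (cases "u = t") (auto simp del: curvatures.simps simp: curvatures_unfold)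
  qed (auto simp del: curvatures.simps)
qed simp

lemma curvatures_invariant:
  assumes "\<And>t x y. t \<in> set ts \<Longrightarrow> t (s x) (s y) = t x y"
  shows "curvatures ts (map s xs) = curvatures ts xs"
  using assms
proof (induction ts arbitrary: xs)
  case (Cons t ts)
  have IH: "curvatures ts (map s xs) = curvatures ts xs" for xs
    by (rule Cons.IH) (use Cons.prems in auto)
  have "cup t (curvatures ts) (map s ys) = cup t (curvatures ts) ys" for ys
    using Cons.prems[of t] IH[of "tl ys"] by (cases "(t, curvatures ts, ys)" rule: cup.cases) auto
  then show ?case by (simp add: coboundary_map)
qed simp

lemma bounded_cochain_curvatures:
  assumes "\<And>t. t \<in> set ts \<Longrightarrow> \<exists>C. \<forall>x y. \<bar>t x y\<bar> \<le> C"
  shows "bounded_cochain (curvatures ts)"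
  using assms
proof (induction ts)
  case Nil
  show ?case unfolding bounded_cochain_def by (auto intro!: exI[of _ 1])
next
  case (Cons t ts)
  obtain C where C: "\<And>x y. \<bar>t x y\<bar> \<le> C" using Cons.prems[of t] by auto
  show ?case unfolding curvatures_Cons
    by (intro bounded_cochain_coboundary bounded_cochain_cup[OF C] Cons.IH Cons.prems) simp
qed

text \<open>Contraction is an antiderivation: it turns \<open>t\<close> into the constant
  \<open>\<alpha>\<close>, and passing the degree-one cochain \<open>t\<close> gives the sign of the
  second term. Invariance of \<open>c\<close> removes the translation of the tail;
  \<open>c [] = 0\<close> covers the empty list.\<close>

lemma prism_cup:
  assumes "\<And>x. t x (s x) = \<alpha>" and "\<And>xs. c (map s xs) = c xs" and "c [] = 0"
  shows "prism (\<lambda>x. x) s (cup t c) xs = \<alpha> * c xs - cup t (prism (\<lambda>x. x) s c) xs"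
proof (cases xs)
  case (Cons x ys)
  have c: "c (s x # map s ys) = c (x # ys)" for x ys using assms(2)[of "x # ys"] by simp
  show ?thesis
  proof (cases ys)
    case Nil
    then show ?thesis using Cons c[of x "[]"] by (simp add: assms)
  next
    case (Cons y zs)
    have "prism (\<lambda>x. x) s (\<lambda>l. cup t c (x # l)) (y # zs)
        = t x y * c (y # s y # map s zs) - prism (\<lambda>x. x) s (\<lambda>l. t x y * c (y # l)) zs"
      by simp
    also have "\<dots> = t x y * prism (\<lambda>x. x) s c (y # zs)"
      by (simp add: prism_scale algebra_simps)
    finally show ?thesis using \<open>xs = x # ys\<close> Cons c[of x "y # zs"] by (simp add: assms)
  qed
qed (simp add: assms)

text \<open>Curvature is basic. The cup product of \<open>t\<close> with the remaining curvatures is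
  invariant, so \<open>prism_homotopy\<close> lets contraction and coboundary anticommute on it; its
  contraction is \<open>\<alpha>\<close> times a closed cochain.\<close>

lemma prism_curvatures:
  assumes "\<And>t x. t \<in> set ts \<Longrightarrow> t x (s x) = \<alpha>"
    and "\<And>t x y. t \<in> set ts \<Longrightarrow> t (s x) (s y) = t x y"
  shows "prism (\<lambda>x. x) s (curvatures ts) xs = 0"
  using assms
proof (induction ts arbitrary: xs)
  case Nil
  show ?case
    by (rule trans[OF prism_cong[where c' = "\<lambda>_. 0"] prism_zero]; cases xs) auto
next
  case (Cons t ts)
  have inv: "curvatures ts (map s xs) = curvatures ts xs" for xs
    by (rule curvatures_invariant) (use Cons.prems in auto)
  have inv': "cup t (curvatures ts) (map s ys) = cup t (curvatures ts) ys" for ys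
    using Cons.prems(2)[of t] inv[of "tl ys"] by (cases "(t, curvatures ts, ys)" rule: cup.cases) auto
  have IH: "prism (\<lambda>x. x) s (curvatures ts) = (\<lambda>_. 0)"
    by (rule ext, rule Cons.IH) (use Cons.prems in auto)
  have "prism (\<lambda>x. x) s (cup t (curvatures ts)) ys = \<alpha> * curvatures ts ys - cup t (prism (\<lambda>x. x) s (curvatures ts)) ys" for ys
    by (rule prism_cup) (use Cons.prems inv in auto)
  moreover have "cup t (\<lambda>_. 0) ys = 0" for ys :: "'a list"
    by (cases "(t, (\<lambda>_. 0) :: 'a list \<Rightarrow> real, ys)" rule: cup.cases) auto
  ultimately have "prism (\<lambda>x. x) s (cup t (curvatures ts)) = (\<lambda>ys. \<alpha> * curvatures ts ys)"
    by (auto simp: IH)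
  then have "coboundary (prism (\<lambda>x. x) s (cup t (curvatures ts))) xs = 0"
    by (simp add: coboundary_scale coboundary_curvatures)
  then show ?case
    using prism_homotopy[of "\<lambda>x. x" s "cup t (curvatures ts)" xs] inv'[of xs]
    by (simp add: curvatures_Cons)
qed

section \<open>Banach limits and averaged cochains\<close>

text \<open>Tychonoff: the sequence lives in a product of compact intervals and has a cluster point
  there. Such a point is approximated in finitely many coordinates at arbitrarily late indices,
  which replaces a convergent subsequence. The coordinates are bounded sequences for Banach limits
  and group elements for Arzela-Ascoli.\<close>

lemma bounded_functions_cluster:
  fixes u :: "nat \<Rightarrow> 'i \<Rightarrow> real"
  assumes "\<And>k i. \<bar>u k i\<bar> \<le> B i"
  obtains h where "\<And>i. \<bar>h i\<bar> \<le> B i"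
    and "\<And>I e N. finite I \<Longrightarrow> 0 < e \<Longrightarrow> \<exists>k\<ge>N. \<forall>i\<in>I. \<bar>u k i - h i\<bar> < e"
proof -
  let ?K = "PiE UNIV (\<lambda>i. {- B i..B i})"
  have "compactin (product_topology (\<lambda>_. euclidean) UNIV) ?K"
    by (auto simp: compactin_PiE)
  then have "compact ?K"
    by (simp add: euclidean_product_topology)
  moreover have "eventually (\<lambda>x. x \<in> ?K) (filtermap u sequentially)"
    using assms by (auto simp: eventually_filtermap PiE_iff abs_le_iff minus_le_iff)
  moreover have "filtermap u sequentially \<noteq> bot"
    by (simp add: filtermap_bot_iff)
  ultimately obtain h where h: "h \<in> ?K" and nb: "inf (nhds h) (filtermap u sequentially) \<noteq> bot"
    unfolding compact_filter by blast
  show thesis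
  proof
    show "\<bar>h i\<bar> \<le> B i" for i
      using h by (auto simp: PiE_iff abs_le_iff minus_le_iff)
    show "\<exists>k\<ge>N. \<forall>i\<in>I. \<bar>u k i - h i\<bar> < e" if "finite I" "0 < e" for I e and N :: nat
    proof -
      let ?S = "\<Inter>i\<in>I. (\<lambda>g. g i) -` {h i - e<..<h i + e}"
      have "open ?S"
        using that by (intro open_INT ballI open_vimage continuous_on_product_coordinates) auto
      then have "eventually (\<lambda>g. g \<in> ?S) (nhds h)"
        using that by (intro eventually_nhds_in_open) auto
      moreover have "eventually (\<lambda>g. g \<in> u ` {N..}) (filtermap u sequentially)"
        by (auto simp: eventually_filtermap eventually_sequentially)
      ultimately have "eventually (\<lambda>g. g \<in> ?S \<and> g \<in> u ` {N..}) (inf (nhds h) (filtermap u sequentially))"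
        by (auto simp: eventually_inf)
      then obtain g where "g \<in> ?S" "g \<in> u ` {N..}"
        using eventually_happens'[OF nb] by blast
      then obtain k where "k \<ge> N" "u k \<in> ?S" by auto
      then show ?thesis by (intro exI[of _ k]) (auto simp: abs_less_iff)
    qed
  qed
qed

definition bounded_seq :: "(nat \<Rightarrow> real) \<Rightarrow> bool" where
  "bounded_seq u \<longleftrightarrow> (\<exists>B. \<forall>k. \<bar>u k\<bar> \<le> B)"

text \<open>A cluster point of the Cesaro means, seen as functions of the sequence. Linearity is
  stated for differences because coboundaries are built from differences.\<close>

lemma banach_limit_exists:
  obtains m :: "(nat \<Rightarrow> real) \<Rightarrow> real"
  where "\<And>u v. bounded_seq u \<Longrightarrow> bounded_seq v \<Longrightarrow> m (\<lambda>k. u k - v k) = m u - m v"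
    and "\<And>c. m (\<lambda>_. c) = c"
    and "\<And>u. bounded_seq u \<Longrightarrow> m (\<lambda>k. u (Suc k)) = m u"
    and "\<And>u B. (\<And>k. \<bar>u k\<bar> \<le> B) \<Longrightarrow> \<bar>m u\<bar> \<le> B"
proof -
  \<comment> \<open>Unbounded sequences get the average 0, so that every coordinate has a finite
    bound \<open>Bd u\<close>.\<close>
  define avg where "avg = (\<lambda>n u. if bounded_seq u then (\<Sum>k\<le>n. u k) / real (Suc n) else 0)"
  define Bd where "Bd = (\<lambda>u :: nat \<Rightarrow> real. if bounded_seq u then (SUP k. \<bar>u k\<bar>) else 0)"
  have avg_le: "\<bar>avg n u\<bar> \<le> B" if "\<And>k. \<bar>u k\<bar> \<le> B" for n u B
  proof -
    have "bounded_seq u" using that unfolding bounded_seq_def by blast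
    have "\<bar>\<Sum>k\<le>n. u k\<bar> \<le> (\<Sum>k\<le>n. \<bar>u k\<bar>)" by (rule sum_abs)
    also have "\<dots> \<le> (\<Sum>k\<le>n. B)" by (rule sum_mono) (rule that)
    finally show ?thesis
      using \<open>bounded_seq u\<close> by (simp add: avg_def abs_divide pos_divide_le_eq mult.commute del: of_nat_Suc)
  qed
  have "\<And>n u. \<bar>avg n u\<bar> \<le> Bd u"
  proof -
    fix n u show "\<bar>avg n u\<bar> \<le> Bd u"
  proof (cases "bounded_seq u")
    case True
    then have "bdd_above (range (\<lambda>k. \<bar>u k\<bar>))"
      unfolding bounded_seq_def by (auto intro: bdd_aboveI2)
    then have "\<bar>u k\<bar> \<le> Bd u" for k
      using True by (auto simp: Bd_def intro: cSUP_upper)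
    then show ?thesis by (rule avg_le)
  qed (simp add: avg_def Bd_def)
  qed
  then obtain m where "\<And>u. \<bar>m u\<bar> \<le> Bd u"
    and m: "\<And>I e N. finite I \<Longrightarrow> 0 < e \<Longrightarrow> \<exists>n\<ge>N. \<forall>u\<in>I. \<bar>avg n u - m u\<bar> < e"
    by (rule bounded_functions_cluster[of avg Bd]) (rule that)
  show thesis
  proof
    fix u v :: "nat \<Rightarrow> real" assume b: "bounded_seq u" "bounded_seq v"
    obtain B C where "\<And>k. \<bar>u k\<bar> \<le> B" "\<And>k. \<bar>v k\<bar> \<le> C"
      using b unfolding bounded_seq_def by blast
    then have "\<bar>u k - v k\<bar> \<le> B + C" for k
      by (metis abs_triangle_ineq4 add_mono order_trans)
    then have b': "bounded_seq (\<lambda>k. u k - v k)"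
      unfolding bounded_seq_def by blast
    have "\<bar>m (\<lambda>k. u k - v k) - (m u - m v)\<bar> \<le> 0 + e" if "0 < e" for e
    proof -
      obtain n where n: "\<forall>w\<in>{u, v, \<lambda>k. u k - v k}. \<bar>avg n w - m w\<bar> < e / 3"
        using m[of "{u, v, \<lambda>k. u k - v k}" "e / 3" 0] \<open>0 < e\<close> by auto
      have "avg n (\<lambda>k. u k - v k) = avg n u - avg n v"
        using b b' by (simp add: avg_def sum_subtractf diff_divide_distrib)
      then show ?thesis using n by (simp only: ball_simps) linarith
    qed
    then have "\<bar>m (\<lambda>k. u k - v k) - (m u - m v)\<bar> \<le> 0" by (rule field_le_epsilon)
    then show "m (\<lambda>k. u k - v k) = m u - m v" by simp
  next
    fix u :: "nat \<Rightarrow> real" and B assume B: "\<And>k. \<bar>u k\<bar> \<le> B"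
    have "\<bar>m u\<bar> \<le> B + e" if "0 < e" for e
    proof -
      obtain n where "\<bar>avg n u - m u\<bar> < e"
        using m[of "{u}" e 0] \<open>0 < e\<close> by auto
      then show ?thesis using avg_le[of u B n, OF B] by linarith
    qed
    then show "\<bar>m u\<bar> \<le> B" by (rule field_le_epsilon)
  next
    fix c :: real
    have "\<bar>m (\<lambda>_. c) - c\<bar> \<le> 0 + e" if "0 < e" for e
    proof -
      obtain n where "\<bar>avg n (\<lambda>_. c) - m (\<lambda>_. c)\<bar> < e"
        using m[of "{\<lambda>_. c}" e 0] \<open>0 < e\<close> by auto
      moreover have "avg n (\<lambda>_. c) = c"
        by (auto simp: avg_def bounded_seq_def)
      ultimately show ?thesis by (simp add: abs_minus_commute)
    qed
    then have "\<bar>m (\<lambda>_. c) - c\<bar> \<le> 0" by (rule field_le_epsilon)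
    then show "m (\<lambda>_. c) = c" by simp
  next
    fix u :: "nat \<Rightarrow> real" assume b: "bounded_seq u"
    then obtain B where B: "\<And>k. \<bar>u k\<bar> \<le> B" unfolding bounded_seq_def by blast
    then have b': "bounded_seq (\<lambda>k. u (Suc k))" unfolding bounded_seq_def by blast
    have B0: "0 \<le> B" using B[of 0] by simp
    have "\<bar>m (\<lambda>k. u (Suc k)) - m u\<bar> \<le> 0 + e" if "0 < e" for e
    proof -
      \<comment> \<open>The Cesaro means of a sequence and of its shift differ by
        \<open>(u (Suc n) - u 0) / (n + 1)\<close>, at most \<open>e / 3\<close> from index
        \<open>N\<close> on.\<close>
      obtain N where N: "2 * B / (e / 3) < real N" using reals_Archimedean2 by blast
      obtain n where n: "n \<ge> N" "\<forall>w\<in>{u, \<lambda>k. u (Suc k)}. \<bar>avg n w - m w\<bar> < e / 3"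
        using m[of "{u, \<lambda>k. u (Suc k)}" "e / 3" N] \<open>0 < e\<close> by auto
      have "(\<Sum>k\<le>n. u (Suc k) - u k) = u (Suc n) - u 0" for n
        by (induction n) auto
      then have "avg n (\<lambda>k. u (Suc k)) - avg n u = (u (Suc n) - u 0) / real (Suc n)"
        using b b' by (simp add: avg_def sum_subtractf[symmetric] diff_divide_distrib[symmetric])
      moreover have "\<bar>u (Suc n) - u 0\<bar> \<le> 2 * B"
        using B[of "Suc n"] B[of 0] by linarith
      moreover have "2 * B < e / 3 * real (Suc n)"
      proof -
        have "2 * B / (e / 3) < real (Suc n)" using N n(1) by linarith
        then show ?thesis using that by (subst (asm) pos_divide_less_eq) (auto simp: mult.commute)
      qed
      ultimately have "\<bar>avg n (\<lambda>k. u (Suc k)) - avg n u\<bar> = \<bar>u (Suc n) - u 0\<bar> / real (Suc n)"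
        and "\<bar>u (Suc n) - u 0\<bar> \<le> e / 3 * real (Suc n)"
        by (simp_all only: abs_divide abs_of_nat)
      then have "\<bar>avg n (\<lambda>k. u (Suc k)) - avg n u\<bar> \<le> e / 3"
        by (simp only: pos_divide_le_eq of_nat_0_less_iff zero_less_Suc)
      then show ?thesis using n(2) by (simp only: ball_simps) linarith
    qed
    then have "\<bar>m (\<lambda>k. u (Suc k)) - m u\<bar> \<le> 0" by (rule field_le_epsilon)
    then show "m (\<lambda>k. u (Suc k)) = m u" by simp
  qed
qed

section \<open>Invariant averages of cochains\<close>

lemma bounded_seq_coboundary:
  assumes "\<And>xs. bounded_seq (\<lambda>k. c k xs)"
  shows "bounded_seq (\<lambda>k. coboundary (c k) xs)"
  using assms
proof (induction xs arbitrary: c)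
  case Nil
  show ?case by (auto simp: bounded_seq_def)
next
  case (Cons x xs)
  have "bounded_seq (\<lambda>k. coboundary (\<lambda>ys. c k (x # ys)) xs)"
    by (rule Cons.IH) (rule Cons.prems)
  then obtain B where B: "\<And>k. \<bar>coboundary (\<lambda>ys. c k (x # ys)) xs\<bar> \<le> B"
    unfolding bounded_seq_def by blast
  obtain C where C: "\<And>k. \<bar>c k xs\<bar> \<le> C"
    using Cons.prems[of xs] unfolding bounded_seq_def by blast
  have "\<bar>coboundary (c k) (x # xs)\<bar> \<le> C + B" for k
    using B[of k] C[of k] by simp
  then show ?case unfolding bounded_seq_def by blast
qed

text \<open>The Banach limit over the iterates of \<open>s\<close> ignores one further application
  of \<open>s\<close> and commutes with \<open>coboundary\<close>. \<open>Q\<close> describes the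
  lists on which \<open>c\<close> is a primitive; its stability under \<open>s\<close> keeps all
  iterates of such a list among them.\<close>

lemma average_cochain:
  fixes s :: "'a \<Rightarrow> 'a"
  assumes b: "bounded_cochain c"
    and \<kappa>: "\<And>xs. Q xs \<Longrightarrow> coboundary c xs = \<kappa> xs" "\<And>xs. \<kappa> (map s xs) = \<kappa> xs"
    and Q: "\<And>xs. Q xs \<Longrightarrow> Q (map s xs)"
  obtains c' where "bounded_cochain c'" "\<And>xs. c' (map s xs) = c' xs"
    and "\<And>xs. Q xs \<Longrightarrow> coboundary c' xs = \<kappa> xs"
proof -
  obtain m :: "(nat \<Rightarrow> real) \<Rightarrow> real"
    where m_diff: "\<And>u v. bounded_seq u \<Longrightarrow> bounded_seq v \<Longrightarrow> m (\<lambda>k. u k - v k) = m u - m v"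
    and m_const: "\<And>c. m (\<lambda>_. c) = c"
    and m_Suc: "\<And>u. bounded_seq u \<Longrightarrow> m (\<lambda>k. u (Suc k)) = m u"
    and m_le: "\<And>u B. (\<And>k. \<bar>u k\<bar> \<le> B) \<Longrightarrow> \<bar>m u\<bar> \<le> B"
    by (rule banach_limit_exists) blast
  define c' where "c' = (\<lambda>xs. m (\<lambda>k. c (map (s ^^ k) xs)))"
  have bs: "bounded_seq (\<lambda>k. c (map (s ^^ k) xs))" for xs
    using b unfolding bounded_cochain_def bounded_seq_def by (metis length_map)
  have m_coboundary: "coboundary (\<lambda>xs. m (\<lambda>k. f k xs)) xs = m (\<lambda>k. coboundary (f k) xs)"
    if "\<And>xs. bounded_seq (\<lambda>k. f k xs)" for f :: "nat \<Rightarrow> 'a list \<Rightarrow> real" and xs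
    using that
  proof (induction xs arbitrary: f)
    case Nil
    show ?case by (simp add: m_const)
  next
    case (Cons x xs)
    have "coboundary (\<lambda>ys. m (\<lambda>k. f k (x # ys))) xs = m (\<lambda>k. coboundary (\<lambda>ys. f k (x # ys)) xs)"
      by (rule Cons.IH) (rule Cons.prems)
    then show ?case
      using m_diff[OF Cons.prems[of xs] bounded_seq_coboundary[of "\<lambda>k ys. f k (x # ys)" xs]]
        Cons.prems by simp
  qed
  show thesis
  proof
    show "bounded_cochain c'"
      unfolding bounded_cochain_def c'_def
    proof
      fix n
      obtain B where "\<And>xs. length xs = n \<Longrightarrow> \<bar>c xs\<bar> \<le> B"
        using b unfolding bounded_cochain_def by blast
      then show "\<exists>B. \<forall>xs. length xs = n \<longrightarrow> \<bar>m (\<lambda>k. c (map (s ^^ k) xs))\<bar> \<le> B"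
        by (intro exI[of _ B] allI impI m_le) simp
    qed
    show "c' (map s xs) = c' xs" for xs
    proof -
      have "c' (map s xs) = m (\<lambda>k. c (map (s ^^ Suc k) xs))"
        by (simp only: c'_def map_map funpow_Suc_right)
      also have "\<dots> = c' xs"
        unfolding c'_def by (rule m_Suc[of "\<lambda>k. c (map (s ^^ k) xs)"]) (rule bs)
      finally show ?thesis .
    qed
    show "coboundary c' xs = \<kappa> xs" if "Q xs" for xs
    proof -
      have it: "Q (map (s ^^ k) xs) \<and> \<kappa> (map (s ^^ k) xs) = \<kappa> xs" for k
      proof (induction k)
        case (Suc k)
        have "map (s ^^ Suc k) xs = map s (map (s ^^ k) xs)" by simp
        then show ?case using Suc Q \<kappa>(2) by metis
      qed (use that in simp)
      have "coboundary c' xs = m (\<lambda>k. coboundary (\<lambda>xs. c (map (s ^^ k) xs)) xs)"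
        unfolding c'_def by (rule m_coboundary) (rule bs)
      also have "\<dots> = m (\<lambda>k. \<kappa> xs)"
        using it \<kappa>(1) by (simp add: coboundary_map[symmetric])
      finally show ?thesis by (simp add: m_const)
    qed
  qed
qed

text \<open>All faces of a constant tuple coincide, so the alternating sum is one face or nothing.
  It follows that a closed cochain vanishes on constant lists of even length, which disposes of the
  constant end of a contraction.\<close>

lemma coboundary_replicate:
  "coboundary c (replicate n x) = (if odd n then c (replicate (n - 1) x) else 0)"
proof (induction n arbitrary: c)
  case (Suc n)
  show ?case using Suc.IH[of "\<lambda>ys. c (x # ys)"] by (cases n) auto
qed simp

text \<open>A change of at most \<open>1 / 16\<close> against a modulus of at least
  \<open>3 / 8\<close> is a factor within \<open>1 / 6\<close> of 1. Both factors lie in the right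
  half-plane, so their arguments add without wrapping around.\<close>

lemma Arg_quotient_cocycle:
  fixes x y z :: complex
  assumes "3 / 8 \<le> cmod x" "3 / 8 \<le> cmod y" "3 / 8 \<le> cmod z"
    and "cmod (y - x) \<le> 1 / 16" "cmod (z - y) \<le> 1 / 16"
  shows "Arg (z / x) = Arg (y / x) + Arg (z / y)"
proof -
  have Re: "0 < Re (v / u)" if "3 / 8 \<le> cmod u" "cmod (v - u) \<le> 1 / 16" for u v :: complex
  proof -
    have u: "u \<noteq> 0" using that(1) by auto
    then have "v / u - 1 = (v - u) / u" by (simp add: field_simps)
    then have "cmod (v / u - 1) = cmod (v - u) / cmod u" by (simp add: norm_divide)
    also have "\<dots> \<le> (1 / 16) / (3 / 8)" using that by (intro frac_le) auto
    finally have "cmod (v / u - 1) < 1" by simp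
    then have "\<bar>Re (v / u - 1)\<bar> < 1" using abs_Re_le_cmod order_le_less_trans by blast
    then show ?thesis by simp
  qed
  have ne: "x \<noteq> 0" "y \<noteq> 0" "z \<noteq> 0" using assms by auto
  have "\<bar>Arg (y / x)\<bar> < pi / 2" "\<bar>Arg (z / y)\<bar> < pi / 2"
    using Re[OF assms(1,4)] Re[OF assms(2,5)] by (simp_all only: Arg_Re_pos simp_thms)
  then have "Arg (y / x) + Arg (z / y) \<in> {-pi<..pi}" by auto
  then have "Arg (y / x * (z / y)) = Arg (y / x) + Arg (z / y)"
    using ne by (intro Arg_times) auto
  then show ?thesis using ne by simp
qed

section \<open>Compact groups\<close>

context topological_group
begin

lemma continuous_map_mult:
  "continuous_map Z T f \<Longrightarrow> continuous_map Z T g \<Longrightarrow> continuous_map Z T (\<lambda>z. f z \<otimes> g z)"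
  using continuous_map_compose[OF _ continuous_mult, of Z "\<lambda>z. (f z, g z)"]
  by (simp add: o_def continuous_map_pairedI)

lemma continuous_map_inv: "continuous_map Z T f \<Longrightarrow> continuous_map Z T (\<lambda>z. inv (f z))"
  using continuous_map_compose[OF _ continuous_inv, of Z f] by (simp add: o_def)

end

locale compact_group = topological_group +
  assumes compact_T: "compact_space T"
begin

text \<open>With symmetric, conjugation-invariant neighbourhoods the left and the right uniform
  structure coincide, so closeness survives translation on either side. That they form a base at
  \<open>\<one>\<close> is due to compactness, see \<open>nbhd_oneI\<close>.\<close>

definition nbhd_one :: "'a set \<Rightarrow> bool" where
  "nbhd_one V \<longleftrightarrow> V \<subseteq> carrier G \<and> (\<exists>U. openin T U \<and> \<one> \<in> U \<and> U \<subseteq> V)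
    \<and> (\<forall>x\<in>V. inv x \<in> V) \<and> (\<forall>x\<in>V. \<forall>g\<in>carrier G. g \<otimes> x \<otimes> inv g \<in> V)"

definition close :: "'a set \<Rightarrow> 'a \<Rightarrow> 'a \<Rightarrow> bool" where
  "close V x y \<longleftrightarrow> x \<in> carrier G \<and> y \<in> carrier G \<and> x \<otimes> inv y \<in> V"

text \<open>The tube lemma over the compact group yields a neighbourhood \<open>A\<close> of
  \<open>\<one>\<close> all of whose conjugates lie in \<open>U\<close>. The set \<open>V\<close> is
  the largest symmetric and conjugation-invariant subset of \<open>U\<close>, and contains the
  elements of \<open>A\<close> whose inverse is in \<open>A\<close>.\<close>

lemma nbhd_oneI:
  assumes "openin T U" "\<one> \<in> U"
  obtains V where "nbhd_one V" "V \<subseteq> U"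
proof -
  let ?W = "{p \<in> topspace (prod_topology T T). snd p \<otimes> fst p \<otimes> inv (snd p) \<in> U}"
  have "openin (prod_topology T T) ?W"
    by (rule openin_continuous_map_preimage[OF _ assms(1)])
      (intro continuous_map_mult continuous_map_inv continuous_map_fst continuous_map_snd)
  moreover have "{\<one>} \<times> carrier G \<subseteq> ?W"
    using assms by (auto simp: topspace_eq_carrier)
  ultimately obtain A B where AB: "openin T A" "\<one> \<in> A" "carrier G \<subseteq> B" "A \<times> B \<subseteq> ?W"
    using tube_lemma_right[of T T ?W "carrier G" \<one>] compact_T
    by (auto simp: topspace_eq_carrier compact_space_def)
  define V where "V = {v \<in> carrier G. \<forall>g\<in>carrier G. g \<otimes> v \<otimes> inv g \<in> U \<and> g \<otimes> inv v \<otimes> inv g \<in> U}"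
  have A: "A \<subseteq> carrier G" using AB(1) openin_subset topspace_eq_carrier by metis
  have conj: "g \<otimes> a \<otimes> inv g \<in> U" if "a \<in> A" "g \<in> carrier G" for a g
    using subsetD[OF AB(4), of "(a, g)"] AB(3) that by auto
  have "openin T (A \<inter> {x \<in> topspace T. inv x \<in> A})"
    by (intro openin_Int AB openin_continuous_map_preimage[OF continuous_inv])
  moreover have "A \<inter> {x \<in> topspace T. inv x \<in> A} \<subseteq> V"
    using conj A by (auto simp: V_def)
  moreover have "\<one> \<in> A \<inter> {x \<in> topspace T. inv x \<in> A}"
    using AB(2) by (auto simp: topspace_eq_carrier)
  moreover have "inv x \<in> V" if "x \<in> V" for x using that by (auto simp: V_def)
  moreover have "h \<otimes> x \<otimes> inv h \<in> V" if "x \<in> V" "h \<in> carrier G" for x h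
  proof -
    have x: "x \<in> carrier G" and U: "\<And>g. g \<in> carrier G \<Longrightarrow> g \<otimes> x \<otimes> inv g \<in> U \<and> g \<otimes> inv x \<otimes> inv g \<in> U"
      using that by (auto simp: V_def)
    have "g \<otimes> (h \<otimes> x \<otimes> inv h) \<otimes> inv g = (g \<otimes> h) \<otimes> x \<otimes> inv (g \<otimes> h)"
      "g \<otimes> inv (h \<otimes> x \<otimes> inv h) \<otimes> inv g = (g \<otimes> h) \<otimes> inv x \<otimes> inv (g \<otimes> h)" if "g \<in> carrier G" for g
      using that x \<open>h \<in> carrier G\<close> by (auto simp: inv_mult_group m_assoc)
    then show ?thesis using x U that(2) by (auto simp: V_def)
  qed
  moreover have "V \<subseteq> carrier G" by (auto simp: V_def)
  ultimately have "nbhd_one V" unfolding nbhd_one_def by blast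
  moreover have "V \<subseteq> U"
  proof
    fix v assume "v \<in> V"
    then have "v \<in> carrier G" "\<one> \<otimes> v \<otimes> inv \<one> \<in> U" unfolding V_def by blast+
    then show "v \<in> U" by simp
  qed
  ultimately show thesis ..
qed

lemma nbhd_one_tube:
  assumes "compact_space Y" "openin (prod_topology Y T) W" "topspace Y \<times> {\<one>} \<subseteq> W"
  obtains V where "nbhd_one V" "topspace Y \<times> V \<subseteq> W"
proof -
  obtain A B where "openin T B" "topspace Y \<subseteq> A" "\<one> \<in> B" "A \<times> B \<subseteq> W"
    using tube_lemma_left[OF assms(2), of "topspace Y" \<one>] assms
    by (auto simp: topspace_eq_carrier compact_space_def)
  moreover obtain V where "nbhd_one V" "V \<subseteq> B" using nbhd_oneI calculation by metis
  ultimately show thesis using that by (meson Sigma_mono order_trans)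
qed

lemma nbhd_one_subset: "nbhd_one V \<Longrightarrow> V \<subseteq> carrier G"
  by (simp add: nbhd_one_def)

lemma nbhd_one_one: "nbhd_one V \<Longrightarrow> \<one> \<in> V"
  by (auto simp: nbhd_one_def)

lemma nbhd_one_Int:
  assumes "nbhd_one U" "nbhd_one V" shows "nbhd_one (U \<inter> V)"
proof -
  obtain A B where "openin T A" "\<one> \<in> A" "A \<subseteq> U" "openin T B" "\<one> \<in> B" "B \<subseteq> V"
    using assms unfolding nbhd_one_def by blast
  then have "\<exists>C. openin T C \<and> \<one> \<in> C \<and> C \<subseteq> U \<inter> V"
    by (intro exI[of _ "A \<inter> B"]) auto
  then show ?thesis using assms unfolding nbhd_one_def by (simp add: le_infI1)
qed

lemma nbhd_one_square:
  assumes "nbhd_one V"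
  obtains U where "nbhd_one U" "U \<subseteq> V" "\<And>x y. x \<in> U \<Longrightarrow> y \<in> U \<Longrightarrow> x \<otimes> y \<in> V"
proof -
  obtain O' where O': "openin T O'" "\<one> \<in> O'" "O' \<subseteq> V" using assms unfolding nbhd_one_def by blast
  have "openin (prod_topology T T) {p \<in> topspace (prod_topology T T). fst p \<otimes> snd p \<in> O'}"
    by (rule openin_continuous_map_preimage[OF _ O'(1)])
      (intro continuous_map_mult continuous_map_fst continuous_map_snd)
  moreover have "(\<one>, \<one>) \<in> {p \<in> topspace (prod_topology T T). fst p \<otimes> snd p \<in> O'}"
    using O' by (auto simp: topspace_eq_carrier)
  ultimately obtain A B where AB: "openin T A" "openin T B" "\<one> \<in> A" "\<one> \<in> B"
    "A \<times> B \<subseteq> {p \<in> topspace (prod_topology T T). fst p \<otimes> snd p \<in> O'}"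
    unfolding openin_prod_topology_alt by meson
  obtain U where "nbhd_one U" "U \<subseteq> A \<inter> B"
    using nbhd_oneI[of "A \<inter> B"] AB by auto
  then have "nbhd_one (U \<inter> V)" and "\<And>x y. x \<in> U \<Longrightarrow> y \<in> U \<Longrightarrow> x \<otimes> y \<in> V"
    using subsetD[OF AB(5)] O'(3) assms by (force simp: nbhd_one_Int)+
  then show thesis using that[of "U \<inter> V"] by auto
qed

lemma close_refl: "nbhd_one V \<Longrightarrow> x \<in> carrier G \<Longrightarrow> close V x x"
  by (simp add: close_def nbhd_one_one)

lemma close_sym:
  assumes "nbhd_one V" "close V x y" shows "close V y x"
proof -
  have "inv (x \<otimes> inv y) = y \<otimes> inv x" using assms by (simp add: close_def inv_mult_group)
  then show ?thesis using assms unfolding close_def nbhd_one_def by metis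
qed

lemma close_trans:
  assumes "close U x y" "close U y z" "\<And>x y. x \<in> U \<Longrightarrow> y \<in> U \<Longrightarrow> x \<otimes> y \<in> V"
  shows "close V x z"
proof -
  have "(x \<otimes> inv y) \<otimes> (y \<otimes> inv z) = x \<otimes> inv z"
    using assms(1,2) by (simp add: close_def m_assoc) (metis inv_closed inv_solve_left m_assoc m_closed)
  then show ?thesis using assms unfolding close_def by metis
qed

lemma close_mult_right:
  assumes "close V x y" "g \<in> carrier G" shows "close V (x \<otimes> g) (y \<otimes> g)"
proof -
  have "x \<otimes> g \<otimes> inv (y \<otimes> g) = x \<otimes> inv y"
    using assms unfolding close_def
    by (simp add: inv_mult_group m_assoc) (metis inv_closed l_one m_assoc r_inv)
  then show ?thesis using assms unfolding close_def by simp
qed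

lemma close_mult_left:
  assumes "nbhd_one V" "close V x y" "g \<in> carrier G" shows "close V (g \<otimes> x) (g \<otimes> y)"
proof -
  have "g \<otimes> x \<otimes> inv (g \<otimes> y) = g \<otimes> (x \<otimes> inv y) \<otimes> inv g"
    using assms unfolding close_def by (simp add: inv_mult_group m_assoc)
  then show ?thesis using assms unfolding close_def nbhd_one_def by simp
qed

lemma close_mono: "U \<subseteq> V \<Longrightarrow> close U x y \<Longrightarrow> close V x y"
  by (auto simp: close_def)

lemma close_mult_self:
  assumes "nbhd_one V" "a \<in> V" "x \<in> carrier G" shows "close V (x \<otimes> a) x"
  using assms unfolding close_def nbhd_one_def by auto


section \<open>The obstruction to contractibility\<close>

definition small :: "'a set \<Rightarrow> 'a set \<Rightarrow> bool" where
  "small V S \<longleftrightarrow> (\<forall>x\<in>S. \<forall>y\<in>S. close V x y)"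

lemma small_subset: "small V S \<Longrightarrow> S' \<subseteq> S \<Longrightarrow> small V S'"
  unfolding small_def by (meson subsetD)

lemma nbhd_one_square_close:
  assumes "nbhd_one V"
  obtains U where "nbhd_one U" "U \<subseteq> V" "\<And>x y z. close U x y \<Longrightarrow> close U y z \<Longrightarrow> close V x z"
proof -
  obtain U where U: "nbhd_one U" "U \<subseteq> V" "\<And>x y. x \<in> U \<Longrightarrow> y \<in> U \<Longrightarrow> x \<otimes> y \<in> V"
    using nbhd_one_square[OF assms] by metis
  show thesis
    by (rule that[OF U(1,2)]) (rule close_trans[OF _ _ U(3)])
qed

text \<open>Equicontinuity of the maps at all times at once. A pair of points is coded as
  \<open>(x, u)\<close> with \<open>u = x \<otimes> inv y\<close>, so that
  \<open>y = inv u \<otimes> x\<close>, and the tube lemma is applied around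
  \<open>u = \<one>\<close>. The same substitution gives
  \<open>continuous_map_uniform\<close>.\<close>

lemma homotopy_uniform:
  assumes h: "continuous_map (prod_topology (top_of_set {0..1::real}) T) T h" and V: "nbhd_one V"
  obtains U where "nbhd_one U"
    "\<And>t x y. t \<in> {0..1} \<Longrightarrow> close U x y \<Longrightarrow> close V (h (t, x)) (h (t, y))"
proof -
  let ?Y = "prod_topology (top_of_set {0..1::real}) T"
  obtain Q where Q: "openin T Q" "\<one> \<in> Q" "Q \<subseteq> V" using V unfolding nbhd_one_def by blast
  have hc: "h (t, x) \<in> carrier G" if "t \<in> {0..1}" "x \<in> carrier G" for t x
    using continuous_map_image_subset_topspace[OF h] that by (auto simp: topspace_eq_carrier)
  let ?W = "{p \<in> topspace (prod_topology ?Y T).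
      h (fst p) \<otimes> inv (h (fst (fst p), inv (snd p) \<otimes> snd (fst p))) \<in> Q}"
  have fst': "continuous_map (prod_topology ?Y T) ?Y fst"
    and snd': "continuous_map (prod_topology ?Y T) T snd"
    by (rule continuous_map_fst continuous_map_snd)+
  have ff: "continuous_map (prod_topology ?Y T) (top_of_set {0..1}) (\<lambda>p. fst (fst p))"
    using continuous_map_compose[OF fst' continuous_map_fst] by (simp add: o_def)
  have sf: "continuous_map (prod_topology ?Y T) T (\<lambda>p. snd (fst p))"
    using continuous_map_compose[OF fst' continuous_map_snd] by (simp add: o_def)
  have 1: "continuous_map (prod_topology ?Y T) T (\<lambda>p. h (fst p))"
    using continuous_map_compose[OF fst' h] by (simp add: o_def)
  have 2: "continuous_map (prod_topology ?Y T) T (\<lambda>p. h (fst (fst p), inv (snd p) \<otimes> snd (fst p)))"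
    using continuous_map_compose[OF _ h, of "prod_topology ?Y T" "\<lambda>p. (fst (fst p), inv (snd p) \<otimes> snd (fst p))"]
    by (simp add: o_def continuous_map_pairedI ff sf snd' continuous_map_mult continuous_map_inv)
  have opW: "openin (prod_topology ?Y T) ?W"
    by (rule openin_continuous_map_preimage[OF _ Q(1)]) (intro continuous_map_mult continuous_map_inv 1 2)
  have subW: "topspace ?Y \<times> {\<one>} \<subseteq> ?W"
    using Q hc by (auto simp: topspace_eq_carrier)
  have cpt: "compact_space ?Y"
    using compact_T by (simp add: compact_space_prod_topology compact_space_subtopology compactin_euclidean_iff)
  obtain U where U: "nbhd_one U" "topspace ?Y \<times> U \<subseteq> ?W"
    by (rule nbhd_one_tube[OF cpt opW subW])
  show thesis
  proof
    show "nbhd_one U" by fact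
    fix t x y assume t: "t \<in> {0..1::real}" and xy: "close U x y"
    then have c: "x \<in> carrier G" "y \<in> carrier G" "x \<otimes> inv y \<in> U" by (auto simp: close_def)
    then have "((t, x), x \<otimes> inv y) \<in> ?W" using t by (intro subsetD[OF U(2)]) (simp add: topspace_eq_carrier)
    moreover have "inv (x \<otimes> inv y) \<otimes> x = y" using c by (simp add: inv_mult_group m_assoc)
    ultimately show "close V (h (t, x)) (h (t, y))"
      using c t hc Q(3) by (auto simp: close_def)
  qed
qed

lemma homotopy_locally_close:
  assumes h: "continuous_map (prod_topology (top_of_set {0..1::real}) T) T h" and V: "nbhd_one V"
    and t: "t \<in> {0..1}"
  obtains S where "openin (top_of_set {0..1}) S" "t \<in> S"
    "\<And>s x. s \<in> S \<Longrightarrow> x \<in> carrier G \<Longrightarrow> close V (h (t, x)) (h (s, x))"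
proof -
  let ?Y = "prod_topology (top_of_set {0..1::real}) T"
  obtain Q where Q: "openin T Q" "\<one> \<in> Q" "Q \<subseteq> V" using V unfolding nbhd_one_def by blast
  have hc: "h (t, x) \<in> carrier G" if "t \<in> {0..1}" "x \<in> carrier G" for t x
    using continuous_map_image_subset_topspace[OF h] that by (auto simp: topspace_eq_carrier)
  let ?W = "{p \<in> topspace ?Y. h (t, snd p) \<otimes> inv (h p) \<in> Q}"
  have "continuous_map ?Y T (\<lambda>p. h (t, snd p))"
    using continuous_map_compose[OF _ h, of ?Y "\<lambda>p. (t, snd p)"] t
    by (simp add: o_def continuous_map_pairedI continuous_map_snd)
  then have "openin ?Y ?W"
    by (intro openin_continuous_map_preimage[OF _ Q(1)] continuous_map_mult continuous_map_inv h)
  moreover have "{t} \<times> carrier G \<subseteq> ?W"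
    using t Q hc by (auto simp: topspace_eq_carrier)
  ultimately obtain A B where "openin (top_of_set {0..1}) A" "t \<in> A" "carrier G \<subseteq> B" "A \<times> B \<subseteq> ?W"
    using tube_lemma_right[of "top_of_set {0..1}" T ?W "carrier G" t] compact_T t
    by (auto simp: topspace_eq_carrier compact_space_def)
  moreover from this have "close V (h (t, x)) (h (s, x))" if "s \<in> A" "x \<in> carrier G" for s x
  proof -
    have "(s, x) \<in> ?W" using calculation that by blast
    then show ?thesis using t hc Q that by (auto simp: close_def)
  qed
  ultimately show thesis using that by blast
qed

text \<open>The loss of scale from \<open>V\<close> to \<open>U\<close> depends neither on \<open>\<kappa>\<close> nor on its degree.\<close>

lemma contractible_primitive:
  assumes contr: "contractible_space T" and V: "nbhd_one V"
  obtains U where "nbhd_one U"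
    and "\<And>\<kappa>. \<lbrakk>bounded_cochain \<kappa>;
        \<And>xs. odd (length xs) \<Longrightarrow> small V (set xs) \<Longrightarrow> coboundary \<kappa> xs = 0\<rbrakk>
      \<Longrightarrow> \<exists>\<beta>. bounded_cochain \<beta> \<and>
          (\<forall>xs. even (length xs) \<longrightarrow> small U (set xs) \<longrightarrow> coboundary \<beta> xs = \<kappa> xs)"
proof -
  obtain b h where h: "continuous_map (prod_topology (top_of_set {0..1::real}) T) T h"
    and h0: "\<And>x. h (0, x) = x" and h1: "\<And>x. h (1, x) = b"
    using contr unfolding contractible_space_def homotopic_with_def by auto
  have hc: "h (t, x) \<in> carrier G" if "t \<in> {0..1}" "x \<in> carrier G" for t x
    using continuous_map_image_subset_topspace[OF h] that by (auto simp: topspace_eq_carrier)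
  obtain V1 where V1: "nbhd_one V1" "V1 \<subseteq> V" "\<And>x y z. close V1 x y \<Longrightarrow> close V1 y z \<Longrightarrow> close V x z"
    using nbhd_one_square_close[OF V] by metis
  obtain U where U: "nbhd_one U"
    "\<And>t x y. t \<in> {0..1} \<Longrightarrow> close U x y \<Longrightarrow> close V1 (h (t, x)) (h (t, y))"
    using homotopy_uniform[OF h V1(1)] by metis
  show thesis
  proof
    show "nbhd_one U" by fact
    fix \<kappa> assume b: "bounded_cochain \<kappa>"
      and closed: "\<And>xs. odd (length xs) \<Longrightarrow> small V (set xs) \<Longrightarrow> coboundary \<kappa> xs = 0"
    \<comment> \<open>Transitivity of \<open>R\<close> only adds primitives, all of them on
      \<open>U\<close>-small lists. However many time steps join 0 to 1, no further scale is
      lost.\<close>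
    define R where "R = (\<lambda>s t. \<exists>\<beta>. bounded_cochain \<beta> \<and> (\<forall>xs. even (length xs) \<longrightarrow> small U (set xs)
        \<longrightarrow> coboundary \<beta> xs = \<kappa> (map (\<lambda>x. h (t, x)) xs) - \<kappa> (map (\<lambda>x. h (s, x)) xs)))"
    have "R 0 1"
    proof (rule connected_equivalence_relation[of "{0..1::real}"])
      fix s t assume "R s t"
      then obtain \<beta> where "bounded_cochain \<beta>" "\<forall>xs. even (length xs) \<longrightarrow> small U (set xs)
        \<longrightarrow> coboundary \<beta> xs = \<kappa> (map (\<lambda>x. h (t, x)) xs) - \<kappa> (map (\<lambda>x. h (s, x)) xs)"
        unfolding R_def by blast
      then show "R t s" unfolding R_def
        by (intro exI[of _ "\<lambda>xs. (- 1) * \<beta> xs"] conjI bounded_cochain_scale)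
          (simp_all only: coboundary_scale, auto)
    next
      fix r s t assume "R r s" "R s t"
      then obtain \<beta> \<gamma> where \<beta>: "bounded_cochain \<beta>" "\<forall>xs. even (length xs) \<longrightarrow> small U (set xs)
        \<longrightarrow> coboundary \<beta> xs = \<kappa> (map (\<lambda>x. h (s, x)) xs) - \<kappa> (map (\<lambda>x. h (r, x)) xs)"
        and \<gamma>: "bounded_cochain \<gamma>" "\<forall>xs. even (length xs) \<longrightarrow> small U (set xs)
        \<longrightarrow> coboundary \<gamma> xs = \<kappa> (map (\<lambda>x. h (t, x)) xs) - \<kappa> (map (\<lambda>x. h (s, x)) xs)"
        unfolding R_def by blast
      show "R r t" unfolding R_def
        using \<beta> \<gamma> bounded_cochain_scale[OF \<beta>(1), of "-1"]
        by (intro exI[of _ "\<lambda>xs. \<gamma> xs - (- 1) * \<beta> xs"] conjI bounded_cochain_diff)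
          (simp_all only: coboundary_diff coboundary_scale, auto)
    next
      fix t :: real assume t: "t \<in> {0..1}"
      obtain S where S: "openin (top_of_set {0..1}) S" "t \<in> S"
        "\<And>s x. s \<in> S \<Longrightarrow> x \<in> carrier G \<Longrightarrow> close V1 (h (t, x)) (h (s, x))"
        using homotopy_locally_close[OF h V1(1) t] by metis
      have "R t s" if s: "s \<in> S" for s
        unfolding R_def
      proof (intro exI conjI allI impI)
        let ?f = "\<lambda>x. h (t, x)" and ?g = "\<lambda>x. h (s, x)"
        show "bounded_cochain (prism ?f ?g \<kappa>)" by (rule bounded_cochain_prism[OF b])
        fix xs assume xs: "even (length xs)" "small U (set xs)"
        have s01: "s \<in> {0..1}" using S(1) s openin_imp_subset by blast
        have xc: "x \<in> carrier G" if "x \<in> set xs" for x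
          using xs(2) that unfolding small_def close_def by blast
        have cff: "close V1 (?f x) (?f y)" and cgg: "close V1 (?g x) (?g y)"
          and cfg: "close V1 (?f x) (?g x)" and cgf: "close V1 (?g x) (?f x)"
          if "x \<in> set xs" "y \<in> set xs" for x y
        proof -
          have "close U x y" using xs(2) that by (simp add: small_def)
          then show "close V1 (?f x) (?f y)" "close V1 (?g x) (?g y)" using U(2) t s01 by blast+
          show "close V1 (?f x) (?g x)" by (rule S(3)[OF s xc[OF that(1)]])
          then show "close V1 (?g x) (?f x)" by (rule close_sym[OF V1(1)])
        qed
        \<comment> \<open>A mixed pair takes two \<open>V1\<close>-steps, for instance from
          \<open>h (t, u)\<close> to \<open>h (s, u)\<close> and on to
          \<open>h (s, v)\<close>.\<close>
        have "small V (?f ` set xs \<union> ?g ` set xs)"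
          unfolding small_def
        proof (intro ballI)
          fix x y assume "x \<in> ?f ` set xs \<union> ?g ` set xs" "y \<in> ?f ` set xs \<union> ?g ` set xs"
          then consider (ff) u v where "x = ?f u" "y = ?f v" "u \<in> set xs" "v \<in> set xs"
            | (fg) u v where "x = ?f u" "y = ?g v" "u \<in> set xs" "v \<in> set xs"
            | (gf) u v where "x = ?g u" "y = ?f v" "u \<in> set xs" "v \<in> set xs"
            | (gg) u v where "x = ?g u" "y = ?g v" "u \<in> set xs" "v \<in> set xs"
            by blast
          then show "close V x y"
          proof cases
            case ff then show ?thesis using cff[of u v] close_mono[OF V1(2)] by simp
          next
            case gg then show ?thesis using cgg[of u v] close_mono[OF V1(2)] by simp
          next
            case fg then show ?thesis
              using V1(3)[OF cfg[of u u] cgg[of u v]] by simp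
          next
            case gf then show ?thesis
              using V1(3)[OF cgf[of u u] cff[of u v]] by simp
          qed
        qed
        then have "coboundary \<kappa> ys = 0"
          if "set ys \<subseteq> ?f ` set xs \<union> ?g ` set xs" "length ys = Suc (length xs)" for ys
          using small_subset[OF _ that(1)] that(2) xs(1) closed by simp
        then have "prism ?f ?g (coboundary \<kappa>) xs = prism ?f ?g (\<lambda>_. 0) xs"
          by (rule prism_cong)
        then show "coboundary (prism ?f ?g \<kappa>) xs = \<kappa> (map ?g xs) - \<kappa> (map ?f xs)"
          using prism_homotopy[of ?f ?g \<kappa> xs] by simp
      qed
      then show "\<exists>S. openin (top_of_set {0..1}) S \<and> t \<in> S \<and> (\<forall>s\<in>S. R t s)" using S by blast
    qed auto
    then obtain \<beta> where \<beta>: "bounded_cochain \<beta>" and d\<beta>: "\<And>xs. even (length xs) \<Longrightarrow> small U (set xs)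
        \<Longrightarrow> coboundary \<beta> xs = \<kappa> (map (\<lambda>x. h (1, x)) xs) - \<kappa> (map (\<lambda>x. h (0, x)) xs)"
      unfolding R_def by blast
    \<comment> \<open>At time 1 every list becomes constant; \<open>\<kappa>\<close> vanishes there
      by \<open>coboundary_replicate\<close>. What remains is minus the pullback at time 0, which is
      \<open>\<kappa>\<close> itself.\<close>
    have "coboundary (\<lambda>xs. (- 1) * \<beta> xs) xs = \<kappa> xs" if "even (length xs)" "small U (set xs)" for xs
    proof -
      have "b \<in> carrier G" using hc[of 1 \<one>] h1 by auto
      then have "small V (set (replicate (Suc (length xs)) b))"
        using close_refl[OF V] by (simp add: small_def)
      then have "coboundary \<kappa> (replicate (Suc (length xs)) b) = 0"
        using that by (intro closed) auto
      then have "\<kappa> (replicate (length xs) b) = 0"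
        using that(1) by (simp only: coboundary_replicate) simp
      moreover have "map (\<lambda>x. h (1, x)) xs = replicate (length xs) b"
        by (simp add: h1 map_replicate_const)
      ultimately show ?thesis using d\<beta>[OF that] by (simp only: coboundary_scale) (simp add: h0)
    qed
    then show "\<exists>\<beta>. bounded_cochain \<beta> \<and>
          (\<forall>xs. even (length xs) \<longrightarrow> small U (set xs) \<longrightarrow> coboundary \<beta> xs = \<kappa> xs)"
      using bounded_cochain_scale[OF \<beta>] by blast
  qed
qed

text \<open>Right translation, extended by the identity off the carrier so that invariance of cochains
  can be stated for all lists.\<close>

definition shift :: "'a \<Rightarrow> 'a \<Rightarrow> 'a" where
  "shift a x = (if x \<in> carrier G then x \<otimes> a else x)"

text \<open>The two identities are those of a connection form for the action of the integers by
  powers of \<open>a\<close>: a prescribed value along the orbit and invariance. The bound makes the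
  cochains built from \<open>t\<close> fit for averaging.\<close>

definition connection :: "'a \<Rightarrow> real \<Rightarrow> ('a \<Rightarrow> 'a \<Rightarrow> real) \<Rightarrow> bool" where
  "connection a \<alpha> t \<longleftrightarrow> (\<forall>x. t x (shift a x) = \<alpha>) \<and> (\<forall>x y. t (shift a x) (shift a y) = t x y)
    \<and> (\<exists>C. \<forall>x y. \<bar>t x y\<bar> \<le> C)"

text \<open>Descending induction along the Gysin sequence: a basic primitive \<open>\<eta>\<close> of the product of
  \<open>n + 1\<close> curvatures makes \<open>t \<union> \<dots> - \<eta>\<close> a cocycle, hence a coboundary; integrating its
  primitive over the orbit direction \<open>a\<close> yields a basic primitive of the product of \<open>n\<close>
  curvatures. At \<open>n = 0\<close> the constant \<open>1\<close> would be a coboundary.\<close>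

lemma no_basic_primitive:
  assumes contr: "contractible_space T" and V: "nbhd_one V"
  shows "\<exists>U. nbhd_one U \<and> (\<forall>a\<in>U. \<forall>\<alpha> ts \<eta>. \<alpha> \<noteq> 0 \<longrightarrow> length ts = n \<longrightarrow>
      (\<forall>t\<in>set ts. connection a \<alpha> t) \<longrightarrow> bounded_cochain \<eta> \<longrightarrow> \<eta> [] = 0 \<longrightarrow>
      (\<forall>xs. \<eta> (map (shift a) xs) = \<eta> xs) \<longrightarrow> (\<forall>xs. prism (\<lambda>x. x) (shift a) \<eta> xs = 0) \<longrightarrow>
      (\<exists>xs. odd (length xs) \<and> small V (set xs) \<and> coboundary \<eta> xs \<noteq> curvatures ts xs))"
  using V
proof (induction n arbitrary: V)
  case 0
  \<comment> \<open>On a one-element list a coboundary is the value at \<open>[]\<close>, here 0,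
    while the empty product of curvatures is 1.\<close>
  have "small V (set [\<one>])" using close_refl[OF 0] by (simp add: small_def)
  then show ?case using 0 by (intro exI[of _ V] conjI ballI allI impI exI[of _ "[\<one>]"]) auto
next
  case (Suc n)
  obtain V2 where V2: "nbhd_one V2"
    and prim: "\<And>\<kappa>. \<lbrakk>bounded_cochain \<kappa>;
        \<And>xs. odd (length xs) \<Longrightarrow> small V (set xs) \<Longrightarrow> coboundary \<kappa> xs = 0\<rbrakk>
      \<Longrightarrow> \<exists>\<beta>. bounded_cochain \<beta> \<and>
          (\<forall>xs. even (length xs) \<longrightarrow> small V2 (set xs) \<longrightarrow> coboundary \<beta> xs = \<kappa> xs)"
    using contractible_primitive[OF contr Suc.prems] by metis
  \<comment> \<open>A \<open>V3\<close>-small list together with its translate by an element of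
    \<open>V3\<close> is \<open>V2\<close>-small. So contracting a primitive valid at scale
    \<open>V2\<close> gives one valid at scale \<open>V3\<close>, where the induction hypothesis is
    used.\<close>
  obtain V3 where V3: "nbhd_one V3" "V3 \<subseteq> V2"
    "\<And>x y z. close V3 x y \<Longrightarrow> close V3 y z \<Longrightarrow> close V2 x z"
    using nbhd_one_square_close[OF V2] by metis
  obtain V4 where V4: "nbhd_one V4" and IH: "\<forall>a\<in>V4. \<forall>\<alpha> ts \<eta>. \<alpha> \<noteq> 0 \<longrightarrow> length ts = n \<longrightarrow>
      (\<forall>t\<in>set ts. connection a \<alpha> t) \<longrightarrow> bounded_cochain \<eta> \<longrightarrow> \<eta> [] = 0 \<longrightarrow>
      (\<forall>xs. \<eta> (map (shift a) xs) = \<eta> xs) \<longrightarrow> (\<forall>xs. prism (\<lambda>x. x) (shift a) \<eta> xs = 0) \<longrightarrow>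
      (\<exists>xs. odd (length xs) \<and> small V3 (set xs) \<and> coboundary \<eta> xs \<noteq> curvatures ts xs)"
    using Suc.IH[OF V3(1)] by blast
  have "\<exists>xs. odd (length xs) \<and> small V (set xs) \<and> coboundary \<eta> xs \<noteq> curvatures ts xs"
    if a: "a \<in> V3 \<inter> V4" and \<alpha>: "\<alpha> \<noteq> 0" and len: "length ts = Suc n"
      and conn: "\<forall>t\<in>set ts. connection a \<alpha> t" and \<eta>: "bounded_cochain \<eta>" "\<eta> [] = 0"
      and \<eta>_inv: "\<forall>xs. \<eta> (map (shift a) xs) = \<eta> xs"
      and \<eta>_basic: "\<forall>xs. prism (\<lambda>x. x) (shift a) \<eta> xs = 0" for a \<alpha> ts \<eta>
  proof (rule ccontr)
    let ?s = "shift a" and ?\<iota> = "prism (\<lambda>x. x) (shift a)"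
    assume "\<not> (\<exists>xs. odd (length xs) \<and> small V (set xs) \<and> coboundary \<eta> xs \<noteq> curvatures ts xs)"
    then have d\<eta>: "coboundary \<eta> xs = curvatures ts xs" if "odd (length xs)" "small V (set xs)" for xs
      using that by blast
    obtain t us where ts: "ts = t # us" "length us = n" using len by (cases ts) auto
    have t: "\<And>x. t x (?s x) = \<alpha>" "\<And>x y. t (?s x) (?s y) = t x y" and "\<exists>C. \<forall>x y. \<bar>t x y\<bar> \<le> C"
      and us: "\<And>u x. u \<in> set us \<Longrightarrow> u x (?s x) = \<alpha>"
        "\<And>u x y. u \<in> set us \<Longrightarrow> u (?s x) (?s y) = u x y"
        "\<And>u. u \<in> set us \<Longrightarrow> \<exists>C. \<forall>x y. \<bar>u x y\<bar> \<le> C"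
      using conn ts(1) unfolding connection_def by auto
    then obtain C where C: "\<And>x y. \<bar>t x y\<bar> \<le> C" by blast
    let ?P = "curvatures us"
    have P_inv: "?P (map ?s xs) = ?P xs" for xs by (rule curvatures_invariant) (rule us)
    have P_basic: "?\<iota> ?P = (\<lambda>_. 0)" by (rule ext, rule prism_curvatures) (rule us, assumption)+
    \<comment> \<open>By definition of \<open>curvatures\<close> the cup product has the full
      curvature product as its coboundary, and on small lists so has \<open>\<eta>\<close>.\<close>
    define \<kappa> where "\<kappa> = (\<lambda>xs. cup t ?P xs - \<eta> xs)"
    have "bounded_cochain \<kappa>" unfolding \<kappa>_def
      by (intro bounded_cochain_diff bounded_cochain_cup[OF C] bounded_cochain_curvatures us \<eta>)
    moreover have "coboundary \<kappa> xs = 0" if "odd (length xs)" "small V (set xs)" for xs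
      using d\<eta>[OF that] unfolding \<kappa>_def by (simp add: coboundary_diff ts)
    ultimately obtain \<beta>0 where \<beta>0: "bounded_cochain \<beta>0"
      "\<And>xs. even (length xs) \<and> small V2 (set xs) \<Longrightarrow> coboundary \<beta>0 xs = \<kappa> xs"
      using prim by blast
    have "cup t ?P (map ?s xs) = cup t ?P xs" for xs
      using t(2) P_inv[of "tl xs"] by (cases "(t, ?P, xs)" rule: cup.cases) auto
    then have \<kappa>_inv: "\<kappa> (map ?s xs) = \<kappa> xs" for xs
      using \<eta>_inv unfolding \<kappa>_def by simp
    have a_carrier: "a \<in> carrier G" using a nbhd_one_subset[OF V4] by blast
    have small_shift: "small V2 (set (map ?s xs))" if "small V2 (set xs)" for xs
      using that close_mult_right[OF _ a_carrier] a_carrier unfolding small_def shift_def by (auto simp: close_def)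
    obtain \<beta> where \<beta>: "bounded_cochain \<beta>" "\<And>xs. \<beta> (map ?s xs) = \<beta> xs"
      "\<And>xs. even (length xs) \<and> small V2 (set xs) \<Longrightarrow> coboundary \<beta> xs = \<kappa> xs"
      by (rule average_cochain[of \<beta>0 "\<lambda>xs. even (length xs) \<and> small V2 (set xs)" \<kappa> ?s])
        (use \<beta>0 \<kappa>_inv small_shift in auto)
    \<comment> \<open>With \<open>\<iota>\<close> for contraction and \<open>d\<close> for the
      coboundary, invariance of \<open>\<beta>\<close> gives
      \<open>d \<iota> \<beta> = - \<iota> d \<beta> = - \<iota> \<kappa>\<close>. As
      \<open>\<eta>\<close> and \<open>?P\<close> are basic, this is \<open>- \<alpha>\<close> times
      \<open>?P\<close>, whence the factor.\<close>
    define \<eta>' where "\<eta>' = (\<lambda>xs. (- 1 / \<alpha>) * ?\<iota> \<beta> xs)"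
    have "coboundary \<eta>' xs = ?P xs" if xs: "odd (length xs)" "small V3 (set xs)" for xs
    proof -
      have xc: "x \<in> carrier G" if "x \<in> set xs" for x
        using xs(2) that unfolding small_def close_def by blast
      have "small V2 (set xs \<union> ?s ` set xs)"
      proof -
        have "close V2 x y \<and> close V2 x (?s y) \<and> close V2 (?s x) y \<and> close V2 (?s x) (?s y)"
          if "x \<in> set xs" "y \<in> set xs" for x y
        proof -
          have xy: "close V3 x y" using xs(2) that by (simp add: small_def)
          have "close V3 (?s z) z" if "z \<in> set xs" for z
            using close_mult_self[OF V3(1), of a z] a xc[OF that] by (simp add: shift_def)
          then have "close V3 (?s x) x" "close V3 y (?s y)"
            using that close_sym[OF V3(1)] by blast+
          then have "close V2 x (?s y)" "close V2 (?s x) y" using xy V3(3) by blast+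
          moreover have "close V2 x y" using close_mono[OF V3(2) xy] .
          moreover have "close V2 (?s x) (?s y)"
            using close_mult_right[OF close_mono[OF V3(2) xy] a_carrier] xc that by (simp add: shift_def)
          ultimately show ?thesis by blast
        qed
        then show ?thesis unfolding small_def by blast
      qed
      then have "coboundary \<beta> ys = \<kappa> ys" if "set ys \<subseteq> set xs \<union> ?s ` set xs" "length ys = Suc (length xs)" for ys
        using small_subset[OF _ that(1)] that(2) xs(1) \<beta>(3) by simp
      then have "?\<iota> (coboundary \<beta>) xs = ?\<iota> \<kappa> xs"
        by (intro prism_cong) auto
      also have "\<dots> = \<alpha> * ?P xs - cup t (\<lambda>_. 0) xs - 0"
        using prism_cup[of t ?s \<alpha> ?P xs, OF t(1) P_inv] \<eta>_basic unfolding \<kappa>_def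
        by (simp add: prism_diff P_basic)
      also have "cup t (\<lambda>_. 0) xs = 0"
        by (cases "(t, (\<lambda>_. 0) :: 'a list \<Rightarrow> real, xs)" rule: cup.cases) auto
      finally have "coboundary (?\<iota> \<beta>) xs = - (\<alpha> * ?P xs)"
        using prism_homotopy[of "\<lambda>x. x" ?s \<beta> xs] \<beta>(2)[of xs] by simp
      then show ?thesis unfolding \<eta>'_def using \<alpha> by (simp only: coboundary_scale) simp
    qed
    moreover have "bounded_cochain \<eta>'" unfolding \<eta>'_def
      by (intro bounded_cochain_scale bounded_cochain_prism \<beta>)
    moreover have "\<eta>' [] = 0" by (simp add: \<eta>'_def)
    moreover have "\<eta>' (map ?s xs) = \<eta>' xs" for xs
    proof -
      have "?\<iota> c (map ?s xs) = ?\<iota> (\<lambda>ys. c (map ?s ys)) xs" for c :: "'a list \<Rightarrow> real" and xs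
        by (induction xs arbitrary: c) auto
      then show ?thesis by (simp add: \<eta>'_def \<beta>(2))
    qed
    moreover have "?\<iota> \<eta>' xs = 0" for xs
      unfolding \<eta>'_def by (simp only: prism_scale prism_prism)
    ultimately show False
      using IH[rule_format, of a \<alpha> us \<eta>'] a \<alpha> ts conn by auto
  qed
  then show ?case using nbhd_one_Int[OF V3(1) V4] by blast
qed

text \<open>The candidate primitive \<open>\<eta> = 0\<close> must fail, so the curvature product is
  nonzero on some small list, and by \<open>curvatures_eq_0\<close> no factor is flat on the entries
  of that list. This is a Lusternik-Schnirelmann bound.\<close>

corollary no_category_bound:
  assumes "contractible_space T" "nbhd_one V"
  obtains U where "nbhd_one U"
    and "\<And>a \<alpha> ts. \<lbrakk>a \<in> U; \<alpha> \<noteq> 0; length ts = n; \<And>t. t \<in> set ts \<Longrightarrow> connection a \<alpha> t\<rbrakk>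
      \<Longrightarrow> \<exists>S. S \<noteq> {} \<and> small V S \<and>
        (\<forall>t\<in>set ts. \<exists>x\<in>S. \<exists>y\<in>S. \<exists>z\<in>S. t y z - t x z + t x y \<noteq> 0)"
proof -
  obtain U where U: "nbhd_one U" and *: "\<forall>a\<in>U. \<forall>\<alpha> ts \<eta>. \<alpha> \<noteq> 0 \<longrightarrow> length ts = n \<longrightarrow>
      (\<forall>t\<in>set ts. connection a \<alpha> t) \<longrightarrow> bounded_cochain \<eta> \<longrightarrow> \<eta> [] = 0 \<longrightarrow>
      (\<forall>xs. \<eta> (map (shift a) xs) = \<eta> xs) \<longrightarrow> (\<forall>xs. prism (\<lambda>x. x) (shift a) \<eta> xs = 0) \<longrightarrow>
      (\<exists>xs. odd (length xs) \<and> small V (set xs) \<and> coboundary \<eta> xs \<noteq> curvatures ts xs)"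
    using no_basic_primitive[OF assms, of n] by blast
  show thesis
  proof (rule that[OF U])
    fix a \<alpha> ts assume h: "a \<in> U" "\<alpha> \<noteq> 0" "length ts = n" "\<And>t. t \<in> set ts \<Longrightarrow> connection a \<alpha> t"
    have "bounded_cochain (\<lambda>_::'a list. 0)" by (auto simp: bounded_cochain_def)
    then obtain xs where xs: "odd (length xs)" "small V (set xs)" "curvatures ts xs \<noteq> 0"
      using *[rule_format, of a \<alpha> ts "\<lambda>_. 0"] h by auto
    show "\<exists>S. S \<noteq> {} \<and> small V S \<and>
        (\<forall>t\<in>set ts. \<exists>x\<in>S. \<exists>y\<in>S. \<exists>z\<in>S. t y z - t x z + t x y \<noteq> 0)"
    proof (intro exI[of _ "set xs"] conjI ballI)
      show "set xs \<noteq> {}" using xs(1) by auto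
      show "\<exists>x\<in>set xs. \<exists>y\<in>set xs. \<exists>z\<in>set xs. t y z - t x z + t x y \<noteq> 0" if "t \<in> set ts" for t
        using curvatures_eq_0[OF that, of "set xs" xs] xs(3) by blast
    qed (use xs in auto)
  qed
qed


section \<open>Uniformly continuous functions\<close>

text \<open>Since \<open>close\<close> holds between elements of the carrier only, values elsewhere
  are unrestricted. The congruence rules for the mean and the inner product accordingly compare
  functions on the carrier.\<close>

definition unif_cont :: "('a \<Rightarrow> real) \<Rightarrow> bool" where
  "unif_cont f \<longleftrightarrow> (\<forall>e>0. \<exists>V. nbhd_one V \<and> (\<forall>x y. close V x y \<longrightarrow> \<bar>f x - f y\<bar> < e))"

lemma unif_contD:
  assumes "unif_cont f" "0 < e"
  obtains V where "nbhd_one V" "\<And>x y. close V x y \<Longrightarrow> \<bar>f x - f y\<bar> < e"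
  using assms unfolding unif_cont_def by metis

lemma close_inv_mult_self: "close V x y \<Longrightarrow> inv (x \<otimes> inv y) \<otimes> x = y"
  by (simp add: close_def inv_mult_group m_assoc)

lemma continuous_map_uniform:
  fixes \<Phi> :: "'y \<times> 'a \<Rightarrow> real"
  assumes "compact_space Y" "continuous_map (prod_topology Y T) euclideanreal \<Phi>" "0 < e"
  obtains V where "nbhd_one V"
    "\<And>y x x'. y \<in> topspace Y \<Longrightarrow> close V x x' \<Longrightarrow> \<bar>\<Phi> (y, x) - \<Phi> (y, x')\<bar> < e"
proof -
  let ?Y = "prod_topology Y T" and ?Z = "prod_topology (prod_topology Y T) T"
  let ?W = "{p \<in> topspace ?Z. \<bar>\<Phi> (fst p) - \<Phi> (fst (fst p), inv (snd p) \<otimes> snd (fst p))\<bar> \<in> {..<e}}"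
  have f: "continuous_map ?Z ?Y fst" and s: "continuous_map ?Z T snd"
    by (rule continuous_map_fst continuous_map_snd)+
  have ff: "continuous_map ?Z Y (\<lambda>p. fst (fst p))"
    using continuous_map_compose[OF f continuous_map_fst] by (simp add: o_def)
  have sf: "continuous_map ?Z T (\<lambda>p. snd (fst p))"
    using continuous_map_compose[OF f continuous_map_snd] by (simp add: o_def)
  have 1: "continuous_map ?Z euclideanreal (\<lambda>p. \<Phi> (fst p))"
    using continuous_map_compose[OF f assms(2)] by (simp add: o_def)
  have 2: "continuous_map ?Z euclideanreal (\<lambda>p. \<Phi> (fst (fst p), inv (snd p) \<otimes> snd (fst p)))"
    using continuous_map_compose[OF _ assms(2), of ?Z "\<lambda>p. (fst (fst p), inv (snd p) \<otimes> snd (fst p))"]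
    by (simp add: o_def continuous_map_pairedI ff sf s continuous_map_mult continuous_map_inv)
  have 3: "openin euclideanreal {..<e}" by simp
  have opW: "openin ?Z ?W"
    by (rule openin_continuous_map_preimage[OF _ 3]) (intro continuous_map_real_abs continuous_map_diff 1 2)
  have subW: "topspace ?Y \<times> {\<one>} \<subseteq> ?W"
    using assms by (auto simp: topspace_eq_carrier)
  have cpt: "compact_space ?Y"
    using compact_T assms by (simp add: compact_space_prod_topology)
  obtain V where V: "nbhd_one V" "topspace ?Y \<times> V \<subseteq> ?W"
    by (rule nbhd_one_tube[OF cpt opW subW])
  show thesis
  proof
    show "nbhd_one V" by fact
    fix y x x' assume y: "y \<in> topspace Y" and c: "close V x x'"
    then have "((y, x), x \<otimes> inv x') \<in> ?W"
      by (intro subsetD[OF V(2)]) (simp add: topspace_eq_carrier close_def)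
    then show "\<bar>\<Phi> (y, x) - \<Phi> (y, x')\<bar> < e"
      using close_inv_mult_self[OF c] by simp
  qed
qed

lemma continuous_map_imp_unif_cont:
  assumes "continuous_map T euclideanreal f" shows "unif_cont f"
  unfolding unif_cont_def
proof (intro allI impI)
  fix e :: real assume "0 < e"
  let ?Y = "discrete_topology {()}"
  have "continuous_map (prod_topology ?Y T) euclideanreal (\<lambda>p. f (snd p))"
    using continuous_map_compose[OF continuous_map_snd assms] by (simp add: o_def)
  then obtain V where "nbhd_one V"
    "\<And>y x x'. y \<in> topspace ?Y \<Longrightarrow> close V x x' \<Longrightarrow> \<bar>f (snd (y, x)) - f (snd (y, x'))\<bar> < e"
    using continuous_map_uniform[of ?Y "\<lambda>p. f (snd p)" e] \<open>0 < e\<close>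
    by (auto simp: compact_space_discrete_topology)
  then show "\<exists>V. nbhd_one V \<and> (\<forall>x y. close V x y \<longrightarrow> \<bar>f x - f y\<bar> < e)"
    by (intro exI[of _ V]) auto
qed

lemma openin_translate:
  assumes "openin T U" "x \<in> carrier G" shows "openin T {y \<in> carrier G. y \<otimes> inv x \<in> U}"
proof -
  have "continuous_map T T (\<lambda>y. y \<otimes> inv x)"
    using assms by (intro continuous_map_mult) (auto simp: topspace_eq_carrier)
  from openin_continuous_map_preimage[OF this assms(1)] show ?thesis
    by (simp add: topspace_eq_carrier)
qed

lemma unif_cont_iff: "unif_cont f \<longleftrightarrow> continuous_map T euclideanreal f"
proof
  assume f: "unif_cont f"
  show "continuous_map T euclideanreal f"
    unfolding continuous_map
  proof (intro conjI allI impI)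
    fix U assume U: "openin euclideanreal U"
    show "openin T {x \<in> topspace T. f x \<in> U}"
    proof (subst openin_subopen, intro ballI)
      fix x assume x: "x \<in> {x \<in> topspace T. f x \<in> U}"
      then obtain e where e: "0 < e" "\<And>z. dist z (f x) < e \<Longrightarrow> z \<in> U"
        using U by (auto simp: open_dist)
      obtain V where V: "nbhd_one V" "\<And>x y. close V x y \<Longrightarrow> \<bar>f x - f y\<bar> < e"
        using unif_contD[OF f e(1)] by metis
      obtain Q where Q: "openin T Q" "\<one> \<in> Q" "Q \<subseteq> V" using V unfolding nbhd_one_def by blast
      have "f y \<in> U" if "y \<in> carrier G" "y \<otimes> inv x \<in> Q" for y
        using V(2)[of y x] that x Q(3) by (intro e(2)) (auto simp: dist_real_def close_def topspace_eq_carrier)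
      then show "\<exists>S. openin T S \<and> x \<in> S \<and> S \<subseteq> {x \<in> topspace T. f x \<in> U}"
        using openin_translate[OF Q(1), of x] x Q(2)
        by (intro exI[of _ "{y \<in> carrier G. y \<otimes> inv x \<in> Q}"]) (auto simp: topspace_eq_carrier)
    qed
  qed simp
qed (rule continuous_map_imp_unif_cont)

lemma unif_cont_add: "unif_cont f \<Longrightarrow> unif_cont g \<Longrightarrow> unif_cont (\<lambda>x. f x + g x)"
  and unif_cont_diff: "unif_cont f \<Longrightarrow> unif_cont g \<Longrightarrow> unif_cont (\<lambda>x. f x - g x)"
  and unif_cont_mult: "unif_cont f \<Longrightarrow> unif_cont g \<Longrightarrow> unif_cont (\<lambda>x. f x * g x)"
  and unif_cont_const: "unif_cont (\<lambda>x. c)"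
  and unif_cont_inv: "unif_cont f \<Longrightarrow> unif_cont (\<lambda>x. f (inv x))"
  and unif_cont_right: "unif_cont f \<Longrightarrow> a \<in> carrier G \<Longrightarrow> unif_cont (\<lambda>x. f (x \<otimes> a))"
proof -
  show "unif_cont f \<Longrightarrow> unif_cont (\<lambda>x. f (inv x))"
    using continuous_map_compose[OF continuous_inv, of euclideanreal f] by (simp add: unif_cont_iff o_def)
  have "a \<in> carrier G \<Longrightarrow> continuous_map T T (\<lambda>x. x \<otimes> a)"
    by (intro continuous_map_mult) (auto simp: topspace_eq_carrier)
  then show "unif_cont f \<Longrightarrow> a \<in> carrier G \<Longrightarrow> unif_cont (\<lambda>x. f (x \<otimes> a))"
    using continuous_map_compose[of T T "\<lambda>x. x \<otimes> a" euclideanreal f] by (simp add: unif_cont_iff o_def)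
qed (auto simp: unif_cont_iff intro: continuous_map_add continuous_map_diff continuous_map_real_mult)

lemma finite_net:
  assumes "nbhd_one V"
  obtains F where "finite F" "F \<noteq> {}" "F \<subseteq> carrier G" "\<And>x. x \<in> carrier G \<Longrightarrow> \<exists>p\<in>F. close V x p"
proof -
  obtain Q where Q: "openin T Q" "\<one> \<in> Q" "Q \<subseteq> V" using assms unfolding nbhd_one_def by blast
  let ?N = "\<lambda>p. {y \<in> carrier G. y \<otimes> inv p \<in> Q}"
  have "compactin T (carrier G)"
    using compact_T unfolding compact_space_def by (simp add: topspace_eq_carrier)
  moreover have "Ball (?N ` carrier G) (openin T)" using openin_translate[OF Q(1)] by blast
  moreover have "carrier G \<subseteq> \<Union> (?N ` carrier G)"
  proof
    fix x assume "x \<in> carrier G"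
    then show "x \<in> \<Union> (?N ` carrier G)" using Q(2) by (intro UN_I[of x]) auto
  qed
  ultimately obtain \<F> where \<F>: "finite \<F>" "\<F> \<subseteq> ?N ` carrier G" "carrier G \<subseteq> \<Union> \<F>"
    by (meson compactinD)
  then obtain F where F: "finite F" "F \<subseteq> carrier G" "\<F> = ?N ` F"
    by (meson finite_subset_image)
  have net: "\<exists>p\<in>F. close V x p" if x: "x \<in> carrier G" for x
  proof -
    obtain p where "p \<in> F" "x \<in> ?N p" using \<F>(3) F(3) x by blast
    then show ?thesis using F(2) Q(3) x by (auto simp: close_def)
  qed
  show thesis
  proof
    show "F \<noteq> {}" using net[of \<one>] by auto
  qed (use F net in auto)
qed

lemma unif_cont_bounded:
  assumes "unif_cont f" obtains B where "\<And>x. x \<in> carrier G \<Longrightarrow> \<bar>f x\<bar> \<le> B"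
proof -
  obtain V where V: "nbhd_one V" "\<And>x y. close V x y \<Longrightarrow> \<bar>f x - f y\<bar> < 1"
    using unif_contD[OF assms zero_less_one] by metis
  obtain F where F: "finite F" "\<And>x. x \<in> carrier G \<Longrightarrow> \<exists>p\<in>F. close V x p"
    using finite_net[OF V(1)] by metis
  show thesis
  proof
    fix x assume "x \<in> carrier G"
    then obtain p where p: "p \<in> F" "close V x p" using F(2) by blast
    then have "\<bar>f p\<bar> \<le> (\<Sum>p\<in>F. \<bar>f p\<bar>)" using F(1) by (intro member_le_sum) auto
    then show "\<bar>f x\<bar> \<le> (\<Sum>p\<in>F. \<bar>f p\<bar>) + 1" using V(2)[OF p(2)] by linarith
  qed
qed


section \<open>The Haar mean\<close>

text \<open>The operators of von Neumann's construction of an invariant mean. Closing under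
  composition by a rule of its own avoids multiplicities in products of finite sets.\<close>

inductive_set averages :: "(('a \<Rightarrow> real) \<Rightarrow> 'a \<Rightarrow> real) set" where
  translates: "\<lbrakk>finite S; S \<noteq> {}; S \<subseteq> carrier G\<rbrakk>
    \<Longrightarrow> (\<lambda>f x. (\<Sum>y\<in>S. f (x \<otimes> y)) / real (card S)) \<in> averages"
| compose: "\<lbrakk>A \<in> averages; B \<in> averages\<rbrakk> \<Longrightarrow> (\<lambda>f. A (B f)) \<in> averages"

lemma averages_le:
  assumes "A \<in> averages" "\<And>x. x \<in> carrier G \<Longrightarrow> f x \<le> c" "x \<in> carrier G"
  shows "A f x \<le> c"
  using assms
proof (induction arbitrary: f x)
  case (translates S)
  have "(\<Sum>y\<in>S. f (x \<otimes> y)) \<le> real (card S) * c"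
    using translates by (intro sum_bounded_above) auto
  then show ?case using translates by (simp add: divide_le_eq card_gt_0_iff mult.commute)
next
  case (compose A B)
  show ?case by (rule compose.IH(1)) (use compose in auto)
qed

lemma averages_linear:
  assumes "A \<in> averages"
  shows "A (\<lambda>x. a * f x + b * g x) = (\<lambda>x. a * A f x + b * A g x)"
  using assms
proof (induction arbitrary: f g)
  case (translates S)
  show ?case
    by (simp add: sum.distrib add_divide_distrib flip: sum_distrib_left)
next
  case (compose A B)
  show ?case by (simp only: compose.IH)
qed

lemma averages_uminus: "A \<in> averages \<Longrightarrow> A (\<lambda>x. - f x) = (\<lambda>x. - A f x)"
  using averages_linear[of A "-1" f 0 f] by simp

lemma averages_ge:
  assumes "A \<in> averages" "\<And>x. x \<in> carrier G \<Longrightarrow> c \<le> f x" "x \<in> carrier G"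
  shows "c \<le> A f x"
  using averages_le[of A "\<lambda>x. - f x" "- c" x] assms by (simp add: averages_uminus)

lemma averages_approx:
  assumes "A \<in> averages" "\<And>x. x \<in> carrier G \<Longrightarrow> \<bar>f x - c\<bar> \<le> e" "x \<in> carrier G"
  shows "\<bar>A f x - c\<bar> \<le> e"
proof -
  have "c - e \<le> f x \<and> f x \<le> c + e" if "x \<in> carrier G" for x
    using assms(2)[OF that] by linarith
  then have "c - e \<le> A f x" "A f x \<le> c + e"
    using averages_ge[OF assms(1) _ assms(3)] averages_le[OF assms(1) _ assms(3)] by auto
  then show ?thesis by linarith
qed

lemma averages_cong:
  assumes "A \<in> averages" "\<And>x. x \<in> carrier G \<Longrightarrow> f x = g x" "x \<in> carrier G"
  shows "A f x = A g x"
  using assms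
proof (induction arbitrary: f g x)
  case (translates S)
  then show ?case by (simp add: subset_iff cong: sum.cong)
next
  case (compose A B)
  have "B f x = B g x" if "x \<in> carrier G" for x
    by (rule compose.IH(2)[OF _ that]) (rule compose.prems(1))
  then show ?case by (rule compose.IH(1)[OF _ compose.prems(2)])
qed

lemma averages_left:
  assumes "A \<in> averages" "y \<in> carrier G" "x \<in> carrier G"
  shows "A (\<lambda>x. f (y \<otimes> x)) x = A f (y \<otimes> x)"
  using assms
proof (induction arbitrary: f x)
  case (translates S)
  then show ?case by (simp add: subset_iff m_assoc cong: sum.cong)
next
  case (compose A B)
  have "A (B (\<lambda>x. f (y \<otimes> x))) x = A (\<lambda>x. B f (y \<otimes> x)) x"
    by (rule averages_cong[OF compose.hyps(1)]) (use compose in auto)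
  then show ?case using compose by simp
qed

text \<open>Right translations preserve \<open>close\<close>, so averaging never worsens a modulus
  of continuity. One net therefore serves all rounds of \<open>almost_mean_exists\<close>.\<close>

lemma averages_modulus:
  assumes "A \<in> averages" "\<And>x y. close V x y \<Longrightarrow> \<bar>f x - f y\<bar> \<le> e" "close V x y"
  shows "\<bar>A f x - A f y\<bar> \<le> e"
  using assms
proof (induction arbitrary: f x y)
  case (translates S)
  have "\<bar>(\<Sum>z\<in>S. f (x \<otimes> z)) - (\<Sum>z\<in>S. f (y \<otimes> z))\<bar> \<le> (\<Sum>z\<in>S. \<bar>f (x \<otimes> z) - f (y \<otimes> z)\<bar>)"
    by (simp add: sum_subtractf[symmetric] sum_abs)
  also have "\<dots> \<le> real (card S) * e"
    using translates(3) by (intro sum_bounded_above translates(4) close_mult_right[OF translates(5)]) blast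
  finally have "\<bar>(\<Sum>z\<in>S. f (x \<otimes> z)) - (\<Sum>z\<in>S. f (y \<otimes> z))\<bar> \<le> real (card S) * e" .
  moreover have "0 < real (card S)" using translates by (simp add: card_gt_0_iff)
  ultimately have "\<bar>(\<Sum>z\<in>S. f (x \<otimes> z)) - (\<Sum>z\<in>S. f (y \<otimes> z))\<bar> / real (card S) \<le> e"
    by (simp only: pos_divide_le_eq mult.commute)
  then show ?case by (simp only: diff_divide_distrib[symmetric] abs_divide abs_of_nat)
next
  case (compose A B)
  have "\<bar>B f x - B f y\<bar> \<le> e" if "close V x y" for x y
    by (rule compose.IH(2)[OF _ that]) (rule compose.prems(1))
  then show ?case by (rule compose.IH(1)[OF _ compose.prems(2)])
qed

lemma averages_unif_cont:
  assumes "A \<in> averages" "unif_cont f" shows "unif_cont (A f)"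
  unfolding unif_cont_def
proof (intro allI impI)
  fix e :: real assume "0 < e"
  then obtain V where V: "nbhd_one V" "\<And>x y. close V x y \<Longrightarrow> \<bar>f x - f y\<bar> < e / 2"
    using unif_contD[OF assms(2), of "e / 2"] by auto
  have "\<bar>A f x - A f y\<bar> < e" if "close V x y" for x y
    using averages_modulus[OF assms(1), of V f "e / 2" x y] V(2) that \<open>0 < e\<close> by (force intro: less_imp_le)
  then show "\<exists>V. nbhd_one V \<and> (\<forall>x y. close V x y \<longrightarrow> \<bar>A f x - A f y\<bar> < e)"
    using V(1) by blast
qed

lemma averages_sum:
  assumes "A \<in> averages" "finite S"
  shows "A (\<lambda>x. \<Sum>y\<in>S. a * g y x) = (\<lambda>x. \<Sum>y\<in>S. a * A (g y) x)"
  using assms(2)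
proof (induction S)
  case empty
  show ?case using averages_linear[OF assms(1), of 0 _ 0] by simp
next
  case (insert z S)
  have "A (\<lambda>x. \<Sum>y\<in>insert z S. a * g y x) = A (\<lambda>x. a * g z x + 1 * (\<Sum>y\<in>S. a * g y x))"
    using insert by simp
  also have "\<dots> = (\<lambda>x. a * A (g z) x + 1 * A (\<lambda>x. \<Sum>y\<in>S. a * g y x) x)"
    by (rule averages_linear[OF assms(1)])
  finally show ?case using insert by simp
qed

text \<open>Conjugating by the inversion turns right averages into left averages, and these commute
  with right averages; this is what makes the mean well defined.\<close>

lemma averages_commute:
  assumes "A \<in> averages" "B \<in> averages" "x \<in> carrier G"
  shows "B (\<lambda>x. A (\<lambda>z. f (inv z)) (inv x)) x = A (\<lambda>z. B f (inv z)) (inv x)"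
  using assms(1,3)
proof (induction arbitrary: f x)
  case (translates S)
  have inv_eq: "inv (inv x \<otimes> y) = inv y \<otimes> x" if "x \<in> carrier G" "y \<in> S" for x y
    using that translates by (auto simp: inv_mult_group)
  have "B (\<lambda>x. (\<Sum>y\<in>S. f (inv (inv x \<otimes> y))) / real (card S)) x
      = B (\<lambda>x. \<Sum>y\<in>S. (1 / real (card S)) * f (inv y \<otimes> x)) x"
    by (rule averages_cong[OF assms(2)]) (use translates inv_eq in \<open>auto simp: sum_divide_distrib intro!: sum.cong\<close>)
  also have "\<dots> = (\<Sum>y\<in>S. (1 / real (card S)) * B (\<lambda>x. f (inv y \<otimes> x)) x)"
    by (rule fun_cong[OF averages_sum[OF assms(2) translates(1)]])
  also have "\<dots> = (\<Sum>y\<in>S. B f (inv (inv x \<otimes> y))) / real (card S)"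
  proof -
    have "(1 / real (card S)) * B (\<lambda>x. f (inv y \<otimes> x)) x = B f (inv (inv x \<otimes> y)) / real (card S)"
      if "y \<in> S" for y
      using averages_left[OF assms(2), of "inv y" x f] translates inv_eq[OF _ that] that by auto
    then show ?thesis by (simp only: sum_divide_distrib cong: sum.cong)
  qed
  finally show ?case .
next
  case (compose A1 A2)
  define k where "k = (\<lambda>x. A2 (\<lambda>z. f (inv z)) (inv x))"
  have 1: "A1 (A2 (\<lambda>z. f (inv z))) (inv x) = A1 (\<lambda>z. k (inv z)) (inv x)" if "x \<in> carrier G" for x
    by (rule averages_cong[OF compose.hyps(1)]) (use that in \<open>auto simp: k_def\<close>)
  have "B (\<lambda>x. A1 (A2 (\<lambda>z. f (inv z))) (inv x)) x = B (\<lambda>x. A1 (\<lambda>z. k (inv z)) (inv x)) x"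
    by (rule averages_cong[OF assms(2)]) (use 1 compose.prems in auto)
  also have "\<dots> = A1 (\<lambda>z. B k (inv z)) (inv x)"
    by (rule compose.IH(1)[OF compose.prems])
  also have "\<dots> = A1 (A2 (\<lambda>z. B f (inv z))) (inv x)"
    by (rule averages_cong[OF compose.hyps(1)]) (use compose.prems compose.IH(2) in \<open>auto simp: k_def\<close>)
  finally show ?case .
qed

definition almost_mean :: "('a \<Rightarrow> real) \<Rightarrow> real \<Rightarrow> real \<Rightarrow> bool" where
  "almost_mean f c e \<longleftrightarrow> (\<exists>A\<in>averages. \<forall>x\<in>carrier G. \<bar>A f x - c\<bar> \<le> e)"

text \<open>The oscillation shrinks by the fixed factor \<open>q\<close> in each round until it is
  at most \<open>2 * e\<close>: either no value lies in the lower half of the range, or one low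
  value is brought to every point by averaging over a net.\<close>

lemma almost_mean_exists:
  assumes f: "unif_cont f" and e: "0 < e"
  shows "\<exists>c. almost_mean f c (2 * e)"
proof -
  obtain V where V: "nbhd_one V" "\<And>x y. close V x y \<Longrightarrow> \<bar>f x - f y\<bar> < e / 2"
    using unif_contD[OF f, of "e / 2"] e by auto
  obtain F where F: "finite F" "F \<noteq> {}" "F \<subseteq> carrier G" "\<And>x. x \<in> carrier G \<Longrightarrow> \<exists>p\<in>F. close V x p"
    using finite_net[OF V(1)] by metis
  define N where "N = real (card F)"
  have N: "1 \<le> N" using F(1,2) by (simp add: N_def Suc_le_eq card_gt_0_iff)
  obtain B where B: "\<And>x. x \<in> carrier G \<Longrightarrow> \<bar>f x\<bar> \<le> B" using unif_cont_bounded[OF f] by metis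
  define q where "q = 1 - 1 / (4 * N)"
  have q: "0 \<le> q" "q < 1" "1 / 2 \<le> q" using N by (auto simp: q_def field_simps)
  have one: "(\<lambda>f x. (\<Sum>y\<in>{\<one>}. f (x \<otimes> y)) / real (card {\<one>})) \<in> averages"
    by (rule averages.translates) auto
  have step: "\<exists>A\<in>averages. \<exists>lo hi. (\<forall>x\<in>carrier G. lo \<le> A f x \<and> A f x \<le> hi)
      \<and> hi - lo \<le> max (2 * e) (q ^ k * (2 * B))" for k
  proof (induction k)
    case 0
    have "- B \<le> f x \<and> f x \<le> B" if "x \<in> carrier G" for x using B[OF that] by linarith
    then show ?case by (intro bexI[OF _ one] exI[of _ "- B"] exI[of _ B]) auto
  next
    case (Suc k)
    then obtain A lo hi where A: "A \<in> averages" "\<And>x. x \<in> carrier G \<Longrightarrow> lo \<le> A f x \<and> A f x \<le> hi"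
      and D: "hi - lo \<le> max (2 * e) (q ^ k * (2 * B))" by blast
    show ?case
    proof (cases "hi - lo \<le> 2 * e")
      case True
      then show ?thesis using A by (intro bexI[OF _ A(1)] exI[of _ lo] exI[of _ hi]) auto
    next
      case False
      then have D': "q * (hi - lo) \<le> q ^ Suc k * (2 * B)" using D q by (auto intro: mult_left_mono)
      show ?thesis
      proof (cases "\<forall>x\<in>carrier G. lo + (hi - lo) / 2 \<le> A f x")
        case True
        moreover have "(hi - lo) * (1 / 2) \<le> (hi - lo) * q"
          using q False e by (intro mult_left_mono) auto
        then have "hi - (lo + (hi - lo) / 2) \<le> max (2 * e) (q ^ Suc k * (2 * B))"
          using D' by (simp add: field_simps max_def)
        ultimately show ?thesis using A
          by (intro bexI[OF _ A(1)] exI[of _ "lo + (hi - lo) / 2"] exI[of _ hi]) auto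
      next
        case False': False
        then obtain x0 where x0: "x0 \<in> carrier G" "A f x0 < lo + (hi - lo) / 2" by auto
        \<comment> \<open>If \<open>x\<close> is close to the net point \<open>w\<close>, then
          \<open>x \<otimes> inv w \<otimes> x0\<close> is close to \<open>x0\<close>. So at every
          \<open>x\<close> one of at most \<open>N\<close> summands is below the midpoint plus
          \<open>e / 2\<close>, hence at most \<open>hi - (hi - lo) / 4\<close>, and the average
          drops by at least \<open>(hi - lo) / (4 * N)\<close>.\<close>
        define S where "S = (\<lambda>w. inv w \<otimes> x0) ` F"
        have S: "finite S" "S \<noteq> {}" "S \<subseteq> carrier G" using F x0 by (auto simp: S_def)
        let ?B = "\<lambda>f x. (\<Sum>y\<in>S. f (x \<otimes> y)) / real (card S)"
        have BA: "?B \<in> averages" by (rule averages.translates[OF S])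
        have bound: "?B (A f) x \<le> hi - (hi - lo) / (4 * N)" if x: "x \<in> carrier G" for x
        proof -
          obtain p where p: "p \<in> F" "close V x p" using F(4)[OF x] by blast
          define y where "y = inv p \<otimes> x0"
          have y: "y \<in> S" "y \<in> carrier G" using p F(3) x0 by (auto simp: S_def y_def)
          have "close V (x \<otimes> y) (p \<otimes> y)" by (rule close_mult_right[OF p(2) y(2)])
          moreover have "p \<otimes> y = x0" using p F(3) x0 by (auto simp: y_def simp flip: m_assoc)
          ultimately have "close V (x \<otimes> y) x0" by simp
          then have "\<bar>A f (x \<otimes> y) - A f x0\<bar> \<le> e / 2"
            using averages_modulus[OF A(1), of V f "e / 2"] V(2) by (force intro: less_imp_le)
          then have small: "A f (x \<otimes> y) \<le> hi - (hi - lo) / 4" using x0(2) False by argo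
          have "(\<Sum>z\<in>S. A f (x \<otimes> z)) = A f (x \<otimes> y) + (\<Sum>z\<in>S - {y}. A f (x \<otimes> z))"
            using S(1) y(1) by (rule sum.remove)
          also have "(\<Sum>z\<in>S - {y}. A f (x \<otimes> z)) \<le> real (card (S - {y})) * hi"
            using A(2) S x by (intro sum_bounded_above) auto
          also have "real (card (S - {y})) = real (card S) - 1"
            using S y by (simp add: card_Diff_singleton of_nat_diff Suc_le_eq card_gt_0_iff)
          finally have "(\<Sum>z\<in>S. A f (x \<otimes> z)) \<le> real (card S) * hi - (hi - lo) / 4"
            using small by (simp add: algebra_simps)
          then have "?B (A f) x \<le> (real (card S) * hi - (hi - lo) / 4) / real (card S)"
            by (rule divide_right_mono) simp
          also have "\<dots> = hi - (hi - lo) / (4 * real (card S))"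
            using S by (simp add: diff_divide_distrib card_gt_0_iff)
          also have "\<dots> \<le> hi - (hi - lo) / (4 * N)"
          proof -
            have "card S \<le> card F" unfolding S_def by (rule card_image_le[OF F(1)])
            moreover have "0 < card S" using S by (simp add: card_gt_0_iff)
            ultimately show ?thesis using False e
              by (auto simp: N_def intro!: divide_left_mono)
          qed
          finally show ?thesis .
        qed
        have "hi - (hi - lo) / (4 * N) - lo = q * (hi - lo)" by (simp add: q_def algebra_simps)
        then show ?thesis
          using bound averages_ge[OF BA, of lo "A f"] A(2) D'
          by (intro bexI[OF _ averages.compose[OF BA A(1)]] exI[of _ lo] exI[of _ "hi - (hi - lo) / (4 * N)"]) auto
      qed
    qed
  qed
  have "(\<lambda>k. q ^ k * (2 * B)) \<longlonglongrightarrow> 0 * (2 * B)"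
    using q by (intro tendsto_mult LIMSEQ_power_zero tendsto_const) auto
  then have "eventually (\<lambda>k. q ^ k * (2 * B) < 2 * e) sequentially"
    by (rule order_tendstoD) (use e in simp)
  then obtain k where "q ^ k * (2 * B) < 2 * e"
    by (meson eventually_happens' sequentially_bot)
  then obtain A lo hi where "A \<in> averages" "\<And>x. x \<in> carrier G \<Longrightarrow> lo \<le> A f x \<and> A f x \<le> hi" "hi - lo \<le> 2 * e"
    using step[of k] by (auto simp: max_def)
  then show ?thesis unfolding almost_mean_def
    by (intro exI[of _ lo] bexI[of _ A] ballI) (auto simp: abs_le_iff, smt (verit, best))
qed

text \<open>After inversion right averages become left averages. Applying one of each kind to
  \<open>f\<close>, in the two possible orders, gives the same value at \<open>\<one>\<close>, which
  is near both \<open>c\<close> and \<open>p\<close>.\<close>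

lemma almost_mean_inv:
  assumes "almost_mean f c e" "almost_mean (\<lambda>x. f (inv x)) p e'"
  shows "\<bar>c - p\<bar> \<le> e + e'"
proof -
  obtain A where A: "A \<in> averages" "\<And>x. x \<in> carrier G \<Longrightarrow> \<bar>A f x - c\<bar> \<le> e"
    using assms(1) unfolding almost_mean_def by blast
  obtain A' where A': "A' \<in> averages" "\<And>x. x \<in> carrier G \<Longrightarrow> \<bar>A' (\<lambda>x. f (inv x)) x - p\<bar> \<le> e'"
    using assms(2) unfolding almost_mean_def by blast
  have "\<bar>A (\<lambda>x. A' (\<lambda>z. f (inv z)) (inv x)) \<one> - p\<bar> \<le> e'"
    by (rule averages_approx[OF A(1)]) (use A'(2) in auto)
  moreover have "\<bar>A' (\<lambda>z. A f (inv z)) (inv \<one>) - c\<bar> \<le> e"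
    by (rule averages_approx[OF A'(1)]) (use A(2) in auto)
  ultimately show ?thesis
    using averages_commute[OF A'(1) A(1), of \<one> f] by simp
qed

text \<open>Both values are compared with one left mean, which exists to any precision; its error
  contributes \<open>d / 2\<close> on each side.\<close>

lemma almost_mean_unique:
  assumes f: "unif_cont f" and "almost_mean f c e" "almost_mean f c' e'"
  shows "\<bar>c - c'\<bar> \<le> e + e'"
proof (rule field_le_epsilon)
  fix d :: real assume "0 < d"
  then obtain p where "almost_mean (\<lambda>x. f (inv x)) p (2 * (d / 4))"
    using almost_mean_exists[OF unif_cont_inv[OF f], of "d / 4"] by auto
  then show "\<bar>c - c'\<bar> \<le> e + e' + d"
    using almost_mean_inv[OF assms(2)] almost_mean_inv[OF assms(3)] by fastforce
qed

text \<open>For uniformly continuous \<open>f\<close> the intervals from \<open>c - e\<close> to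
  \<open>c + e\<close> intersect pairwise by \<open>almost_mean_unique\<close>, so the supremum of
  their left ends lies in all of them.\<close>

definition mean :: "('a \<Rightarrow> real) \<Rightarrow> real" where
  "mean f = Sup {c - e | c e. almost_mean f c e}"

lemma mean_near:
  assumes f: "unif_cont f" and c: "almost_mean f c e" shows "\<bar>mean f - c\<bar> \<le> e"
proof -
  let ?L = "{c - e | c e. almost_mean f c e}"
  have ub: "l \<le> c + e" if "l \<in> ?L" for l
    using that almost_mean_unique[OF f c] by fastforce
  have "c - e \<in> ?L" using c by blast
  then have "c - e \<le> mean f" unfolding mean_def
    by (rule cSup_upper) (rule bdd_aboveI[OF ub])
  moreover have "mean f \<le> c + e" unfolding mean_def
    by (rule cSup_least) (use ub \<open>c - e \<in> ?L\<close> in auto)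
  ultimately show ?thesis by linarith
qed

lemma almost_mean_mean:
  assumes f: "unif_cont f" and e: "0 < e" shows "almost_mean f (mean f) e"
proof -
  obtain c where c: "almost_mean f c (2 * (e / 4))"
    using almost_mean_exists[OF f, of "e / 4"] e by auto
  then obtain A where A: "A \<in> averages" "\<And>x. x \<in> carrier G \<Longrightarrow> \<bar>A f x - c\<bar> \<le> 2 * (e / 4)"
    unfolding almost_mean_def by blast
  have "\<bar>A f x - mean f\<bar> \<le> e" if "x \<in> carrier G" for x
    using A(2)[OF that] mean_near[OF f c] by linarith
  then show ?thesis unfolding almost_mean_def using A(1) by blast
qed

lemma mean_eqI:
  assumes "unif_cont f" "\<And>e. 0 < e \<Longrightarrow> almost_mean f c e" shows "mean f = c"
proof -
  have "\<bar>mean f - c\<bar> \<le> 0 + e" if "0 < e" for e using mean_near[OF assms(1) assms(2)[OF that]] by simp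
  then have "\<bar>mean f - c\<bar> \<le> 0" by (rule field_le_epsilon)
  then show ?thesis by simp
qed

lemma mean_average:
  assumes "A \<in> averages" "unif_cont f" shows "mean (A f) = mean f"
proof (rule sym, rule mean_eqI[OF assms(2)])
  fix e :: real assume "0 < e"
  then obtain B where "B \<in> averages" "\<forall>x\<in>carrier G. \<bar>B (A f) x - mean (A f)\<bar> \<le> e"
    using almost_mean_mean[OF averages_unif_cont[OF assms]] unfolding almost_mean_def by blast
  then show "almost_mean f (mean (A f)) e"
    unfolding almost_mean_def using averages.compose[OF _ assms(1)] by (intro bexI[of _ "\<lambda>f. B (A f)"]) auto
qed

text \<open>The averages are applied one after another: a later one neither spoils an approximation
  already reached, by \<open>averages_approx\<close>, nor changes the mean of the next function, by
  \<open>mean_average\<close>.\<close>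

lemma mean_simultaneous:
  assumes "finite F" "\<And>f. f \<in> F \<Longrightarrow> unif_cont f" "0 < e"
  obtains A where "A \<in> averages" "\<And>f x. f \<in> F \<Longrightarrow> x \<in> carrier G \<Longrightarrow> \<bar>A f x - mean f\<bar> \<le> e"
proof -
  have "\<exists>A\<in>averages. \<forall>f\<in>F. \<forall>x\<in>carrier G. \<bar>A f x - mean f\<bar> \<le> e"
    using assms(1,2)
  proof (induction F)
    case empty
    have "(\<lambda>f x. (\<Sum>y\<in>{\<one>}. f (x \<otimes> y)) / real (card {\<one>})) \<in> averages"
      by (rule averages.translates) auto
    then show ?case by blast
  next
    case (insert f F)
    then obtain A where A: "A \<in> averages" "\<forall>f\<in>F. \<forall>x\<in>carrier G. \<bar>A f x - mean f\<bar> \<le> e" by auto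
    have f: "unif_cont f" using insert by auto
    then obtain B where B: "B \<in> averages" "\<forall>x\<in>carrier G. \<bar>B (A f) x - mean f\<bar> \<le> e"
      using almost_mean_mean[OF averages_unif_cont[OF A(1) f] assms(3)]
      unfolding almost_mean_def by (auto simp: mean_average[OF A(1) f])
    then show ?case
      using A averages_approx[OF B(1)] by (intro bexI[OF _ averages.compose[OF B(1) A(1)]]) auto
  qed
  then show thesis using that by blast
qed

lemma mean_linear:
  assumes f: "unif_cont f" and g: "unif_cont g"
  shows "mean (\<lambda>x. a * f x + b * g x) = a * mean f + b * mean g"
proof (rule mean_eqI)
  show "unif_cont (\<lambda>x. a * f x + b * g x)"
    by (intro unif_cont_add unif_cont_mult unif_cont_const f g)
  fix e :: real assume e: "0 < e"
  define d where "d = e / (\<bar>a\<bar> + \<bar>b\<bar> + 1)"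
  have d: "0 < d" "(\<bar>a\<bar> + \<bar>b\<bar>) * d \<le> e"
    using e by (auto simp: d_def field_simps)
  obtain A where A: "A \<in> averages" "\<And>h x. h \<in> {f, g} \<Longrightarrow> x \<in> carrier G \<Longrightarrow> \<bar>A h x - mean h\<bar> \<le> d"
    using mean_simultaneous[of "{f, g}" d] f g d(1) by auto
  have "\<bar>A (\<lambda>x. a * f x + b * g x) x - (a * mean f + b * mean g)\<bar> \<le> e" if x: "x \<in> carrier G" for x
  proof -
    have "\<bar>a * (A f x - mean f) + b * (A g x - mean g)\<bar> \<le> \<bar>a\<bar> * d + \<bar>b\<bar> * d"
      using A(2)[OF _ x] by (intro order_trans[OF abs_triangle_ineq] add_mono) (auto simp: abs_mult intro!: mult_left_mono)
    also have "\<dots> \<le> e" using d(2) by (simp add: algebra_simps)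
    finally show ?thesis by (simp add: averages_linear[OF A(1)] algebra_simps)
  qed
  then show "almost_mean (\<lambda>x. a * f x + b * g x) (a * mean f + b * mean g) e"
    unfolding almost_mean_def using A(1) by blast
qed

lemma mean_add: "unif_cont f \<Longrightarrow> unif_cont g \<Longrightarrow> mean (\<lambda>x. f x + g x) = mean f + mean g"
  using mean_linear[of f g 1 1] by simp

lemma mean_diff: "unif_cont f \<Longrightarrow> unif_cont g \<Longrightarrow> mean (\<lambda>x. f x - g x) = mean f - mean g"
  using mean_linear[of f g 1 "-1"] by simp

lemma mean_scale: "unif_cont f \<Longrightarrow> mean (\<lambda>x. a * f x) = a * mean f"
  using mean_linear[of f f a 0] by simp

lemma mean_le:
  assumes "unif_cont f" "\<And>x. x \<in> carrier G \<Longrightarrow> f x \<le> c" shows "mean f \<le> c"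
proof (rule field_le_epsilon)
  fix e :: real assume "0 < e"
  then obtain A where A: "A \<in> averages" "\<forall>x\<in>carrier G. \<bar>A f x - mean f\<bar> \<le> e"
    using almost_mean_mean[OF assms(1)] unfolding almost_mean_def by blast
  have "A f \<one> \<le> c" by (rule averages_le[OF A(1)]) (use assms(2) in auto)
  then show "mean f \<le> c + e" using bspec[OF A(2), of \<one>] by simp
qed

lemma mean_const [simp]: "mean (\<lambda>x. c) = c"
proof (rule antisym)
  show "mean (\<lambda>x. c) \<le> c" by (rule mean_le) (auto simp: unif_cont_const)
  have "mean (\<lambda>x. - c) \<le> - c" by (rule mean_le) (auto simp: unif_cont_const)
  then show "c \<le> mean (\<lambda>x. c)" using mean_scale[OF unif_cont_const, of "-1" c] by simp
qed

lemma mean_mono: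
  assumes "unif_cont f" "unif_cont g" "\<And>x. x \<in> carrier G \<Longrightarrow> f x \<le> g x" shows "mean f \<le> mean g"
  using mean_le[of "\<lambda>x. f x - g x" 0] assms by (simp add: unif_cont_diff mean_diff)

lemma mean_cong:
  assumes "unif_cont f" "unif_cont g" "\<And>x. x \<in> carrier G \<Longrightarrow> f x = g x" shows "mean f = mean g"
  using mean_mono[OF assms(1,2)] mean_mono[OF assms(2,1)] assms(3) by force

lemma mean_right:
  assumes "unif_cont f" "a \<in> carrier G" shows "mean (\<lambda>x. f (x \<otimes> a)) = mean f"
proof -
  have "(\<lambda>f x. (\<Sum>y\<in>{a}. f (x \<otimes> y)) / real (card {a})) \<in> averages"
    by (rule averages.translates) (use assms in auto)
  from mean_average[OF this assms(1)] show ?thesis by simp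
qed

text \<open>The net argument of \<open>almost_mean_exists\<close> again: finitely many translates
  bring a large value near every point, so one average has a positive lower bound. This makes
  \<open>norm2\<close> definite on the carrier.\<close>

lemma mean_pos:
  assumes f: "unif_cont f" "\<And>x. x \<in> carrier G \<Longrightarrow> 0 \<le> f x" and x0: "x0 \<in> carrier G" "0 < f x0"
  shows "0 < mean f"
proof -
  obtain V where V: "nbhd_one V" "\<And>x y. close V x y \<Longrightarrow> \<bar>f x - f y\<bar> < f x0 / 2"
    using unif_contD[OF f(1), of "f x0 / 2"] x0(2) by auto
  obtain F where F: "finite F" "F \<noteq> {}" "F \<subseteq> carrier G" "\<And>x. x \<in> carrier G \<Longrightarrow> \<exists>p\<in>F. close V x p"
    using finite_net[OF V(1)] by metis
  define S where "S = (\<lambda>w. inv w \<otimes> x0) ` F"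
  have S: "finite S" "S \<noteq> {}" "S \<subseteq> carrier G" using F x0 by (auto simp: S_def)
  let ?B = "\<lambda>f x. (\<Sum>y\<in>S. f (x \<otimes> y)) / real (card S)"
  have BA: "?B \<in> averages" by (rule averages.translates[OF S])
  have card: "0 < real (card S)" using S by (simp add: card_gt_0_iff)
  have "f x0 / 2 / real (card S) \<le> ?B f x" if x: "x \<in> carrier G" for x
  proof -
    obtain p where p: "p \<in> F" "close V x p" using F(4)[OF x] by blast
    define y where "y = inv p \<otimes> x0"
    have y: "y \<in> S" "y \<in> carrier G" using p F(3) x0 by (auto simp: S_def y_def)
    have "close V (x \<otimes> y) (p \<otimes> y)" by (rule close_mult_right[OF p(2) y(2)])
    moreover have "p \<otimes> y = x0" using p F(3) x0 by (auto simp: y_def simp flip: m_assoc)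
    ultimately have "close V (x \<otimes> y) x0" by simp
    from V(2)[OF this] have "f x0 / 2 \<le> f (x \<otimes> y)" by linarith
    also have "\<dots> \<le> (\<Sum>y\<in>S. f (x \<otimes> y))"
      using S y(1) x f(2) by (intro member_le_sum) auto
    finally show ?thesis by (rule divide_right_mono) simp
  qed
  then have "mean (\<lambda>x. f x0 / 2 / real (card S)) \<le> mean (?B f)"
    by (intro mean_mono unif_cont_const averages_unif_cont[OF BA f(1)])
  also have "mean (?B f) = mean f" by (rule mean_average[OF BA f(1)])
  finally have "f x0 / 2 / real (card S) \<le> mean f" by simp
  then show ?thesis using x0(2) card by (smt (verit) divide_pos_pos half_gt_zero)
qed

text \<open>Simultaneous approximation of the means of finitely many sections by one and the same
  average reduces the exchange of the two means to a finite sum.\<close>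

lemma mean_mean_swap:
  assumes \<Phi>: "continuous_map (prod_topology T T) euclideanreal (\<lambda>(x, y). \<Phi> x y)"
  shows "unif_cont (\<lambda>x. mean (\<lambda>y. \<Phi> x y))" (is ?uc)
    and "mean (\<lambda>x. mean (\<lambda>y. \<Phi> x y)) = mean (\<lambda>y. mean (\<lambda>x. \<Phi> x y))"
proof -
  have sect: "unif_cont (\<lambda>y. \<Phi> x y)"
    if "x \<in> carrier G" "continuous_map (prod_topology T T) euclideanreal (\<lambda>(x, y). \<Phi> x y)"
    for x and \<Phi> :: "'a \<Rightarrow> 'a \<Rightarrow> real"
  proof -
    have "continuous_map T (prod_topology T T) (\<lambda>y. (x, y))"
      using that by (intro continuous_map_pairedI) (auto simp: topspace_eq_carrier)
    from continuous_map_compose[OF this that(2)] show ?thesis by (simp add: unif_cont_iff o_def)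
  qed
  have swap: "continuous_map (prod_topology T T) euclideanreal (\<lambda>(y, x). \<Phi> x y)"
    using continuous_map_compose[OF _ \<Phi>, of "prod_topology T T" "\<lambda>(y, x). (x, y)"]
    by (simp add: o_def case_prod_unfold continuous_map_pairedI continuous_map_fst continuous_map_snd)
  have unif: "\<exists>V. nbhd_one V \<and> (\<forall>y\<in>carrier G. \<forall>x x'. close V x x' \<longrightarrow> \<bar>\<Phi> y x - \<Phi> y x'\<bar> < e)"
    if "0 < e" "continuous_map (prod_topology T T) euclideanreal (\<lambda>(x, y). \<Phi> x y)"
    for e and \<Phi> :: "'a \<Rightarrow> 'a \<Rightarrow> real"
  proof -
    note pos = that(1) and cont = that(2)
    obtain V where "nbhd_one V" "\<And>y x x'. y \<in> topspace T \<Longrightarrow> close V x x'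
        \<Longrightarrow> \<bar>(case (y, x) of (x, y) \<Rightarrow> \<Phi> x y) - (case (y, x') of (x, y) \<Rightarrow> \<Phi> x y)\<bar> < e"
      by (rule continuous_map_uniform[OF compact_T cont pos]) (rule that)
    then show ?thesis by (intro exI[of _ V]) (auto simp: topspace_eq_carrier)
  qed
  have uc: "unif_cont (\<lambda>x. mean (\<lambda>y. \<Phi> x y))"
    if \<Phi>: "continuous_map (prod_topology T T) euclideanreal (\<lambda>(x, y). \<Phi> x y)"
      and swap: "continuous_map (prod_topology T T) euclideanreal (\<lambda>(y, x). \<Phi> x y)"
    for \<Phi> :: "'a \<Rightarrow> 'a \<Rightarrow> real"
    unfolding unif_cont_def
  proof (intro allI impI)
    fix e :: real assume e: "0 < e"
    then obtain V where V: "nbhd_one V" "\<And>y x x'. y \<in> carrier G \<Longrightarrow> close V x x' \<Longrightarrow> \<bar>\<Phi> x y - \<Phi> x' y\<bar> < e / 2"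
      using unif[OF _ swap, of "e / 2"] by auto
    have "\<bar>mean (\<lambda>y. \<Phi> x y) - mean (\<lambda>y. \<Phi> x' y)\<bar> < e" if c: "close V x x'" for x x'
    proof -
      have x: "x \<in> carrier G" "x' \<in> carrier G" using c by (auto simp: close_def)
      have "\<Phi> x y - \<Phi> x' y \<le> e / 2 \<and> \<Phi> x' y - \<Phi> x y \<le> e / 2" if "y \<in> carrier G" for y
        using V(2)[OF that c] by linarith
      then have "mean (\<lambda>y. \<Phi> x y - \<Phi> x' y) \<le> e / 2" "mean (\<lambda>y. \<Phi> x' y - \<Phi> x y) \<le> e / 2"
        by (intro mean_le unif_cont_diff sect[OF _ \<Phi>] x; blast)+
      then show ?thesis using e by (simp add: mean_diff sect[OF _ \<Phi>] x abs_less_iff)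
    qed
    then show "\<exists>V. nbhd_one V \<and> (\<forall>x x'. close V x x' \<longrightarrow> \<bar>mean (\<lambda>y. \<Phi> x y) - mean (\<lambda>y. \<Phi> x' y)\<bar> < e)"
      using V(1) by blast
  qed
  show K: ?uc by (rule uc[OF \<Phi> swap])
  let ?K = "\<lambda>x. mean (\<lambda>y. \<Phi> x y)" and ?F = "\<lambda>y. mean (\<lambda>x. \<Phi> x y)"
  have F: "unif_cont ?F" by (rule uc[of "\<lambda>y x. \<Phi> x y", OF swap \<Phi>])
  have "\<bar>mean ?K - mean ?F\<bar> \<le> 0 + e" if e: "0 < e" for e
  proof -
    obtain V where V: "nbhd_one V" "\<And>y x x'. y \<in> carrier G \<Longrightarrow> close V x x' \<Longrightarrow> \<bar>\<Phi> x y - \<Phi> x' y\<bar> < e / 8"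
      using unif[OF _ swap, of "e / 8"] e by auto
    obtain V' where V': "nbhd_one V'" "\<And>x x'. close V' x x' \<Longrightarrow> \<bar>?K x - ?K x'\<bar> < e / 8"
      using unif_contD[OF K, of "e / 8"] e by auto
    obtain P where P: "finite P" "P \<subseteq> carrier G" "\<And>x. x \<in> carrier G \<Longrightarrow> \<exists>p\<in>P. close (V \<inter> V') x p"
      using finite_net[OF nbhd_one_Int[OF V(1) V'(1)]] by metis
    have "unif_cont f" if "f \<in> insert ?F (\<Phi> ` P)" for f
      using that F sect[OF _ \<Phi>] P(2) by auto
    then obtain A where A: "A \<in> averages"
      "\<And>f x. f \<in> insert ?F (\<Phi> ` P) \<Longrightarrow> x \<in> carrier G \<Longrightarrow> \<bar>A f x - mean f\<bar> \<le> e / 8"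
      using mean_simultaneous[of "insert ?F (\<Phi> ` P)" "e / 8"] P(1) e
      by (metis (no_types, lifting) finite.insertI finite_imageI zero_less_divide_iff zero_less_numeral)
    \<comment> \<open>Passing to a net point costs three errors of \<open>e / 8\<close>: under the
      average, between average and mean, and in \<open>?K\<close>.\<close>
    have near: "\<bar>A (\<Phi> x) \<one> - ?K x\<bar> \<le> e / 2" if x: "x \<in> carrier G" for x
    proof -
      obtain p where p: "p \<in> P" "close (V \<inter> V') x p" using P(3)[OF x] by blast
      then have p': "close V x p" "close V' x p" by (auto intro: close_mono[rotated])
      have "\<bar>A (\<lambda>y. 1 * \<Phi> x y + (- 1) * \<Phi> p y) \<one> - 0\<bar> \<le> e / 8"
        by (rule averages_approx[OF A(1)]) (use V(2)[OF _ p'(1)] in \<open>auto intro: less_imp_le\<close>)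
      then have "\<bar>A (\<Phi> x) \<one> - A (\<Phi> p) \<one>\<bar> \<le> e / 8"
        by (subst (asm) averages_linear[OF A(1)]) simp
      moreover have "\<bar>A (\<Phi> p) \<one> - ?K p\<bar> \<le> e / 8" using A(2)[of "\<Phi> p" \<one>] p by simp
      ultimately show ?thesis using V'(2)[OF p'(2)] e by linarith
    qed
    have A_mean: "mean (\<lambda>x. A (\<Phi> x) \<one>) = A ?F \<one> \<and> unif_cont (\<lambda>x. A (\<Phi> x) \<one>)"
    proof -
      have "mean (\<lambda>x. A (\<Phi> x) z) = A (\<lambda>y. mean (\<lambda>x. \<Phi> x y)) z \<and> unif_cont (\<lambda>x. A (\<Phi> x) z)"
        if "z \<in> carrier G" "A \<in> averages" "\<And>z. z \<in> carrier G \<Longrightarrow> unif_cont (\<lambda>x. \<Phi> x z)"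
        for z A and \<Phi> :: "'a \<Rightarrow> 'a \<Rightarrow> real"
        using that(2,1,3)
      proof (induction arbitrary: \<Phi> z)
        case (translates S \<Phi> z)
        have sum: "mean (\<lambda>x. \<Sum>y\<in>S'. \<Phi> x (z \<otimes> y)) = (\<Sum>y\<in>S'. mean (\<lambda>x. \<Phi> x (z \<otimes> y)))
            \<and> unif_cont (\<lambda>x. \<Sum>y\<in>S'. \<Phi> x (z \<otimes> y))" if "finite S'" "S' \<subseteq> carrier G" for S'
          using that
        proof (induction S')
          case (insert y S')
          then have "unif_cont (\<lambda>x. \<Phi> x (z \<otimes> y))" using translates by auto
          then show ?case using insert by (simp add: mean_add unif_cont_add)
        qed (simp add: unif_cont_const)
        show ?case
          using sum[OF translates(1,3)] mean_scale[of "\<lambda>x. \<Sum>y\<in>S. \<Phi> x (z \<otimes> y)" "1 / real (card S)"]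
            unif_cont_mult[OF unif_cont_const[of "1 / real (card S)"], of "\<lambda>x. \<Sum>y\<in>S. \<Phi> x (z \<otimes> y)"]
          by simp
      next
        case (compose A B \<Phi> z)
        have B: "mean (\<lambda>x. B (\<Phi> x) z) = B (\<lambda>y. mean (\<lambda>x. \<Phi> x y)) z \<and> unif_cont (\<lambda>x. B (\<Phi> x) z)"
          if "z \<in> carrier G" for z
          by (rule compose.IH(2)[OF that]) (rule compose.prems(2))
        have "mean (\<lambda>x. A (B (\<Phi> x)) z) = A (\<lambda>y. mean (\<lambda>x. B (\<Phi> x) y)) z \<and> unif_cont (\<lambda>x. A (B (\<Phi> x)) z)"
          by (rule compose.IH(1)[OF compose.prems(1)]) (rule conjunct2[OF B])
        moreover have "A (\<lambda>y. mean (\<lambda>x. B (\<Phi> x) y)) z = A (B (\<lambda>y. mean (\<lambda>x. \<Phi> x y))) z"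
          by (rule averages_cong[OF compose.hyps(1)]) (use B compose.prems in auto)
        ultimately show ?case by simp
      qed
      from this[OF one_closed A(1), of \<Phi>] show ?thesis using sect[of _ "\<lambda>y x. \<Phi> x y", OF _ swap] by simp
    qed
    have "\<bar>mean (\<lambda>x. A (\<Phi> x) \<one>) - mean ?K\<bar> \<le> e / 2"
    proof -
      have "A (\<Phi> x) \<one> - ?K x \<le> e / 2 \<and> ?K x - A (\<Phi> x) \<one> \<le> e / 2" if "x \<in> carrier G" for x
        using near[OF that] by linarith
      then have "mean (\<lambda>x. A (\<Phi> x) \<one> - ?K x) \<le> e / 2" "mean (\<lambda>x. ?K x - A (\<Phi> x) \<one>) \<le> e / 2"
        using A_mean K by (intro mean_le unif_cont_diff; blast)+
      then show ?thesis
        using mean_diff[OF conjunct2[OF A_mean] K] mean_diff[OF K conjunct2[OF A_mean]] by linarith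
    qed
    moreover have "\<bar>A ?F \<one> - mean ?F\<bar> \<le> e / 8" using A(2)[of ?F \<one>] by simp
    ultimately show ?thesis using A_mean e by linarith
  qed
  then have "\<bar>mean ?K - mean ?F\<bar> \<le> 0" by (rule field_le_epsilon)
  then show "mean ?K = mean ?F" by simp
qed


section \<open>Eigenfunctions\<close>

definition ip :: "('a \<Rightarrow> real) \<Rightarrow> ('a \<Rightarrow> real) \<Rightarrow> real" where
  "ip f g = mean (\<lambda>x. f x * g x)"

definition norm2 :: "('a \<Rightarrow> real) \<Rightarrow> real" where
  "norm2 f = sqrt (ip f f)"

lemma ip_commute: "ip f g = ip g f"
  by (simp add: ip_def mult.commute)

lemma ip_linear:
  assumes "unif_cont f" "unif_cont g" "unif_cont k"
  shows "ip (\<lambda>x. a * f x + b * g x) k = a * ip f k + b * ip g k"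
  using mean_linear[OF unif_cont_mult[OF assms(1,3)] unif_cont_mult[OF assms(2,3)], of a b]
  by (simp add: ip_def algebra_simps)

lemma ip_cong:
  assumes "unif_cont f" "unif_cont f'" "unif_cont g" "unif_cont g'"
    and "\<And>x. x \<in> carrier G \<Longrightarrow> f x * g x = f' x * g' x"
  shows "ip f g = ip f' g'"
  unfolding ip_def by (rule mean_cong) (use assms in \<open>auto intro: unif_cont_mult\<close>)

lemma ip_nonneg: "unif_cont f \<Longrightarrow> 0 \<le> ip f f"
  using mean_mono[OF unif_cont_const[of 0] unif_cont_mult[of f f]] by (simp add: ip_def)

lemma norm2_nonneg: "unif_cont f \<Longrightarrow> 0 \<le> norm2 f"
  by (simp add: norm2_def ip_nonneg)

lemma norm2_power2: "unif_cont f \<Longrightarrow> (norm2 f)\<^sup>2 = ip f f"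
  by (simp add: norm2_def ip_nonneg)

lemma norm2_pos:
  assumes "unif_cont f" "x \<in> carrier G" "f x \<noteq> 0" shows "0 < norm2 f"
proof -
  have "0 < f x * f x" using assms(3) by (meson not_real_square_gt_zero)
  then show ?thesis
    using mean_pos[OF unif_cont_mult[OF assms(1,1)] _ assms(2)] by (simp add: norm2_def ip_def)
qed

lemma norm2_le_sup:
  assumes "unif_cont f" "\<And>x. x \<in> carrier G \<Longrightarrow> \<bar>f x\<bar> \<le> c" shows "norm2 f \<le> c"
proof -
  have c: "0 \<le> c" using assms(2)[OF one_closed] by linarith
  have "f x * f x \<le> c * c" if "x \<in> carrier G" for x
    using assms(2)[OF that] c abs_le_square_iff[of "f x" c] by (simp add: power2_eq_square)
  then have "ip f f \<le> c\<^sup>2" unfolding ip_def power2_eq_square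
    by (intro mean_le unif_cont_mult assms)
  then show ?thesis unfolding norm2_def using c by (simp add: real_le_lsqrt ip_nonneg assms)
qed

lemma Cauchy_Schwarz_ip:
  assumes f: "unif_cont f" and g: "unif_cont g" shows "\<bar>ip f g\<bar> \<le> norm2 f * norm2 g"
proof (cases "ip g g = 0")
  case True
  then have "\<forall>x\<in>carrier G. g x = 0" using norm2_pos[OF g] by (force simp: norm2_def)
  then have "ip f g = ip (\<lambda>x. 0) (\<lambda>x. 0)"
    by (intro ip_cong f g unif_cont_const) auto
  then show ?thesis by (simp add: ip_def norm2_nonneg f g)
next
  case False
  then have p: "0 < ip g g" using ip_nonneg[OF g] by simp
  define t where "t = ip f g / ip g g"
  have u: "unif_cont (\<lambda>x. 1 * f x + (- t) * g x)" by (intro unif_cont_add unif_cont_mult unif_cont_const f g)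
  have "ip (\<lambda>x. 1 * f x + (- t) * g x) (\<lambda>x. 1 * f x + (- t) * g x)
      = ip f f - 2 * t * ip f g + t\<^sup>2 * ip g g"
    unfolding ip_linear[OF f g u] ip_commute[of _ "\<lambda>x. 1 * f x + (- t) * g x"]
      ip_linear[OF f g f] ip_linear[OF f g g]
    by (simp add: ip_commute[of g f] algebra_simps power2_eq_square)
  also have "\<dots> = ip f f - (ip f g)\<^sup>2 / ip g g"
    using p by (simp add: t_def power2_eq_square field_simps)
  finally have "(ip f g)\<^sup>2 / ip g g \<le> ip f f" using ip_nonneg[OF u] by linarith
  then have "(ip f g)\<^sup>2 \<le> ip f f * ip g g" using p by (simp add: pos_divide_le_eq)
  also have "\<dots> = (norm2 f * norm2 g)\<^sup>2" by (simp add: power_mult_distrib norm2_power2 f g)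
  finally show ?thesis using norm2_nonneg[OF f] norm2_nonneg[OF g]
    by (metis abs_le_square_iff abs_of_nonneg mult_nonneg_nonneg)
qed

lemma norm2_scale: "unif_cont f \<Longrightarrow> norm2 (\<lambda>x. a * f x) = \<bar>a\<bar> * norm2 f"
  using mean_scale[OF unif_cont_mult[of f f], of "a * a"]
  by (simp add: norm2_def ip_def real_sqrt_mult algebra_simps)

lemma norm2_triangle:
  assumes f: "unif_cont f" and g: "unif_cont g" shows "norm2 (\<lambda>x. f x + g x) \<le> norm2 f + norm2 g"
proof -
  have u: "unif_cont (\<lambda>x. 1 * f x + 1 * g x)" by (intro unif_cont_add unif_cont_mult unif_cont_const f g)
  have "ip (\<lambda>x. 1 * f x + 1 * g x) (\<lambda>x. 1 * f x + 1 * g x) = ip f f + 2 * ip f g + ip g g"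
    unfolding ip_linear[OF f g u] ip_commute[of _ "\<lambda>x. 1 * f x + 1 * g x"]
      ip_linear[OF f g f] ip_linear[OF f g g]
    by (simp add: ip_commute[of g f])
  also have "\<dots> \<le> (norm2 f)\<^sup>2 + 2 * (norm2 f * norm2 g) + (norm2 g)\<^sup>2"
    using Cauchy_Schwarz_ip[OF f g] by (simp add: norm2_power2 f g)
  also have "\<dots> = (norm2 f + norm2 g)\<^sup>2" by (simp add: power2_sum)
  finally have "ip (\<lambda>x. f x + g x) (\<lambda>x. f x + g x) \<le> (norm2 f + norm2 g)\<^sup>2" by simp
  then show ?thesis unfolding norm2_def[of "\<lambda>x. f x + g x"]
    using norm2_nonneg[OF f] norm2_nonneg[OF g] by (simp add: real_le_lsqrt)
qed

lemma norm2_right: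
  assumes "unif_cont f" "a \<in> carrier G" shows "norm2 (\<lambda>x. f (x \<otimes> a)) = norm2 f"
  using mean_right[OF unif_cont_mult[OF assms(1,1)] assms(2)] by (simp add: norm2_def ip_def)

section \<open>Uniform limits, compactness and eigenvectors\<close>

lemma unif_cont_uniform_limit:
  assumes "\<And>e. 0 < e \<Longrightarrow> \<exists>g. unif_cont g \<and> (\<forall>x\<in>carrier G. \<bar>h x - g x\<bar> \<le> e)"
  shows "unif_cont h"
  unfolding unif_cont_def
proof (intro allI impI)
  fix e :: real assume e: "0 < e"
  then obtain g where g: "unif_cont g" "\<And>x. x \<in> carrier G \<Longrightarrow> \<bar>h x - g x\<bar> \<le> e / 4"
    using assms[of "e / 4"] by auto
  obtain V where V: "nbhd_one V" "\<And>x y. close V x y \<Longrightarrow> \<bar>g x - g y\<bar> < e / 4"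
    using unif_contD[OF g(1), of "e / 4"] e by auto
  have "\<bar>h x - h y\<bar> < e" if "close V x y" for x y
    using V(2)[OF that] g(2)[of x] g(2)[of y] that e unfolding close_def by linarith
  then show "\<exists>V. nbhd_one V \<and> (\<forall>x y. close V x y \<longrightarrow> \<bar>h x - h y\<bar> < e)" using V(1) by blast
qed

text \<open>Arzela-Ascoli with a cluster point as the limit, so that no diagonal subsequence, and hence no
  separability of the group, is needed.\<close>

lemma equicontinuous_cluster:
  fixes g :: "nat \<Rightarrow> 'a \<Rightarrow> real"
  assumes bound: "\<And>k x. x \<in> carrier G \<Longrightarrow> \<bar>g k x\<bar> \<le> D"
    and equi: "\<And>e. 0 < e \<Longrightarrow> \<exists>V. nbhd_one V \<and> (\<forall>k x y. close V x y \<longrightarrow> \<bar>g k x - g k y\<bar> \<le> e)"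
  obtains h where "\<And>e N. 0 < e \<Longrightarrow> \<exists>k\<ge>N. \<forall>x\<in>carrier G. \<bar>g k x - h x\<bar> \<le> e"
proof -
  define u where "u = (\<lambda>k x. if x \<in> carrier G then g k x else 0)"
  have "\<bar>u k x\<bar> \<le> \<bar>D\<bar>" for k x using bound[of x k] by (auto simp: u_def)
  then obtain h where "\<And>x. \<bar>h x\<bar> \<le> \<bar>D\<bar>"
    and h: "\<And>I e N. finite I \<Longrightarrow> 0 < e \<Longrightarrow> \<exists>k\<ge>N. \<forall>x\<in>I. \<bar>u k x - h x\<bar> < e"
    by (rule bounded_functions_cluster[of u "\<lambda>_. \<bar>D\<bar>"]) (rule that)
  have h': "\<exists>k\<ge>N. \<forall>x\<in>I. \<bar>g k x - h x\<bar> < e" if I: "finite I" "I \<subseteq> carrier G" and e: "0 < e" for I e and N :: nat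
  proof -
    obtain k where k: "k \<ge> N" "\<forall>x\<in>I. \<bar>u k x - h x\<bar> < e" using h[OF I(1) e] by blast
    have "\<bar>g k x - h x\<bar> < e" if "x \<in> I" for x
      using bspec[OF k(2) that] I(2) that by (auto simp: u_def)
    then show ?thesis using k(1) by blast
  qed
  show thesis
  proof
    fix e :: real and N :: nat assume e: "0 < e"
    obtain V where V: "nbhd_one V" "\<And>k x y. close V x y \<Longrightarrow> \<bar>g k x - g k y\<bar> \<le> e / 4"
      using equi[of "e / 4"] e by auto
    obtain P where P: "finite P" "P \<subseteq> carrier G" "\<And>x. x \<in> carrier G \<Longrightarrow> \<exists>p\<in>P. close V x p"
      using finite_net[OF V(1)] by metis
    have hV: "\<bar>h x - h y\<bar> \<le> e / 2" if c: "close V x y" for x y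
    proof -
      have "{x, y} \<subseteq> carrier G" using c by (auto simp: close_def)
      then obtain k where "\<forall>z\<in>{x, y}. \<bar>g k z - h z\<bar> < e / 8"
        using h'[of "{x, y}" "e / 8" 0] e by auto
      then have "\<bar>g k x - h x\<bar> < e / 8" "\<bar>g k y - h y\<bar> < e / 8" by blast+
      then show ?thesis using V(2)[OF c, of k] by linarith
    qed
    obtain k where k: "k \<ge> N" "\<forall>x\<in>P. \<bar>g k x - h x\<bar> < e / 4"
      using h'[OF P(1,2), of "e / 4" N] e by auto
    have "\<bar>g k x - h x\<bar> \<le> e" if x: "x \<in> carrier G" for x
    proof -
      obtain p where p: "p \<in> P" "close V x p" using P(3)[OF x] by blast
      show ?thesis using V(2)[OF p(2), of k] hV[OF p(2)] bspec[OF k(2) p(1)] by linarith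
    qed
    then show "\<exists>k\<ge>N. \<forall>x\<in>carrier G. \<bar>g k x - h x\<bar> \<le> e" using k(1) by blast
  qed
qed

text \<open>A maximising sequence for the norm of \<open>A\<close> is asymptotically an eigenvector of
  \<open>B A = A\<^sup>* A\<close>.\<close>

lemma eigenfunction_exists:
  assumes S: "\<And>f. f \<in> S \<Longrightarrow> unif_cont f"
    and S_lin: "\<And>f g a b. f \<in> S \<Longrightarrow> g \<in> S \<Longrightarrow> (\<lambda>x. a * f x + b * g x) \<in> S"
    and S_lim: "\<And>h. (\<And>e. 0 < e \<Longrightarrow> \<exists>g\<in>S. \<forall>x\<in>carrier G. \<bar>h x - g x\<bar> \<le> e) \<Longrightarrow> h \<in> S"
    and AS: "\<And>f. f \<in> S \<Longrightarrow> A f \<in> S" and BS: "\<And>f. f \<in> S \<Longrightarrow> B f \<in> S"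
    and A_lin: "\<And>f g a b. f \<in> S \<Longrightarrow> g \<in> S \<Longrightarrow> A (\<lambda>x. a * f x + b * g x) = (\<lambda>x. a * A f x + b * A g x)"
    and B_lin: "\<And>f g a b. f \<in> S \<Longrightarrow> g \<in> S \<Longrightarrow> B (\<lambda>x. a * f x + b * g x) = (\<lambda>x. a * B f x + b * B g x)"
    and adj: "\<And>f g. f \<in> S \<Longrightarrow> g \<in> S \<Longrightarrow> ip (A f) g = ip f (B g)"
    and bdd: "\<And>f. f \<in> S \<Longrightarrow> norm2 (A f) \<le> C * norm2 f"
    and nz: "f0 \<in> S" "0 < norm2 (A f0)"
    and bound: "\<And>f x. f \<in> S \<Longrightarrow> norm2 f \<le> 1 \<Longrightarrow> x \<in> carrier G \<Longrightarrow> \<bar>B (A f) x\<bar> \<le> D"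
    and equi: "\<And>e. 0 < e \<Longrightarrow> \<exists>V. nbhd_one V \<and>
      (\<forall>f\<in>S. norm2 f \<le> 1 \<longrightarrow> (\<forall>x y. close V x y \<longrightarrow> \<bar>B (A f) x - B (A f) y\<bar> \<le> e))"
  obtains h \<mu> where "h \<in> S" "0 < \<mu>" "\<exists>x\<in>carrier G. h x \<noteq> 0"
    "\<And>x. x \<in> carrier G \<Longrightarrow> B (A h) x = \<mu> * h x"
proof -
  note [simp] = S AS BS norm2_nonneg
  let ?N = "{norm2 (A f) | f. f \<in> S \<and> norm2 f \<le> 1}"
  define L where "L = Sup ?N"
  have scale: "(\<lambda>x. a * f x) \<in> S" if "f \<in> S" for a f
    using S_lin[OF that that, of a 0] by simp
  have A_scale: "A (\<lambda>x. a * f x) = (\<lambda>x. a * A f x)" if "f \<in> S" for a f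
    using A_lin[OF that that, of a 0] by simp
  have "0 \<le> C"
  proof (rule ccontr)
    assume "\<not> 0 \<le> C"
    then have "C * norm2 f0 \<le> 0" using nz by (simp add: mult_nonpos_nonneg)
    then show False using bdd[OF nz(1)] nz(2) by linarith
  qed
  then have ub: "l \<le> C" if "l \<in> ?N" for l
    using that bdd by (fastforce intro: order_trans mult_left_le)
  then have bdd_N: "bdd_above ?N" by (rule bdd_aboveI)
  have L_unit: "norm2 (A f) \<le> L" if "f \<in> S" "norm2 f \<le> 1" for f
    unfolding L_def by (rule cSup_upper[OF _ bdd_N]) (use that in blast)
  have L: "norm2 (A f) \<le> L * norm2 f" if f: "f \<in> S" for f
  proof (cases "norm2 f = 0")
    case True
    then show ?thesis using bdd[OF f] by simp
  next
    case False
    then have p: "0 < norm2 f" using f by (simp add: order_less_le)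
    have "norm2 (\<lambda>x. (1 / norm2 f) * f x) = 1"
      using p by (subst norm2_scale) (simp_all add: f)
    then have "norm2 (A (\<lambda>x. (1 / norm2 f) * f x)) \<le> L"
      using f by (intro L_unit scale) simp_all
    then have "norm2 (A f) / norm2 f \<le> L"
      by (subst (asm) A_scale[OF f], subst (asm) norm2_scale) (use f p in simp_all)
    then show ?thesis using p by (simp add: pos_divide_le_eq)
  qed
  have L_pos: "0 < L"
  proof (rule ccontr)
    assume "\<not> 0 < L"
    then have "L * norm2 f0 \<le> 0" using nz(1) by (simp add: mult_nonpos_nonneg)
    then show False using L[OF nz(1)] nz(2) by linarith
  qed
  have L_B: "norm2 (B g) \<le> L * norm2 g" if g: "g \<in> S" for g
  proof (cases "norm2 (B g) = 0")
    case True
    then show ?thesis using g L_pos by simp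
  next
    case False
    have "norm2 (B g) * norm2 (B g) = ip (A (B g)) g"
      using g norm2_power2[of "B g"] adj[of "B g" g] by (simp add: power2_eq_square)
    also have "\<dots> \<le> norm2 (A (B g)) * norm2 g"
      using Cauchy_Schwarz_ip[of "A (B g)" g] g by simp
    also have "\<dots> \<le> L * norm2 (B g) * norm2 g"
      using L[of "B g"] g by (intro mult_right_mono) auto
    finally have "norm2 (B g) * norm2 (B g) \<le> norm2 (B g) * (L * norm2 g)" by (simp add: mult_ac)
    moreover have "0 < norm2 (B g)" using False g by (simp add: order_less_le)
    ultimately show ?thesis by (simp add: mult_le_cancel_left)
  qed
  have "\<exists>f\<in>S. norm2 f \<le> 1 \<and> L\<^sup>2 - 1 / real (Suc k) \<le> (norm2 (A f))\<^sup>2" for k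
  proof -
    have "sqrt (max 0 (L\<^sup>2 - 1 / real (Suc k))) < L"
      using L_pos by (intro real_less_lsqrt) (auto simp: max_def)
    moreover have "?N \<noteq> {}" using scale[OF nz(1), of 0] by (force simp: norm2_def ip_def)
    ultimately obtain l where "l \<in> ?N" "sqrt (max 0 (L\<^sup>2 - 1 / real (Suc k))) < l"
      using less_cSupD[of ?N "sqrt (max 0 (L\<^sup>2 - 1 / real (Suc k)))"] by (auto simp only: L_def[symmetric])
    then obtain f where f: "f \<in> S" "norm2 f \<le> 1" "sqrt (max 0 (L\<^sup>2 - 1 / real (Suc k))) < norm2 (A f)"
      by blast
    have "max 0 (L\<^sup>2 - 1 / real (Suc k)) = (sqrt (max 0 (L\<^sup>2 - 1 / real (Suc k))))\<^sup>2"
      by (rule real_sqrt_pow2[symmetric]) simp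
    also have "\<dots> \<le> (norm2 (A f))\<^sup>2"
      by (rule power_mono[OF less_imp_le[OF f(3)]]) simp
    finally have "max 0 (L\<^sup>2 - 1 / real (Suc k)) \<le> (norm2 (A f))\<^sup>2" .
    then show ?thesis using f by auto
  qed
  then obtain f where f: "\<And>k. f k \<in> S" "\<And>k. norm2 (f k) \<le> 1"
    "\<And>k. L\<^sup>2 - 1 / real (Suc k) \<le> (norm2 (A (f k)))\<^sup>2" by metis
  define g where "g = (\<lambda>k. B (A (f k)))"
  have gS: "g k \<in> S" for k by (simp add: g_def f)
  define \<mu> where "\<mu> = L\<^sup>2"
  have \<mu>: "0 < \<mu>" using L_pos by (simp add: \<mu>_def)
  \<comment> \<open>Expanding the square and bounding \<open>B\<close> by \<open>L\<close> leaves at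
    most \<open>\<mu> * (\<mu> - (norm2 (A (f k)))^2)\<close>, which is small because
    \<open>f k\<close> almost attains the norm.\<close>
  have asymp: "(norm2 (\<lambda>x. 1 * g k x + (- \<mu>) * f k x))\<^sup>2 \<le> \<mu> / real (Suc k)" for k
  proof -
    let ?w = "\<lambda>x. 1 * g k x + (- \<mu>) * f k x"
    have w: "?w \<in> S" using gS f(1) by (rule S_lin)
    have gf: "ip (g k) (f k) = (norm2 (A (f k)))\<^sup>2"
      using adj[of "f k" "A (f k)"] f(1) by (simp add: g_def norm2_power2 ip_commute)
    have "(norm2 ?w)\<^sup>2 = ip ?w ?w" using w by (simp only: S norm2_power2)
    also have "\<dots> = ip (g k) (g k) - 2 * \<mu> * ip (g k) (f k) + \<mu>\<^sup>2 * ip (f k) (f k)"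
      unfolding ip_linear[OF S[OF gS] S[OF f(1)] S[OF w]] ip_commute[of _ ?w]
        ip_linear[OF S[OF gS] S[OF f(1)] S[OF gS]] ip_linear[OF S[OF gS] S[OF f(1)] S[OF f(1)]]
      by (simp add: ip_commute[of "f k" "g k"] algebra_simps power2_eq_square)
    also have "\<dots> = (norm2 (g k))\<^sup>2 - 2 * \<mu> * (norm2 (A (f k)))\<^sup>2 + \<mu>\<^sup>2 * (norm2 (f k))\<^sup>2"
      using gf gS f(1) by (simp add: norm2_power2)
    also have "\<dots> \<le> \<mu> * (norm2 (A (f k)))\<^sup>2 - 2 * \<mu> * (norm2 (A (f k)))\<^sup>2 + \<mu>\<^sup>2 * 1"
    proof -
      have "(norm2 (g k))\<^sup>2 \<le> (L * norm2 (A (f k)))\<^sup>2"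
        using L_B[of "A (f k)"] f(1) gS by (intro power_mono) (auto simp: g_def)
      then have "(norm2 (g k))\<^sup>2 \<le> \<mu> * (norm2 (A (f k)))\<^sup>2" by (simp only: \<mu>_def power_mult_distrib)
      moreover have "\<mu>\<^sup>2 * (norm2 (f k))\<^sup>2 \<le> \<mu>\<^sup>2 * 1"
        using f(1,2) by (intro mult_left_mono) (auto simp: power_le_one)
      ultimately show ?thesis by linarith
    qed
    also have "\<dots> = \<mu> * (\<mu> - (norm2 (A (f k)))\<^sup>2)" by (simp add: algebra_simps power2_eq_square)
    also have "\<dots> \<le> \<mu> * (1 / real (Suc k))"
      using f(3)[of k] \<mu> by (intro mult_left_mono) (auto simp: \<mu>_def)
    finally show ?thesis by simp
  qed
  have gb: "\<bar>g k x\<bar> \<le> D" if "x \<in> carrier G" for k x unfolding g_def by (rule bound) (use f that in auto)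
  have ge: "\<exists>V. nbhd_one V \<and> (\<forall>k x y. close V x y \<longrightarrow> \<bar>g k x - g k y\<bar> \<le> e)" if "0 < e" for e
    using equi[OF that] f(1,2) unfolding g_def by meson
  \<comment> \<open>The cluster point is taken for the images \<open>g k\<close>, not for the
    maximising \<open>f k\<close>, since only the images are equicontinuous. Approximation is
    uniform, so \<open>h\<close> stays in \<open>S\<close> without a completion.\<close>
  obtain h where h: "\<And>e N. 0 < e \<Longrightarrow> \<exists>k\<ge>N. \<forall>x\<in>carrier G. \<bar>g k x - h x\<bar> \<le> e"
    using equicontinuous_cluster[OF gb ge] by blast
  have hS: "h \<in> S"
  proof (rule S_lim)
    fix e :: real assume "0 < e"
    then obtain k where "\<forall>x\<in>carrier G. \<bar>g k x - h x\<bar> \<le> e" using h by blast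
    then show "\<exists>g\<in>S. \<forall>x\<in>carrier G. \<bar>h x - g x\<bar> \<le> e"
      using gS by (intro bexI[of _ "g k"]) (auto simp: abs_minus_commute)
  qed
  have approx: "\<exists>k\<ge>N. (\<forall>x\<in>carrier G. \<bar>g k x - h x\<bar> \<le> e) \<and> norm2 (\<lambda>x. 1 * g k x + (- \<mu>) * f k x) \<le> e"
    if e: "0 < e" for e and N :: nat
  proof -
    obtain M where M: "\<mu> / e\<^sup>2 < real M" using reals_Archimedean2 by blast
    obtain k where k: "k \<ge> max M N" "\<forall>x\<in>carrier G. \<bar>g k x - h x\<bar> \<le> e" using h[OF e] by blast
    have "\<mu> / e\<^sup>2 < real (Suc k)" using M k(1) by linarith
    then have "\<mu> < e\<^sup>2 * real (Suc k)" using e by (subst (asm) pos_divide_less_eq) (auto simp: mult.commute)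
    then have "\<mu> / real (Suc k) \<le> e\<^sup>2" by (simp add: pos_divide_le_eq)
    then have "(norm2 (\<lambda>x. 1 * g k x + (- \<mu>) * f k x))\<^sup>2 \<le> e\<^sup>2" using asymp[of k] by linarith
    then have "norm2 (\<lambda>x. 1 * g k x + (- \<mu>) * f k x) \<le> e" by (rule power2_le_imp_le) (use e in simp)
    then show ?thesis using k by auto
  qed
  have small: "norm2 (\<lambda>x. 1 * h x + (- 1) * g k x) \<le> e" if "\<forall>x\<in>carrier G. \<bar>g k x - h x\<bar> \<le> e" for e k
    by (rule norm2_le_sup) (use that S[OF S_lin[OF hS gS, of 1 "-1"]] in \<open>auto simp: abs_minus_commute\<close>)
  let ?r = "\<lambda>x. 1 * B (A h) x + (- \<mu>) * h x"
  have rS: "?r \<in> S" using hS by (intro S_lin) simp_all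
  have "norm2 ?r \<le> 0 + e'" if e': "0 < e'" for e'
  proof -
    \<comment> \<open>With \<open>u = h - g k\<close> and \<open>w = g k - \<mu> f k\<close> the
      residual equals \<open>B A u + B A w - \<mu> u\<close>; each of the three terms has norm at
      most \<open>\<mu> * e\<close>.\<close>
    define e where "e = e' / (3 * \<mu>)"
    have e: "0 < e" using e' \<mu> by (simp add: e_def)
    obtain k where k: "\<forall>x\<in>carrier G. \<bar>g k x - h x\<bar> \<le> e" "norm2 (\<lambda>x. 1 * g k x + (- \<mu>) * f k x) \<le> e"
      using approx[OF e] by blast
    let ?u = "\<lambda>x. 1 * h x + (- 1) * g k x" and ?w = "\<lambda>x. 1 * g k x + (- \<mu>) * f k x"
    have uS: "?u \<in> S" by (rule S_lin[OF hS gS])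
    have wS: "?w \<in> S" by (rule S_lin[OF gS f(1)])
    have BA: "norm2 (B (A v)) \<le> \<mu> * norm2 v" if "v \<in> S" for v
    proof -
      have "norm2 (B (A v)) \<le> L * norm2 (A v)" using that by (intro L_B) simp
      also have "\<dots> \<le> L * (L * norm2 v)" using that L_pos by (intro mult_left_mono L) auto
      finally show ?thesis by (simp add: \<mu>_def power2_eq_square mult.assoc)
    qed
    have BAu: "B (A ?u) = (\<lambda>x. 1 * B (A h) x + (- 1) * B (A (g k)) x)"
      using hS gS by (simp only: A_lin B_lin AS)
    have BAw: "B (A ?w) = (\<lambda>x. 1 * B (A (g k)) x + (- \<mu>) * B (A (f k)) x)"
      using f(1) gS by (simp only: A_lin B_lin AS)
    have gk: "B (A (f k)) = g k" by (simp add: g_def)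
    have "1 * B (A h) x + (- \<mu>) * h x = B (A ?u) x + (B (A ?w) x + (- \<mu>) * ?u x)" for x
      unfolding fun_cong[OF BAu, of x] fun_cong[OF BAw, of x] gk by (simp add: algebra_simps)
    then have "?r = (\<lambda>x. B (A ?u) x + (B (A ?w) x + (- \<mu>) * ?u x))" by (rule ext)
    moreover have cu: "unif_cont (B (A ?u))" by (rule S[OF BS[OF AS[OF uS]]])
    moreover have cw: "unif_cont (B (A ?w))" by (rule S[OF BS[OF AS[OF wS]]])
    moreover have c: "unif_cont (\<lambda>x. (- \<mu>) * ?u x)" by (rule unif_cont_mult[OF unif_cont_const S[OF uS]])
    ultimately have "norm2 ?r \<le> norm2 (B (A ?u)) + norm2 (\<lambda>x. B (A ?w) x + (- \<mu>) * ?u x)"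
      using norm2_triangle[OF cu unif_cont_add[OF cw c]] by (simp only:)
    also have "norm2 (\<lambda>x. B (A ?w) x + (- \<mu>) * ?u x) \<le> norm2 (B (A ?w)) + norm2 (\<lambda>x. (- \<mu>) * ?u x)"
      by (rule norm2_triangle[OF cw c])
    also have "norm2 (\<lambda>x. (- \<mu>) * ?u x) = \<mu> * norm2 ?u"
      using norm2_scale[OF S[OF uS], of "- \<mu>"] \<mu> by simp
    also have "norm2 (B (A ?u)) + (norm2 (B (A ?w)) + \<mu> * norm2 ?u) \<le> \<mu> * e + (\<mu> * e + \<mu> * e)"
      using BA[OF uS] BA[OF wS] small[OF k(1)] k(2) \<mu>
      by (intro add_mono order_trans[OF BA[OF uS]] order_trans[OF BA[OF wS]] mult_left_mono) auto
    also have "\<dots> = e'" using \<mu> by (simp add: e_def)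
    finally show ?thesis by simp
  qed
  then have "norm2 ?r \<le> 0" by (rule field_le_epsilon)
  then have r0: "?r x = 0" if "x \<in> carrier G" for x
    using norm2_pos[OF S[OF rS] that] by force
  have "\<exists>x\<in>carrier G. h x \<noteq> 0"
  proof (rule ccontr)
    assume "\<not> (\<exists>x\<in>carrier G. h x \<noteq> 0)"
    \<comment> \<open>If \<open>h\<close> were 0, then \<open>g k\<close> would be bounded by
      \<open>\<mu> / 4\<close> for some late \<open>k\<close>, whereas \<open>ip (g k) (f k)\<close>
      is the square of \<open>norm2 (A (f k))\<close> and at least \<open>3 / 4\<close> of
      \<open>\<mu>\<close> there.\<close>
    obtain M where M: "4 / \<mu> < real M" using reals_Archimedean2 by blast
    obtain k where k: "k \<ge> M" "\<forall>x\<in>carrier G. \<bar>g k x - h x\<bar> \<le> \<mu> / 4"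
      using h[of "\<mu> / 4" M] \<mu> by auto
    then have "norm2 (g k) \<le> \<mu> / 4"
      using \<open>\<not> (\<exists>x\<in>carrier G. h x \<noteq> 0)\<close> by (intro norm2_le_sup) (auto simp: gS)
    have "4 / \<mu> < real (Suc k)" using M k(1) by linarith
    then have "4 < real (Suc k) * \<mu>" using \<mu> by (simp only: pos_divide_less_eq)
    then have "1 / real (Suc k) \<le> \<mu> / 4" by (simp add: field_simps)
    then have "\<mu> - \<mu> / 4 \<le> (norm2 (A (f k)))\<^sup>2" using f(3)[of k] by (simp add: \<mu>_def)
    also have "\<dots> = ip (g k) (f k)"
      using adj[of "f k" "A (f k)"] f(1) by (simp add: g_def norm2_power2 ip_commute)
    also have "\<dots> \<le> norm2 (g k) * norm2 (f k)"
      using Cauchy_Schwarz_ip[OF S[OF gS] S[OF f(1)]] by (meson abs_le_D1)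
    also have "\<dots> \<le> norm2 (g k)" using f(2)[of k] gS by (intro mult_left_le) auto
    also have "\<dots> \<le> \<mu> / 4" by fact
    finally show False using \<mu> by simp
  qed
  moreover have "B (A h) x = \<mu> * h x" if "x \<in> carrier G" for x
    using r0[OF that] by simp
  ultimately show thesis using that hS \<mu> by blast
qed

lemma unif_cont_attains_sup:
  assumes "unif_cont f" obtains x where "x \<in> carrier G" "\<And>y. y \<in> carrier G \<Longrightarrow> f y \<le> f x"
proof -
  have "compactin euclideanreal (f ` topspace T)"
    using assms compact_T unfolding unif_cont_iff compact_space_def by (rule image_compactin[rotated])
  then have "compact (f ` carrier G)" by (simp add: topspace_eq_carrier)
  moreover have "f ` carrier G \<noteq> {}" by auto
  ultimately show thesis using compact_attains_sup[of "f ` carrier G"] that by auto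
qed

lemma unif_cont_linear: "unif_cont f \<Longrightarrow> unif_cont g \<Longrightarrow> unif_cont (\<lambda>x. a * f x + b * g x)"
  by (intro unif_cont_add unif_cont_mult unif_cont_const)

section \<open>Convolution operators\<close>

lemma close_inv:
  assumes "nbhd_one V" "close V x y" shows "close V (inv x) (inv y)"
proof -
  have yx: "y \<otimes> inv x \<in> V" and c: "x \<in> carrier G" "y \<in> carrier G"
    using close_sym[OF assms] by (auto simp: close_def)
  have "inv x \<otimes> (y \<otimes> inv x) \<otimes> inv (inv x) = inv x \<otimes> inv (inv y)"
    using c by (simp add: m_assoc)
  moreover have "inv x \<otimes> (y \<otimes> inv x) \<otimes> inv (inv x) \<in> V"
    using assms(1) yx c(1) unfolding nbhd_one_def by blast
  ultimately show ?thesis using c by (simp add: close_def)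
qed

text \<open>Convolution with \<open>\<psi>\<close>. The kernel depends on
  \<open>y \<otimes> inv x\<close> alone and the mean is right-invariant, so the operator commutes
  with right translations and its eigenspaces are right-invariant.\<close>

definition kernel_op :: "('a \<Rightarrow> real) \<Rightarrow> ('a \<Rightarrow> real) \<Rightarrow> 'a \<Rightarrow> real" where
  "kernel_op \<psi> f x = mean (\<lambda>y. \<psi> (y \<otimes> inv x) * f y)"

context
  fixes \<psi> assumes \<psi>: "unif_cont \<psi>" and sym: "\<forall>x\<in>carrier G. \<psi> (inv x) = \<psi> x"
begin

lemma kernel_continuous:
  assumes "unif_cont f" "unif_cont g"
  shows "continuous_map (prod_topology T T) euclideanreal (\<lambda>(x, y). \<psi> (y \<otimes> inv x) * f y * g x)"
proof -
  have f: "continuous_map (prod_topology T T) T fst" and s: "continuous_map (prod_topology T T) T snd"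
    by (rule continuous_map_fst continuous_map_snd)+
  have "continuous_map (prod_topology T T) T (\<lambda>p. snd p \<otimes> inv (fst p))"
    by (intro continuous_map_mult continuous_map_inv f s)
  then have "continuous_map (prod_topology T T) euclideanreal (\<lambda>p. \<psi> (snd p \<otimes> inv (fst p)))"
    using continuous_map_compose[of _ T _ euclideanreal \<psi>] \<psi> by (force simp: unif_cont_iff o_def)
  moreover have "continuous_map (prod_topology T T) euclideanreal (\<lambda>p. f (snd p))"
    using continuous_map_compose[OF s, of euclideanreal f] assms by (simp add: unif_cont_iff o_def)
  moreover have "continuous_map (prod_topology T T) euclideanreal (\<lambda>p. g (fst p))"
    using continuous_map_compose[OF f, of euclideanreal g] assms by (simp add: unif_cont_iff o_def)
  ultimately show ?thesis by (simp add: case_prod_unfold continuous_map_real_mult)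
qed

lemma kernel_section: "x \<in> carrier G \<Longrightarrow> unif_cont (\<lambda>y. \<psi> (y \<otimes> inv x))"
  using unif_cont_right[OF \<psi>] by simp

lemma kernel_op_unif_cont: "unif_cont f \<Longrightarrow> unif_cont (kernel_op \<psi> f)"
  using mean_mean_swap(1)[OF kernel_continuous[OF _ unif_cont_const[of 1]]]
  by (simp add: kernel_op_def[abs_def])

lemma kernel_op_linear:
  assumes "unif_cont f" "unif_cont g" "x \<in> carrier G"
  shows "kernel_op \<psi> (\<lambda>x. a * f x + b * g x) x = a * kernel_op \<psi> f x + b * kernel_op \<psi> g x"
  using mean_linear[OF unif_cont_mult[OF kernel_section assms(1)] unif_cont_mult[OF kernel_section assms(2)], of x x a b]
    assms(3) by (simp add: kernel_op_def algebra_simps)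

lemma kernel_op_adjoint:
  assumes "unif_cont f" "unif_cont g"
  shows "ip (kernel_op \<psi> f) g = ip f (kernel_op \<psi> g)"
proof -
  have cont: "continuous_map (prod_topology T T) euclideanreal (\<lambda>(x, y). \<psi> (y \<otimes> inv x) * f y * g x)"
    by (rule kernel_continuous[OF assms])
  have x: "mean (\<lambda>y. \<psi> (y \<otimes> inv x) * f y * g x) = kernel_op \<psi> f x * g x" if "x \<in> carrier G" for x
    using mean_scale[OF unif_cont_mult[OF kernel_section[OF that] assms(1)], of "g x"]
    by (simp add: kernel_op_def mult_ac)
  have y: "mean (\<lambda>x. \<psi> (y \<otimes> inv x) * f y * g x) = f y * kernel_op \<psi> g y" if y: "y \<in> carrier G" for y
  proof -
    have u: "unif_cont (\<lambda>x. \<psi> (x \<otimes> inv y) * g x)"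
      by (intro unif_cont_mult kernel_section[OF y] assms(2))
    have eq: "\<psi> (y \<otimes> inv x) = \<psi> (x \<otimes> inv y)" if "x \<in> carrier G" for x
      using bspec[OF sym, of "x \<otimes> inv y"] that y by (simp add: inv_mult_group)
    have "unif_cont (\<lambda>x. \<psi> (y \<otimes> inv x))"
    proof -
      have "continuous_map T (prod_topology T T) (\<lambda>x. (x, y))"
        using y by (intro continuous_map_pairedI) (auto simp: topspace_eq_carrier)
      from continuous_map_compose[OF this kernel_continuous[OF unif_cont_const[of 1] unif_cont_const[of 1]]]
      show ?thesis by (simp add: unif_cont_iff o_def)
    qed
    then have "unif_cont (\<lambda>x. \<psi> (y \<otimes> inv x) * f y * g x)"
      by (rule unif_cont_mult[OF unif_cont_mult[OF _ unif_cont_const] assms(2)])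
    then have "mean (\<lambda>x. \<psi> (y \<otimes> inv x) * f y * g x) = mean (\<lambda>x. f y * (\<psi> (x \<otimes> inv y) * g x))"
      by (rule mean_cong[OF _ unif_cont_mult[OF unif_cont_const u]]) (simp add: eq)
    then show ?thesis using mean_scale[OF u, of "f y"] by (simp add: kernel_op_def)
  qed
  have ux: "unif_cont (\<lambda>x. mean (\<lambda>y. \<psi> (y \<otimes> inv x) * f y * g x))"
    using mean_mean_swap(1)[OF cont] .
  have uy: "unif_cont (\<lambda>y. mean (\<lambda>x. \<psi> (y \<otimes> inv x) * f y * g x))"
  proof (rule mean_mean_swap(1))
    show "continuous_map (prod_topology T T) euclideanreal (\<lambda>(y, x). \<psi> (y \<otimes> inv x) * f y * g x)"
      using continuous_map_compose[OF _ cont, of "prod_topology T T" "\<lambda>(y, x). (x, y)"]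
      by (simp add: o_def case_prod_unfold continuous_map_pairedI continuous_map_fst continuous_map_snd)
  qed
  have "ip (kernel_op \<psi> f) g = mean (\<lambda>x. mean (\<lambda>y. \<psi> (y \<otimes> inv x) * f y * g x))"
    unfolding ip_def
    by (rule mean_cong) (use x ux kernel_op_unif_cont assms unif_cont_mult in auto)
  also have "\<dots> = mean (\<lambda>y. mean (\<lambda>x. \<psi> (y \<otimes> inv x) * f y * g x))"
    by (rule mean_mean_swap(2)[OF cont])
  also have "\<dots> = ip f (kernel_op \<psi> g)"
    unfolding ip_def
    by (rule mean_cong) (use y uy kernel_op_unif_cont assms unif_cont_mult in auto)
  finally show ?thesis .
qed

lemma kernel_op_bound:
  obtains C where "0 < C" "\<And>f x. unif_cont f \<Longrightarrow> x \<in> carrier G \<Longrightarrow> \<bar>kernel_op \<psi> f x\<bar> \<le> C * norm2 f"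
proof -
  obtain B where B: "\<And>x. x \<in> carrier G \<Longrightarrow> \<bar>\<psi> x\<bar> \<le> B" using unif_cont_bounded[OF \<psi>] by metis
  have B0: "0 \<le> B" using B[OF one_closed] by linarith
  show thesis
  proof
    show "0 < B + 1" using B0 by simp
    fix f x assume f: "unif_cont f" and x: "x \<in> carrier G"
    have "\<bar>kernel_op \<psi> f x\<bar> \<le> norm2 (\<lambda>y. \<psi> (y \<otimes> inv x)) * norm2 f"
      using Cauchy_Schwarz_ip[OF kernel_section[OF x] f] by (simp add: kernel_op_def ip_def)
    also have "\<dots> \<le> (B + 1) * norm2 f"
      using x B by (intro mult_right_mono norm2_nonneg f norm2_le_sup kernel_section) (auto intro!: add_increasing2)
    finally show "\<bar>kernel_op \<psi> f x\<bar> \<le> (B + 1) * norm2 f" .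
  qed
qed

text \<open>Cauchy-Schwarz hands the modulus of continuity of \<open>\<psi>\<close> to the image,
  with \<open>f\<close> entering through \<open>norm2 f\<close> alone. Images of the unit ball are
  thus equicontinuous, which is the compactness of the operator.\<close>

lemma kernel_op_equicontinuous:
  assumes "0 < e"
  obtains V where "nbhd_one V"
    "\<And>f x x'. unif_cont f \<Longrightarrow> close V x x' \<Longrightarrow> \<bar>kernel_op \<psi> f x - kernel_op \<psi> f x'\<bar> \<le> e * norm2 f"
proof -
  obtain V where V: "nbhd_one V" "\<And>x y. close V x y \<Longrightarrow> \<bar>\<psi> x - \<psi> y\<bar> < e"
    using unif_contD[OF \<psi> assms] by metis
  show thesis
  proof
    show "nbhd_one V" by fact
    fix f x x' assume f: "unif_cont f" and c: "close V x x'"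
    then have x: "x \<in> carrier G" "x' \<in> carrier G" by (auto simp: close_def)
    let ?d = "\<lambda>y. \<psi> (y \<otimes> inv x) - \<psi> (y \<otimes> inv x')"
    have u: "unif_cont ?d" by (intro unif_cont_diff kernel_section x)
    have "\<bar>?d y\<bar> \<le> e" if "y \<in> carrier G" for y
      using V(2)[OF close_mult_left[OF V(1) close_inv[OF V(1) c] that]] by simp
    then have "norm2 ?d \<le> e" by (rule norm2_le_sup[OF u])
    have "kernel_op \<psi> f x - kernel_op \<psi> f x' = ip ?d f"
      using mean_diff[OF unif_cont_mult[OF kernel_section[OF x(1)] f] unif_cont_mult[OF kernel_section[OF x(2)] f]]
      by (simp add: kernel_op_def ip_def algebra_simps)
    also have "\<bar>\<dots>\<bar> \<le> norm2 ?d * norm2 f" by (rule Cauchy_Schwarz_ip[OF u f])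
    also have "\<dots> \<le> e * norm2 f" using \<open>norm2 ?d \<le> e\<close> by (intro mult_right_mono norm2_nonneg f)
    finally show "\<bar>kernel_op \<psi> f x - kernel_op \<psi> f x'\<bar> \<le> e * norm2 f" .
  qed
qed

lemma kernel_op_right:
  assumes f: "unif_cont f" and a: "a \<in> carrier G" and x: "x \<in> carrier G"
  shows "kernel_op \<psi> (\<lambda>x. f (x \<otimes> a)) x = kernel_op \<psi> f (x \<otimes> a)"
proof -
  let ?k = "\<lambda>y. \<psi> (y \<otimes> inv (x \<otimes> a)) * f y"
  have k: "unif_cont ?k" using a x by (intro unif_cont_mult kernel_section f) auto
  have "y \<otimes> a \<otimes> inv (x \<otimes> a) = y \<otimes> inv x" if "y \<in> carrier G" for y
    using a x that by (simp add: inv_mult_group m_assoc) (metis inv_closed l_one m_assoc r_inv)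
  then have "mean (\<lambda>y. \<psi> (y \<otimes> inv x) * f (y \<otimes> a)) = mean (\<lambda>y. ?k (y \<otimes> a))"
    using a x by (intro mean_cong unif_cont_mult kernel_section unif_cont_right[OF f a] unif_cont_right[OF k a]) auto
  then show ?thesis using mean_right[OF k a] by (simp add: kernel_op_def)
qed

end

text \<open>A closed right-invariant space of functions with the compactness of a finite-dimensional one.
  Its finite dimension, which would follow, is never needed.\<close>

definition compact_invariant :: "('a \<Rightarrow> real) set \<Rightarrow> real \<Rightarrow> bool" where
  "compact_invariant S D \<longleftrightarrow> (\<forall>f\<in>S. unif_cont f)
    \<and> (\<forall>f\<in>S. \<forall>g\<in>S. \<forall>a b. (\<lambda>x. a * f x + b * g x) \<in> S)
    \<and> (\<forall>h. (\<forall>e>0. \<exists>g\<in>S. \<forall>x\<in>carrier G. \<bar>h x - g x\<bar> \<le> e) \<longrightarrow> h \<in> S)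
    \<and> (\<forall>f\<in>S. \<forall>a\<in>carrier G. (\<lambda>x. f (x \<otimes> a)) \<in> S)
    \<and> (\<forall>f\<in>S. norm2 f \<le> 1 \<longrightarrow> (\<forall>x\<in>carrier G. \<bar>f x\<bar> \<le> D))
    \<and> (\<forall>e>0. \<exists>V. nbhd_one V \<and>
        (\<forall>f\<in>S. norm2 f \<le> 1 \<longrightarrow> (\<forall>x y. close V x y \<longrightarrow> \<bar>f x - f y\<bar> \<le> e)))"

lemma compact_invariantD:
  assumes "compact_invariant S D"
  shows "f \<in> S \<Longrightarrow> unif_cont f"
    and "f \<in> S \<Longrightarrow> g \<in> S \<Longrightarrow> (\<lambda>x. a * f x + b * g x) \<in> S"
    and "(\<And>e. 0 < e \<Longrightarrow> \<exists>g\<in>S. \<forall>x\<in>carrier G. \<bar>h x - g x\<bar> \<le> e) \<Longrightarrow> h \<in> S"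
    and "f \<in> S \<Longrightarrow> c \<in> carrier G \<Longrightarrow> (\<lambda>x. f (x \<otimes> c)) \<in> S"
    and "f \<in> S \<Longrightarrow> norm2 f \<le> 1 \<Longrightarrow> x \<in> carrier G \<Longrightarrow> \<bar>f x\<bar> \<le> D"
    and "0 < e \<Longrightarrow> \<exists>V. nbhd_one V \<and>
      (\<forall>f\<in>S. norm2 f \<le> 1 \<longrightarrow> (\<forall>x y. close V x y \<longrightarrow> \<bar>f x - f y\<bar> \<le> e))"
  using assms unfolding compact_invariant_def by simp_all

text \<open>\<open>S\<close> is an eigenspace of the square of a convolution operator for some
  \<open>\<mu> > 0\<close>: dividing by \<open>\<mu>\<close> makes each \<open>f\<close> in
  \<open>S\<close> an image, which inherits bound and modulus. The square appears because
  \<open>eigenfunction_exists\<close> treats \<open>B A\<close> with \<open>B\<close> adjoint to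
  \<open>A\<close>, and here both are the same self-adjoint operator.\<close>

lemma compact_invariant_exists:
  assumes "Hausdorff_space T" "carrier G \<noteq> {\<one>}"
  obtains S D where "compact_invariant S D"
    and "\<exists>f\<in>S. \<exists>x\<in>carrier G. f x \<noteq> 0" and "\<And>f. f \<in> S \<Longrightarrow> mean f = 0"
proof -
  obtain b where b: "b \<in> carrier G" "b \<noteq> \<one>" using assms(2) one_closed by blast
  have "completely_regular_space T"
    using assms(1) compact_T by (simp add: compact_imp_locally_compact_space locally_compact_regular_imp_completely_regular_space)
  moreover have "closedin T {b}"
    using assms(1) b(1) by (simp add: closedin_Hausdorff_singleton topspace_eq_carrier)
  ultimately obtain u where u: "continuous_map T (top_of_set {0..1}) u" "u \<one> = (0::real)" "u b = 1"
    using b unfolding completely_regular_space_def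
    by (elim allE[of _ "{b}"] allE[of _ \<one>]) (auto simp: topspace_eq_carrier)
  have uc: "unif_cont u" using u(1) by (simp add: unif_cont_iff continuous_map_in_subtopology)
  have u0: "0 \<le> u x" if "x \<in> carrier G" for x
    using continuous_map_image_subset_topspace[OF u(1)] that by (auto simp: topspace_eq_carrier)
  \<comment> \<open>Symmetrising makes the convolution self-adjoint; subtracting the mean in
    \<open>\<psi>\<close> makes it kill constants, which will force mean 0 on
    \<open>S\<close>.\<close>
  define v where "v = (\<lambda>x. u x + u (inv x))"
  define \<psi> where "\<psi> = (\<lambda>x. v x - mean v)"
  have vc: "unif_cont v" unfolding v_def by (intro unif_cont_add uc unif_cont_inv)
  then have \<psi>: "unif_cont \<psi>" unfolding \<psi>_def by (intro unif_cont_diff unif_cont_const)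
  have sym: "\<forall>x\<in>carrier G. \<psi> (inv x) = \<psi> x" by (simp add: \<psi>_def v_def)
  have m\<psi>: "mean \<psi> = 0" using mean_diff[OF vc unif_cont_const, of "mean v"] by (simp add: \<psi>_def)
  let ?K = "kernel_op \<psi>"
  note K_uc = kernel_op_unif_cont[OF \<psi> sym] and K_lin = kernel_op_linear[OF \<psi> sym]
    and K_adj = kernel_op_adjoint[OF \<psi> sym] and K_right = kernel_op_right[OF \<psi> sym]
  note [simp] = K_uc
  obtain C where C: "0 < C" "\<And>f x. unif_cont f \<Longrightarrow> x \<in> carrier G \<Longrightarrow> \<bar>?K f x\<bar> \<le> C * norm2 f"
    using kernel_op_bound[OF \<psi> sym] by blast
  have Kn: "norm2 (?K f) \<le> C * norm2 f" if "unif_cont f" for f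
    by (rule norm2_le_sup) (use C(2) that in auto)
  have KK: "\<bar>?K (?K f) x\<bar> \<le> C * C * norm2 f" if f: "unif_cont f" and x: "x \<in> carrier G" for f x
  proof -
    have "\<bar>?K (?K f) x\<bar> \<le> C * norm2 (?K f)" using C(2)[of "?K f" x] f x by simp
    also have "\<dots> \<le> C * (C * norm2 f)" using C(1) Kn[OF f] by (intro mult_left_mono) auto
    finally show ?thesis by simp
  qed
  have KK_equi: "\<exists>V. nbhd_one V \<and> (\<forall>f x y. unif_cont f \<longrightarrow> close V x y \<longrightarrow> \<bar>?K (?K f) x - ?K (?K f) y\<bar> \<le> e * norm2 f)"
    if "0 < e" for e
  proof -
    have "0 < e / C" using that C(1) by simp
    from kernel_op_equicontinuous[OF \<psi> sym this] obtain V where V: "nbhd_one V"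
      "\<And>f x x'. unif_cont f \<Longrightarrow> close V x x' \<Longrightarrow> \<bar>?K f x - ?K f x'\<bar> \<le> e / C * norm2 f"
      by blast
    have "\<bar>?K (?K f) x - ?K (?K f) y\<bar> \<le> e * norm2 f" if f: "unif_cont f" and c: "close V x y" for f x y
    proof -
      have "\<bar>?K (?K f) x - ?K (?K f) y\<bar> \<le> e / C * norm2 (?K f)" using V(2)[OF _ c] f by simp
      also have "\<dots> \<le> e / C * (C * norm2 f)" using \<open>0 < e / C\<close> Kn[OF f] by (intro mult_left_mono) auto
      finally show ?thesis using C(1) by simp
    qed
    then show ?thesis using V(1) by blast
  qed
  have K_cong: "?K f x = ?K g x" if "unif_cont f" "unif_cont g" "x \<in> carrier G" "\<And>x. x \<in> carrier G \<Longrightarrow> f x = g x" for f g x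
    unfolding kernel_op_def using that
    by (intro mean_cong unif_cont_mult kernel_section[OF \<psi> sym]) auto
  have "\<exists>x\<in>carrier G. \<psi> x \<noteq> 0"
  proof (rule ccontr)
    assume "\<not> ?thesis"
    then have "\<psi> \<one> = \<psi> b" using b by auto
    then show False using u u0[of "inv b"] b by (simp add: \<psi>_def v_def)
  qed
  then obtain c where c: "c \<in> carrier G" "\<psi> c \<noteq> 0" by blast
  have "0 < mean (\<lambda>x. \<psi> x * \<psi> x)"
    by (rule mean_pos[OF unif_cont_mult[OF \<psi> \<psi>] _ c(1)]) (use c(2) in \<open>auto simp: zero_less_mult_iff linorder_neq_iff\<close>)
  also have "mean (\<lambda>x. \<psi> x * \<psi> x) = ?K \<psi> \<one>"
    unfolding kernel_op_def using kernel_section[OF \<psi> sym one_closed]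
    by (intro mean_cong unif_cont_mult \<psi>) auto
  finally have nz: "0 < norm2 (?K \<psi>)" using norm2_pos[OF K_uc[OF \<psi>] one_closed] by simp
  have K_lin': "(\<lambda>x. if x \<in> carrier G then ?K (\<lambda>x. a * f x + b * g x) x else 0)
      = (\<lambda>x. a * (if x \<in> carrier G then ?K f x else 0) + b * (if x \<in> carrier G then ?K g x else 0))"
    if "unif_cont f" "unif_cont g" for f g a b
    using K_lin[OF that] by auto
  \<comment> \<open>\<open>eigenfunction_exists\<close> wants linearity as an equality of functions,
    but \<open>kernel_op\<close> is known to be linear only at points of the carrier.\<close>
  define K' where "K' = (\<lambda>f x. if x \<in> carrier G then ?K f x else 0)"
  have K'_eq: "K' f x = ?K f x" if "x \<in> carrier G" for f x using that by (simp add: K'_def)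
  have K'_uc: "unif_cont (K' f)" if "unif_cont f" for f
    by (rule unif_cont_uniform_limit) (use that in \<open>auto simp: K'_def intro!: exI[of _ "?K f"]\<close>)
  have K'_ip: "ip (K' f) g = ip (?K f) g" if "unif_cont f" "unif_cont g" for f g
    by (rule ip_cong) (use that K'_uc in \<open>auto simp: K'_eq\<close>)
  have K'_norm: "norm2 (K' f) = norm2 (?K f)" if "unif_cont f" for f
    unfolding norm2_def by (subst ip_cong[of _ "?K f" _ "?K f"]) (use that K'_uc in \<open>auto simp: K'_eq\<close>)
  have K'K': "K' (K' f) x = ?K (?K f) x" if "unif_cont f" "x \<in> carrier G" for f x
    using K_cong[OF K'_uc K_uc, of f f x] that by (simp add: K'_eq)
  obtain h0 \<mu> where h0: "unif_cont h0" "\<exists>x\<in>carrier G. h0 x \<noteq> 0" and \<mu>: "0 < \<mu>"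
    "\<And>x. x \<in> carrier G \<Longrightarrow> K' (K' h0) x = \<mu> * h0 x"
  proof (rule eigenfunction_exists[of "{f. unif_cont f}" K' K' C \<psi> "C * C"])
    show "\<exists>V. nbhd_one V \<and> (\<forall>f\<in>{f. unif_cont f}. norm2 f \<le> 1 \<longrightarrow>
        (\<forall>x y. close V x y \<longrightarrow> \<bar>K' (K' f) x - K' (K' f) y\<bar> \<le> e))" if "0 < e" for e
    proof -
      obtain V where V: "nbhd_one V" "\<forall>f x y. unif_cont f \<longrightarrow> close V x y \<longrightarrow> \<bar>?K (?K f) x - ?K (?K f) y\<bar> \<le> e * norm2 f"
        using KK_equi[OF \<open>0 < e\<close>] by blast
      have "\<bar>K' (K' f) x - K' (K' f) y\<bar> \<le> e" if "unif_cont f" "norm2 f \<le> 1" "close V x y" for f x y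
      proof -
        have "e * norm2 f \<le> e" using \<open>0 < e\<close> that by (simp add: mult_left_le)
        moreover have "x \<in> carrier G" "y \<in> carrier G" using that(3) by (auto simp: close_def)
        moreover have "\<bar>?K (?K f) x - ?K (?K f) y\<bar> \<le> e * norm2 f" using V(2) that(1,3) by blast
        ultimately show ?thesis using K'K'[OF that(1)] by simp
      qed
      then show ?thesis using V(1) by blast
    qed
    show "\<bar>K' (K' f) x\<bar> \<le> C * C" if "f \<in> {f. unif_cont f}" "norm2 f \<le> 1" "x \<in> carrier G" for f x
    proof -
      have "C * C * norm2 f \<le> C * C" using that(2) C(1) by (intro mult_left_le) auto
      then show ?thesis using KK[of f x] that K'K'[of f x] by simp
    qed
    show "h \<in> {f. unif_cont f}"
      if "\<And>e. 0 < e \<Longrightarrow> \<exists>g\<in>{f. unif_cont f}. \<forall>x\<in>carrier G. \<bar>h x - g x\<bar> \<le> e" for h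
      using unif_cont_uniform_limit[of h] that by auto
    show "ip (K' f) g = ip f (K' g)" if "f \<in> {f. unif_cont f}" "g \<in> {f. unif_cont f}" for f g
      using that K_adj[of f g] K'_ip[of f g] K'_ip[of g f] by (simp add: ip_commute)
  qed (use \<psi> nz Kn K'_uc K'_norm K_lin' in \<open>auto simp: K'_def intro: unif_cont_linear\<close>)
  have h0K: "?K (?K h0) x = \<mu> * h0 x" if "x \<in> carrier G" for x
    using \<mu>(2)[OF that] K'K'[OF h0(1) that] by simp
  define S where "S = {f. unif_cont f \<and> (\<forall>x\<in>carrier G. ?K (?K f) x = \<mu> * f x)}"
  have S: "unif_cont f" "\<And>x. x \<in> carrier G \<Longrightarrow> ?K (?K f) x = \<mu> * f x" if "f \<in> S" for f
    using that by (auto simp: S_def)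
  have "compact_invariant S (C * C / \<mu>)"
    unfolding compact_invariant_def
  proof (intro conjI ballI allI impI)
    show "(\<lambda>x. a * f x + b * g x) \<in> S" if "f \<in> S" "g \<in> S" for f g a b
    proof -
      have fg: "unif_cont f" "unif_cont g" using S that by auto
      have l: "unif_cont (\<lambda>x. a * f x + b * g x)" "unif_cont (\<lambda>x. a * ?K f x + b * ?K g x)"
        by (intro unif_cont_add unif_cont_mult unif_cont_const K_uc fg)+
      have "?K (?K (\<lambda>x. a * f x + b * g x)) x = \<mu> * (a * f x + b * g x)" if x: "x \<in> carrier G" for x
      proof -
        have "?K (?K (\<lambda>x. a * f x + b * g x)) x = ?K (\<lambda>x. a * ?K f x + b * ?K g x) x"
          by (rule K_cong[OF K_uc[OF l(1)] l(2) x]) (rule K_lin[OF fg])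
        also have "\<dots> = a * ?K (?K f) x + b * ?K (?K g) x" by (rule K_lin[OF K_uc[OF fg(1)] K_uc[OF fg(2)] x])
        finally show ?thesis using S(2)[OF \<open>f \<in> S\<close> x] S(2)[OF \<open>g \<in> S\<close> x] by (simp add: algebra_simps)
      qed
      then show ?thesis using l(1) by (simp add: S_def)
    qed
    show "h \<in> S" if lim: "\<forall>e>0. \<exists>g\<in>S. \<forall>x\<in>carrier G. \<bar>h x - g x\<bar> \<le> e" for h
    proof -
      have hc: "unif_cont h" by (rule unif_cont_uniform_limit) (use lim S in blast)
      have "?K (?K h) x = \<mu> * h x" if x: "x \<in> carrier G" for x
      proof -
        have "\<bar>?K (?K h) x - \<mu> * h x\<bar> \<le> 0 + e" if e: "0 < e" for e
        proof -
          define d where "d = e / (C * C + \<mu>)"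
          have d: "0 < d" using e C(1) \<mu>(1) by (simp add: d_def add_pos_pos)
          obtain g where g: "g \<in> S" "\<And>x. x \<in> carrier G \<Longrightarrow> \<bar>h x - g x\<bar> \<le> d" using lim d by blast
          have gc: "unif_cont g" by (rule S[OF g(1)])
          let ?w = "\<lambda>x. 1 * h x + (- 1) * g x"
          have wc: "unif_cont ?w" by (intro unif_cont_add unif_cont_mult unif_cont_const hc gc)
          have wc': "unif_cont (\<lambda>x. 1 * ?K h x + (- 1) * ?K g x)"
            by (intro unif_cont_add unif_cont_mult unif_cont_const K_uc hc gc)
          have "norm2 ?w \<le> d" by (rule norm2_le_sup[OF wc]) (use g(2) in simp)
          have "?K (?K ?w) x = ?K (\<lambda>x. 1 * ?K h x + (- 1) * ?K g x) x"
            by (rule K_cong[OF K_uc[OF wc] wc' x]) (rule K_lin[OF hc gc])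
          also have "\<dots> = 1 * ?K (?K h) x + (- 1) * ?K (?K g) x"
            by (rule K_lin[OF K_uc[OF hc] K_uc[OF gc] x])
          finally have "\<bar>?K (?K h) x - \<mu> * g x\<bar> \<le> C * C * norm2 ?w"
            using KK[OF wc x] S(2)[OF g(1) x] by simp
          also have "\<dots> \<le> C * C * d" using \<open>norm2 ?w \<le> d\<close> C(1) by (intro mult_left_mono) auto
          finally have 1: "\<bar>?K (?K h) x - \<mu> * g x\<bar> \<le> C * C * d" .
          have "\<bar>\<mu> * g x - \<mu> * h x\<bar> \<le> \<mu> * d"
            using g(2)[OF x] \<mu>(1) by (simp add: abs_mult abs_minus_commute flip: right_diff_distrib)
          then have "\<bar>?K (?K h) x - \<mu> * h x\<bar> \<le> (C * C + \<mu>) * d" using 1 by (simp add: algebra_simps)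
          also have "\<dots> = e"
          proof -
            have "0 < C * C + \<mu>" using C(1) \<mu>(1) by (simp add: add_pos_pos)
            then show ?thesis by (simp add: d_def)
          qed
          finally show ?thesis by simp
        qed
        then have "\<bar>?K (?K h) x - \<mu> * h x\<bar> \<le> 0" by (rule field_le_epsilon)
        then show ?thesis by simp
      qed
      then show ?thesis using hc by (simp add: S_def)
    qed
    show "(\<lambda>x. f (x \<otimes> a)) \<in> S" if f: "f \<in> S" and a: "a \<in> carrier G" for f a
    proof -
      have fc: "unif_cont f" by (rule S[OF f])
      have "?K (?K (\<lambda>x. f (x \<otimes> a))) x = \<mu> * f (x \<otimes> a)" if x: "x \<in> carrier G" for x
      proof -
        have "?K (?K (\<lambda>x. f (x \<otimes> a))) x = ?K (\<lambda>x. ?K f (x \<otimes> a)) x"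
          by (rule K_cong[OF K_uc[OF unif_cont_right[OF fc a]] unif_cont_right[OF K_uc[OF fc] a] x])
            (rule K_right[OF fc a])
        also have "\<dots> = ?K (?K f) (x \<otimes> a)" by (rule K_right[OF K_uc[OF fc] a x])
        finally show ?thesis using S(2)[OF f] x a by simp
      qed
      then show ?thesis using unif_cont_right[OF fc a] by (simp add: S_def)
    qed
    show "\<bar>f x\<bar> \<le> C * C / \<mu>" if f: "f \<in> S" "norm2 f \<le> 1" and x: "x \<in> carrier G" for f x
    proof -
      have "\<mu> * \<bar>f x\<bar> = \<bar>?K (?K f) x\<bar>" using S(2)[OF f(1) x] \<mu>(1) by (simp add: abs_mult)
      also have "\<dots> \<le> C * C * norm2 f" by (rule KK[OF S(1)[OF f(1)] x])
      also have "\<dots> \<le> C * C" using f(2) C(1) by (intro mult_left_le) auto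
      finally show ?thesis using \<mu>(1) by (simp add: pos_le_divide_eq mult.commute)
    qed
    show "\<exists>V. nbhd_one V \<and> (\<forall>f\<in>S. norm2 f \<le> 1 \<longrightarrow> (\<forall>x y. close V x y \<longrightarrow> \<bar>f x - f y\<bar> \<le> e))"
      if e: "0 < e" for e
    proof -
      have "0 < \<mu> * e" using e \<mu>(1) by simp
      from KK_equi[OF this] obtain V where V: "nbhd_one V"
        "\<forall>f x y. unif_cont f \<longrightarrow> close V x y \<longrightarrow> \<bar>?K (?K f) x - ?K (?K f) y\<bar> \<le> \<mu> * e * norm2 f" by blast
      have "\<bar>f x - f y\<bar> \<le> e" if f: "f \<in> S" "norm2 f \<le> 1" and c: "close V x y" for f x y
      proof -
        have xy: "x \<in> carrier G" "y \<in> carrier G" using c by (auto simp: close_def)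
        have "\<mu> * \<bar>f x - f y\<bar> = \<bar>?K (?K f) x - ?K (?K f) y\<bar>"
          using S(2)[OF f(1)] xy \<mu>(1) by (simp add: abs_mult flip: right_diff_distrib)
        also have "\<dots> \<le> \<mu> * e * norm2 f" using V(2) S(1)[OF f(1)] c by blast
        also have "\<dots> \<le> \<mu> * e" using f(2) \<open>0 < \<mu> * e\<close> by (intro mult_left_le) auto
        finally show ?thesis using \<mu>(1) by simp
      qed
      then show ?thesis using V(1) by blast
    qed
  qed (use S in auto)
  moreover have "\<exists>f\<in>S. \<exists>x\<in>carrier G. f x \<noteq> 0"
      using h0 h0K by (intro bexI[of _ h0]) (auto simp: S_def)
  moreover have "mean f = 0" if f: "f \<in> S" for f
    proof -
      have fc: "unif_cont f" by (rule S[OF f])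
      have K1: "?K (\<lambda>_. 1) x = 0" if "x \<in> carrier G" for x
        using mean_right[OF \<psi>, of "inv x"] that by (simp add: kernel_op_def m\<psi>)
      \<comment> \<open>One factor is moved across the inner product onto the constant 1, where it
        returns the mean of \<open>\<psi>\<close>.\<close>
      have "\<mu> * mean f = ip (?K (?K f)) (\<lambda>_. 1)"
        using mean_cong[OF K_uc[OF K_uc[OF fc]] unif_cont_mult[OF unif_cont_const fc], of \<mu>] S(2)[OF f] mean_scale[OF fc, of \<mu>]
        by (simp add: ip_def)
      also have "\<dots> = ip (?K f) (?K (\<lambda>_. 1))" by (rule K_adj[OF K_uc[OF fc] unif_cont_const])
      also have "\<dots> = ip (\<lambda>_. 0) (\<lambda>_. 0)"
        by (rule ip_cong) (use fc K1 unif_cont_const in auto)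
      finally show ?thesis using \<mu>(1) by (simp add: ip_def)
    qed
  ultimately show thesis using that by blast
qed

text \<open>Let \<open>R\<close> be translation by \<open>a\<close> and \<open>A = R - 1\<close>.
  The adjoint times \<open>A\<close> is \<open>2 - R\<close> minus the inverse of \<open>R\<close>,
  so an eigenvector \<open>h\<close> satisfies a second-order recurrence along orbits. Its
  characteristic polynomial splits into \<open>R - cis \<alpha>\<close> and
  \<open>R - cis (- \<alpha>)\<close>; applying one factor to \<open>h\<close> gives an eigenvector
  of \<open>R\<close> or 0. Complex numbers enter only here.\<close>

lemma eigenfunction_translation:
  assumes ci: "compact_invariant S D"
    and a: "a \<in> carrier G" and f0: "f0 \<in> S" "x0 \<in> carrier G" "f0 (x0 \<otimes> a) \<noteq> f0 x0"
  obtains \<omega> :: complex and f :: "'a \<Rightarrow> complex" where "cmod \<omega> = 1" "\<omega> \<noteq> 1"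
    "(\<lambda>x. Re (f x)) \<in> S" "(\<lambda>x. Im (f x)) \<in> S" "\<exists>x\<in>carrier G. f x \<noteq> 0"
    "\<And>x. x \<in> carrier G \<Longrightarrow> f (x \<otimes> a) = \<omega> * f x"
proof -
  note S = compact_invariantD(1)[OF ci] and S_lin = compact_invariantD(2)[OF ci]
    and S_lim = compact_invariantD(3)[OF ci] and S_right = compact_invariantD(4)[OF ci]
    and bound = compact_invariantD(5)[OF ci] and equi = compact_invariantD(6)[OF ci]
  note [simp] = S S_right
  have diff: "(\<lambda>x. f x - g x) \<in> S" if "f \<in> S" "g \<in> S" for f g using S_lin[OF that, of 1 "-1"] by simp
  let ?A = "\<lambda>f x. f (x \<otimes> a) - f x" and ?B = "\<lambda>f x. f (x \<otimes> inv a) - f x"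
  have BA: "?B (?A f) x = 2 * f x - f (x \<otimes> inv a) - f (x \<otimes> a)" if "x \<in> carrier G" for f :: "'a \<Rightarrow> real" and x
    using a that by (simp add: m_assoc)
  have adj: "ip (?A f) g = ip f (?B g)" if fg: "f \<in> S" "g \<in> S" for f g
  proof -
    have u: "unif_cont f" "unif_cont g" "unif_cont (\<lambda>x. f (x \<otimes> a))" "unif_cont (\<lambda>x. g (x \<otimes> inv a))"
      using fg a by (auto intro!: unif_cont_right)
    have "mean (\<lambda>x. f (x \<otimes> a) * g x) = mean (\<lambda>x. f (x \<otimes> inv a \<otimes> a) * g (x \<otimes> inv a))"
      using mean_right[OF unif_cont_mult[OF u(3,2)], of "inv a"] a by simp
    also have "\<dots> = mean (\<lambda>x. f x * g (x \<otimes> inv a))"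
    proof (rule mean_cong)
      show "unif_cont (\<lambda>x. f (x \<otimes> inv a \<otimes> a) * g (x \<otimes> inv a))"
        using unif_cont_right[OF unif_cont_mult[OF u(3,2)], of "inv a"] a by simp
    qed (use u a in \<open>auto intro: unif_cont_mult simp: m_assoc\<close>)
    finally show ?thesis
      using mean_diff[OF unif_cont_mult[OF u(3,2)] unif_cont_mult[OF u(1,2)]]
        mean_diff[OF unif_cont_mult[OF u(1,4)] unif_cont_mult[OF u(1,2)]]
      by (simp add: ip_def algebra_simps)
  qed
  obtain h \<mu> where h: "h \<in> S" "0 < \<mu>" "\<exists>x\<in>carrier G. h x \<noteq> 0"
    and eig: "\<And>x. x \<in> carrier G \<Longrightarrow> ?B (?A h) x = \<mu> * h x"
  proof (rule eigenfunction_exists[of S ?A ?B 2 f0 "4 * \<bar>D\<bar>"])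
    show "norm2 (?A f) \<le> 2 * norm2 f" if f: "f \<in> S" for f
    proof -
      have fc: "unif_cont f" "unif_cont (\<lambda>x. f (x \<otimes> a))" "unif_cont (\<lambda>x. (- 1) * f x)"
        using f a by (simp, simp, intro unif_cont_mult[OF unif_cont_const] S)
      show ?thesis
        using norm2_triangle[OF fc(2,3)] norm2_right[OF fc(1) a] norm2_scale[OF fc(1), of "-1"] by simp
    qed
    show "0 < norm2 (?A f0)"
      by (rule norm2_pos[OF _ f0(2)]) (use f0 a in \<open>auto intro!: S diff\<close>)
    show "\<bar>?B (?A f) x\<bar> \<le> 4 * \<bar>D\<bar>" if f: "f \<in> S" "norm2 f \<le> 1" and x: "x \<in> carrier G" for f x
      unfolding BA[OF x] using bound[OF f, of x] bound[OF f, of "x \<otimes> a"] bound[OF f, of "x \<otimes> inv a"] x a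
      by (simp add: abs_le_iff)
    show "\<exists>V. nbhd_one V \<and> (\<forall>f\<in>S. norm2 f \<le> 1 \<longrightarrow>
        (\<forall>x y. close V x y \<longrightarrow> \<bar>?B (?A f) x - ?B (?A f) y\<bar> \<le> e))" if e: "0 < e" for e
    proof -
      obtain V where V: "nbhd_one V"
        "\<And>f x y. f \<in> S \<Longrightarrow> norm2 f \<le> 1 \<Longrightarrow> close V x y \<Longrightarrow> \<bar>f x - f y\<bar> \<le> e / 4"
        using equi[of "e / 4"] e by auto
      have "\<bar>?B (?A f) x - ?B (?A f) y\<bar> \<le> e" if f: "f \<in> S" "norm2 f \<le> 1" and c: "close V x y" for f x y
      proof -
        have xy: "x \<in> carrier G" "y \<in> carrier G" using c by (auto simp: close_def)
        show ?thesis
          unfolding BA[OF xy(1)] BA[OF xy(2)]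
          using V(2)[OF f c] V(2)[OF f close_mult_right[OF c a]]
            V(2)[OF f close_mult_right[OF c inv_closed[OF a]]] by linarith
      qed
      then show ?thesis using V(1) by blast
    qed
  qed (use a f0 adj S_lin S_lim in \<open>auto intro!: diff simp: algebra_simps\<close>)
  have eq: "h (x \<otimes> a) + h (x \<otimes> inv a) = (2 - \<mu>) * h x" if "x \<in> carrier G" for x
    using eig[OF that] unfolding BA[OF that] by (simp add: algebra_simps)
  \<comment> \<open>At a point where the absolute value of \<open>h\<close> is maximal the
    recurrence bounds that of \<open>2 - \<mu>\<close> by 2, so \<open>2 - \<mu>\<close> is twice a
    cosine. Positivity of \<open>\<mu>\<close> keeps the cosine away from 1 and hence the eigenvalue
    too.\<close>
  have "unif_cont (\<lambda>x. \<bar>h x\<bar>)"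
    using S[OF h(1)] by (simp add: unif_cont_iff continuous_map_real_abs)
  then obtain p where p: "p \<in> carrier G" "\<And>y. y \<in> carrier G \<Longrightarrow> \<bar>h y\<bar> \<le> \<bar>h p\<bar>"
    using unif_cont_attains_sup by blast
  have hp: "0 < \<bar>h p\<bar>" using h(3) p(2) by fastforce
  have "\<bar>2 - \<mu>\<bar> * \<bar>h p\<bar> = \<bar>h (p \<otimes> a) + h (p \<otimes> inv a)\<bar>" using eq[OF p(1)] by (simp add: abs_mult)
  also have "\<dots> \<le> 2 * \<bar>h p\<bar>" using p(2)[of "p \<otimes> a"] p(2)[of "p \<otimes> inv a"] p(1) a by simp
  finally have \<mu>4: "\<mu> \<le> 4" using hp by (simp add: mult_le_cancel_right)
  define \<alpha> where "\<alpha> = arccos (1 - \<mu> / 2)"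
  have cos: "cos \<alpha> = 1 - \<mu> / 2" unfolding \<alpha>_def using h(2) \<mu>4 by (intro cos_arccos) auto
  have cis_sum: "cis \<alpha> + cis (- \<alpha>) = of_real (2 - \<mu>)"
    by (simp add: complex_eq_iff cos)
  have ne1: "cis \<alpha> \<noteq> 1" "cis (- \<alpha>) \<noteq> 1" using cos h(2) by (auto simp: complex_eq_iff)
  define f where "f = (\<lambda>x. of_real (h (x \<otimes> a)) - cis (- \<alpha>) * of_real (h x))"
  have f_eig: "f (x \<otimes> a) = cis \<alpha> * f x" if x: "x \<in> carrier G" for x
  proof -
    have "h (x \<otimes> a \<otimes> a) = (2 - \<mu>) * h (x \<otimes> a) - h x"
      using eq[of "x \<otimes> a"] x a by (simp add: m_assoc)
    then have "f (x \<otimes> a) = (cis \<alpha> + cis (- \<alpha>)) * of_real (h (x \<otimes> a)) - of_real (h x) - cis (- \<alpha>) * of_real (h (x \<otimes> a))"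
      by (simp add: f_def cis_sum)
    also have "\<dots> = cis \<alpha> * of_real (h (x \<otimes> a)) - (cis \<alpha> * cis (- \<alpha>)) * of_real (h x)"
      by (simp add: cis_mult algebra_simps)
    finally show ?thesis by (simp add: f_def algebra_simps)
  qed
  show thesis
  proof (cases "\<exists>x\<in>carrier G. f x \<noteq> 0")
    case True
    have "(\<lambda>x. Re (f x)) = (\<lambda>x. 1 * h (x \<otimes> a) + (- cos \<alpha>) * h x)"
      "(\<lambda>x. Im (f x)) = (\<lambda>x. sin \<alpha> * h x + 0 * h x)"
      by (auto simp: f_def)
    then have "(\<lambda>x. Re (f x)) \<in> S" "(\<lambda>x. Im (f x)) \<in> S"
      using S_lin[OF S_right[OF h(1) a] h(1), of 1 "- cos \<alpha>"] S_lin[OF h(1) h(1), of "sin \<alpha>" 0] by auto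
    then show thesis using that[of "cis \<alpha>" f] True f_eig ne1 by simp
  next
    \<comment> \<open>If the factor annihilates \<open>h\<close>, then \<open>h\<close> itself is an
      eigenvector for the other root.\<close>
    case False
    have "(\<lambda>x. Im (complex_of_real (h x))) \<in> S" using S_lin[OF h(1) h(1), of 0 0] by simp
    moreover have "complex_of_real (h (x \<otimes> a)) = cis (- \<alpha>) * complex_of_real (h x)" if "x \<in> carrier G" for x
      using False that by (auto simp: f_def)
    ultimately show thesis
      using that[of "cis (- \<alpha>)" "\<lambda>x. complex_of_real (h x)"] h ne1 by simp
  qed
qed


section \<open>Contractible compact groups are trivial\<close>

lemma connected_open_subgroup:
  assumes "connected_space T" "nbhd_one V" "V \<subseteq> H"
    and H: "H \<subseteq> carrier G" "\<And>x y. x \<in> H \<Longrightarrow> y \<in> H \<Longrightarrow> x \<otimes> y \<in> H" "\<And>x. x \<in> H \<Longrightarrow> inv x \<in> H"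
  shows "H = carrier G"
proof -
  obtain Q where Q: "openin T Q" "\<one> \<in> Q" "Q \<subseteq> V" using assms(2) unfolding nbhd_one_def by blast
  have nb: "openin T {y \<in> carrier G. y \<otimes> inv x \<in> Q}" if "x \<in> carrier G" for x
    by (rule openin_translate[OF Q(1) that])
  have quot: "y \<otimes> inv x \<in> H" if "y \<otimes> inv x \<in> Q" for x y using that Q(3) assms(3) by blast
  have "openin T H"
  proof (subst openin_subopen, intro ballI)
    fix x assume x: "x \<in> H"
    then have xc: "x \<in> carrier G" using H by blast
    have "y \<in> H" if "y \<in> carrier G" "y \<otimes> inv x \<in> Q" for y
      using H(2)[OF quot[OF that(2)] x] that xc by (simp add: m_assoc)
    then show "\<exists>A. openin T A \<and> x \<in> A \<and> A \<subseteq> H"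
      using nb[OF xc] xc Q(2) by (intro exI[of _ "{y \<in> carrier G. y \<otimes> inv x \<in> Q}"]) auto
  qed
  moreover have "openin T (carrier G - H)"
  proof (subst openin_subopen, intro ballI)
    fix x assume x: "x \<in> carrier G - H"
    then have xc: "x \<in> carrier G" by blast
    have "y \<notin> H" if "y \<in> carrier G" "y \<otimes> inv x \<in> Q" for y
    proof
      assume y: "y \<in> H"
      have "inv (y \<otimes> inv x) \<otimes> y \<in> H" by (rule H(2)[OF H(3)[OF quot[OF that(2)]] y])
      then show False using x that xc by (simp add: inv_mult_group m_assoc)
    qed
    then show "\<exists>A. openin T A \<and> x \<in> A \<and> A \<subseteq> carrier G - H"
      using nb[OF xc] xc Q(2) by (intro exI[of _ "{y \<in> carrier G. y \<otimes> inv x \<in> Q}"]) auto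
  qed
  then have "closedin T H" using H(1) by (simp add: closedin_def topspace_eq_carrier)
  moreover have "H \<noteq> {}" using assms(2,3) nbhd_one_one by blast
  ultimately show ?thesis
    using assms(1) unfolding connected_space_clopen_in topspace_eq_carrier by blast
qed

theorem contractible_trivial:
  assumes "Hausdorff_space T" "contractible_space T" shows "carrier G = {\<one>}"
proof (rule ccontr)
  assume "carrier G \<noteq> {\<one>}"
  obtain S D where ci: "compact_invariant S D"
    and nz: "\<exists>f\<in>S. \<exists>x\<in>carrier G. f x \<noteq> 0" and mean0: "\<And>f. f \<in> S \<Longrightarrow> mean f = 0"
    using compact_invariant_exists[OF assms(1) \<open>carrier G \<noteq> {\<one>}\<close>] by blast
  note S = compact_invariantD(1)[OF ci] and S_lin = compact_invariantD(2)[OF ci]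
  \<comment> \<open>Errors of \<open>1 / 32\<close> in the real and the imaginary part add up to the
    \<open>1 / 16\<close> of \<open>Arg_quotient_cocycle\<close>.\<close>
  obtain V where V: "nbhd_one V"
    "\<And>f x y. f \<in> S \<Longrightarrow> norm2 f \<le> 1 \<Longrightarrow> close V x y \<Longrightarrow> \<bar>f x - f y\<bar> \<le> 1 / 32"
    using compact_invariantD(6)[OF ci, of "1 / 32"] by auto
  obtain P where P: "finite P" "P \<subseteq> carrier G" "\<And>x. x \<in> carrier G \<Longrightarrow> \<exists>p\<in>P. close V x p"
    using finite_net[OF V(1)] by metis
  obtain ps where ps: "set ps = P" using finite_list[OF P(1)] by blast
  obtain U where U: "nbhd_one U" and no_bound: "\<And>a \<alpha> ts. \<lbrakk>a \<in> U; \<alpha> \<noteq> 0; length ts = length ps;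
      \<And>t. t \<in> set ts \<Longrightarrow> connection a \<alpha> t\<rbrakk> \<Longrightarrow> \<exists>Q. Q \<noteq> {} \<and> small V Q \<and>
        (\<forall>t\<in>set ts. \<exists>x\<in>Q. \<exists>y\<in>Q. \<exists>z\<in>Q. t y z - t x z + t x y \<noteq> 0)"
    using no_category_bound[OF assms(2) V(1), of "length ps"] by blast
  \<comment> \<open>Otherwise the elements acting trivially on \<open>S\<close> form an open
    subgroup, hence the whole group. Functions in \<open>S\<close> would be constant, and mean 0
    makes them vanish, contrary to \<open>nz\<close>.\<close>
  have "\<exists>a\<in>U. \<exists>f\<in>S. \<exists>x\<in>carrier G. f (x \<otimes> a) \<noteq> f x"
  proof (rule ccontr)
    assume neg: "\<not> ?thesis"
    define H where "H = {a \<in> carrier G. \<forall>f\<in>S. \<forall>x\<in>carrier G. f (x \<otimes> a) = f x}"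
    have conn: "connected_space T"
      using assms(2) by (intro path_connected_imp_connected_space contractible_imp_path_connected_space)
    have sub: "U \<subseteq> H" using neg nbhd_one_subset[OF U] by (auto simp: H_def)
    have mul: "x \<otimes> y \<in> H" if "x \<in> H" "y \<in> H" for x y
      using that by (auto simp: H_def simp flip: m_assoc)
    have invc: "inv x \<in> H" if x: "x \<in> H" for x
    proof -
      have "f (y \<otimes> inv x) = f y" if "f \<in> S" "y \<in> carrier G" for f y
      proof -
        have "f (y \<otimes> inv x \<otimes> x) = f (y \<otimes> inv x)" using x that by (simp add: H_def)
        then show ?thesis using x that by (simp add: H_def m_assoc)
      qed
      then show ?thesis using x by (simp add: H_def)
    qed
    have H: "H = carrier G"
    proof (rule connected_open_subgroup[OF conn U sub])
      show "H \<subseteq> carrier G" unfolding H_def by blast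
    qed (fact mul, fact invc)
    obtain f x where f: "f \<in> S" "x \<in> carrier G" "f x \<noteq> 0" using nz by blast
    have const: "f y = f \<one>" if "y \<in> carrier G" for y
    proof -
      have "y \<in> H" using H that by simp
      then have "f (\<one> \<otimes> y) = f \<one>" using f(1) unfolding H_def by blast
      then show ?thesis using that by simp
    qed
    have "mean f = mean (\<lambda>_. f \<one>)"
      by (rule mean_cong[OF S[OF f(1)] unif_cont_const const])
    then show False using mean0[OF f(1)] f(3) const[OF f(2)] by simp
  qed
  then obtain a f0 x0 where a: "a \<in> U" and f0: "f0 \<in> S" "x0 \<in> carrier G" "f0 (x0 \<otimes> a) \<noteq> f0 x0" by blast
  have ac: "a \<in> carrier G" using a nbhd_one_subset[OF U] by blast
  obtain \<omega> :: complex and f :: "'a \<Rightarrow> complex" where \<omega>: "cmod \<omega> = 1" "\<omega> \<noteq> 1"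
    and fS: "(\<lambda>x. Re (f x)) \<in> S" "(\<lambda>x. Im (f x)) \<in> S" and fnz: "\<exists>x\<in>carrier G. f x \<noteq> 0"
    and f_eig: "\<And>x. x \<in> carrier G \<Longrightarrow> f (x \<otimes> a) = \<omega> * f x"
    by (rule eigenfunction_translation[OF ci ac f0]) (rule that)
  have "unif_cont (\<lambda>x. (Re (f x))\<^sup>2 + (Im (f x))\<^sup>2)"
    unfolding power2_eq_square by (intro unif_cont_add unif_cont_mult S fS)
  then obtain q where q: "q \<in> carrier G" "\<And>y. y \<in> carrier G \<Longrightarrow> (Re (f y))\<^sup>2 + (Im (f y))\<^sup>2 \<le> (Re (f q))\<^sup>2 + (Im (f q))\<^sup>2"
    using unif_cont_attains_sup by blast
  have fq: "cmod (f y) \<le> cmod (f q)" if "y \<in> carrier G" for y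
    using q(2)[OF that] by (simp add: cmod_def)
  then have fq0: "0 < cmod (f q)" using fnz by fastforce
  \<comment> \<open>Scaled to maximal modulus 1, attained at \<open>q\<close>. Real and imaginary
    part then have \<open>norm2\<close> at most 1, so the modulus of continuity behind
    \<open>V\<close> applies to a function found only after \<open>V\<close>.\<close>
  define g where "g = (\<lambda>x. f x / of_real (cmod (f q)))"
  have g_eig: "g (x \<otimes> a) = \<omega> * g x" if "x \<in> carrier G" for x using f_eig[OF that] by (simp add: g_def)
  have g1: "cmod (g y) \<le> 1" if "y \<in> carrier G" for y
    using fq[OF that] fq0 by (simp add: g_def norm_divide)
  have gq: "cmod (g q) = 1" using fq0 by (simp add: g_def norm_divide)
  have gS: "(\<lambda>x. Re (g x)) \<in> S" "(\<lambda>x. Im (g x)) \<in> S"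
    using S_lin[OF fS(1) fS(1), of "1 / cmod (f q)" 0] S_lin[OF fS(2) fS(2), of "1 / cmod (f q)" 0]
    by (simp_all add: g_def)
  have g_close: "cmod (g x - g y) \<le> 1 / 16" if c: "close V x y" for x y
  proof -
    have "norm2 (\<lambda>x. Re (g x)) \<le> 1" "norm2 (\<lambda>x. Im (g x)) \<le> 1"
      using g1 abs_Re_le_cmod abs_Im_le_cmod by (auto intro!: norm2_le_sup S gS intro: order_trans)
    then have "\<bar>Re (g x - g y)\<bar> \<le> 1 / 32" "\<bar>Im (g x - g y)\<bar> \<le> 1 / 32"
      using V(2)[OF gS(1) _ c] V(2)[OF gS(2) _ c] by auto
    then show ?thesis using cmod_le[of "g x - g y"] by linarith
  qed
  define \<alpha> where "\<alpha> = Arg \<omega>"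
  have \<alpha>0: "\<alpha> \<noteq> 0"
  proof
    assume "\<alpha> = 0"
    then have "\<omega> = 1" using rcis_cmod_Arg[of \<omega>] \<omega>(1) by (simp add: \<alpha>_def rcis_def)
    then show False using \<omega>(2) by simp
  qed
  define big where "big = (\<lambda>p x. x \<in> carrier G \<and> 3 / 8 \<le> cmod (g (p \<otimes> x)))"
  \<comment> \<open>The default \<open>\<alpha>\<close> also serves points off the carrier, which
    \<open>shift a\<close> fixes: a connection has the value \<open>\<alpha>\<close> along the orbit
    at every element of the type.\<close>
  define t where "t = (\<lambda>p x y. if big p x \<and> big p y then Arg (g (p \<otimes> y) / g (p \<otimes> x)) else \<alpha>)"
  have shift_g: "g (p \<otimes> shift a x) = \<omega> * g (p \<otimes> x)" if "p \<in> P" "x \<in> carrier G" for p x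
    using that P(2) ac g_eig[of "p \<otimes> x"] by (auto simp: shift_def m_assoc subset_iff)
  have shift_big: "big p (shift a x) \<longleftrightarrow> big p x" if "p \<in> P" for p x
    using shift_g[OF that] \<omega>(1) ac by (cases "x \<in> carrier G") (auto simp: big_def norm_mult, auto simp: shift_def)
  have "connection a \<alpha> (t p)" if p: "p \<in> P" for p
    unfolding connection_def
  proof (intro conjI allI)
    fix x
    show "t p x (shift a x) = \<alpha>"
    proof (cases "big p x")
      case True
      then have "g (p \<otimes> x) \<noteq> 0" "x \<in> carrier G" by (auto simp: big_def)
      then show ?thesis using True shift_big[OF p] shift_g[OF p] by (simp add: t_def \<alpha>_def)
    qed (simp add: t_def)
  next
    fix x y
    have "\<omega> \<noteq> 0" using \<omega>(1) by auto
    then show "t p (shift a x) (shift a y) = t p x y"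
      unfolding t_def shift_big[OF p] using shift_g[OF p] by (auto simp: big_def)
  next
    have "\<bar>t p x y\<bar> \<le> pi" for x y
      using Arg_bounded[of "g (p \<otimes> y) / g (p \<otimes> x)"] Arg_bounded[of \<omega>] by (auto simp: t_def \<alpha>_def abs_le_iff)
    then show "\<exists>C. \<forall>x y. \<bar>t p x y\<bar> \<le> C" by blast
  qed
  then have "\<exists>Q. Q \<noteq> {} \<and> small V Q \<and>
        (\<forall>u\<in>set (map t ps). \<exists>x\<in>Q. \<exists>y\<in>Q. \<exists>z\<in>Q. u y z - u x z + u x y \<noteq> 0)"
    using ps by (intro no_bound[OF a \<alpha>0]) auto
  then obtain Q where Q: "Q \<noteq> {}" "small V Q" and
    curved: "\<forall>p\<in>P. \<exists>x\<in>Q. \<exists>y\<in>Q. \<exists>z\<in>Q. t p y z - t p x z + t p x y \<noteq> 0"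
    using ps by auto
  obtain w where w: "w \<in> Q" using Q(1) by blast
  have Qc: "x \<in> carrier G" if "x \<in> Q" for x using Q(2) that unfolding small_def close_def by blast
  \<comment> \<open>Left translation by \<open>p\<close> takes \<open>w\<close> near the maximum
    point \<open>q\<close> and keeps \<open>Q\<close> small. So \<open>g\<close> has modulus at
    least \<open>15 / 16 - 1 / 16\<close> on the translate, above the threshold
    \<open>3 / 8\<close>, and \<open>t p\<close> is flat on \<open>Q\<close>.\<close>
  obtain p where p: "p \<in> P" "close V (q \<otimes> inv w) p" using P(3)[of "q \<otimes> inv w"] q(1) Qc[OF w] by auto
  have pc: "p \<in> carrier G" using p(1) P(2) by blast
  have "close V (q \<otimes> inv w \<otimes> w) (p \<otimes> w)" by (rule close_mult_right[OF p(2) Qc[OF w]])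
  then have "close V q (p \<otimes> w)" using q(1) Qc[OF w] by (simp add: m_assoc)
  then have gw: "15 / 16 \<le> cmod (g (p \<otimes> w))"
    using g_close[of q "p \<otimes> w"] norm_triangle_ineq2[of "g q" "g (p \<otimes> w)"] gq by linarith
  have near: "cmod (g (p \<otimes> x) - g (p \<otimes> y)) \<le> 1 / 16" if "x \<in> Q" "y \<in> Q" for x y
    using g_close[OF close_mult_left[OF V(1) _ pc]] Q(2) that unfolding small_def by blast
  have big: "3 / 8 \<le> cmod (g (p \<otimes> x))" if "x \<in> Q" for x
    using near[OF w that] gw norm_triangle_ineq2[of "g (p \<otimes> w)" "g (p \<otimes> x)"] by linarith
  have "t p y z - t p x z + t p x y = 0" if "x \<in> Q" "y \<in> Q" "z \<in> Q" for x y z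
    using Arg_quotient_cocycle[of "g (p \<otimes> x)" "g (p \<otimes> y)" "g (p \<otimes> z)"] big near that Qc
    by (simp add: t_def big_def)
  then show False using bspec[OF curved p(1)] by blast
qed

end

section \<open>From an equivariant map on the join to a contraction of the group\<close>

lemma (in continuous_right_action) join_equivariant_imp_contractible:
  assumes x0: "x0 \<in> topspace X"
    and f: "continuous_map (join_topology X T) T f" "join_equivariant G T X act f"
  shows "contractible_space T"
proof -
  let ?q = "\<lambda>p. join_rel X T `` {p}"
  have q: "continuous_map (cylinder X T) (join_topology X T) ?q"
    unfolding join_topology_def
    by (rule quotient_imp_continuous_map[OF quotient_map_quotient_topology[OF equiv_join_rel]])
  define k where "k = (\<lambda>(t::real, g). f (?q (x0, t, g)))"
  have "continuous_map (prod_topology (top_of_set {0..1}) T) (cylinder X T) (\<lambda>p. (x0, p))"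
    using x0 by (intro continuous_map_pairedI) auto
  from continuous_map_compose[OF continuous_map_compose[OF this q] f(1)]
  have k: "continuous_map (prod_topology (top_of_set {0..1}) T) T k"
    by (simp add: k_def o_def case_prod_unfold)
  have kc: "k (t, g) \<in> carrier G" if "t \<in> {0..1}" "g \<in> carrier G" for t g
    using continuous_map_image_subset_topspace[OF k] that by (auto simp: topspace_eq_carrier)
  \<comment> \<open>The slice over \<open>x0\<close> is not invariant under the action, but at time
    0 the point \<open>act x0 g\<close> may be replaced by \<open>x0\<close>. Equivariance then
    shows that \<open>k (0, _)\<close> is left multiplication by
    \<open>k (0, \<one>)\<close>.\<close>
  have end0: "k (0, g) = k (0, \<one>) \<otimes> g" if g: "g \<in> carrier G" for g
  proof -
    have "?q (x0, 0, \<one>) \<in> topspace (join_topology X T)"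
      using continuous_map_image_subset_topspace[OF q] x0 by (auto simp: topspace_eq_carrier)
    then have "f (join_act G act (?q (x0, 0, \<one>)) g) = k (0, \<one>) \<otimes> g"
      using f(2) g unfolding join_equivariant_def k_def by simp
    moreover have "join_act G act (?q (x0, 0, \<one>)) g = ?q (act x0 g, 0, g)"
      using join_act_class[of x0 0 \<one> g] x0 g by simp
    moreover have "?q (act x0 g, 0, g) = ?q (x0, 0, g)"
      using x0 g act_closed[OF x0 g]
      by (intro equiv_class_eq[OF equiv_join_rel]) (auto simp: join_rel_def topspace_eq_carrier)
    ultimately show ?thesis by (simp add: k_def)
  qed
  have end1: "k (1, g) = k (1, \<one>)" if g: "g \<in> carrier G" for g
  proof -
    have "?q (x0, 1, g) = ?q (x0, 1, \<one>)"
      using x0 g by (intro equiv_class_eq[OF equiv_join_rel]) (auto simp: join_rel_def topspace_eq_carrier)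
    then show ?thesis by (simp add: k_def)
  qed
  \<comment> \<open>Multiplying on the left by the inverse of \<open>k (0, \<one>)\<close> turns the
    map at time 0 into the identity; \<open>b\<close> is the constant value at time 1.\<close>
  define b where "b = inv (k (0, \<one>)) \<otimes> k (1, \<one>)"
  have "\<exists>h. continuous_map (prod_topology (top_of_set {0..1::real}) T) T h \<and>
      (\<forall>x\<in>topspace T. h (0, x) = x) \<and> (\<forall>x\<in>topspace T. h (1, x) = b)"
  proof (intro exI conjI ballI)
    show "continuous_map (prod_topology (top_of_set {0..1}) T) T (\<lambda>p. inv (k (0, \<one>)) \<otimes> k p)"
      using kc[of 0 \<one>] by (intro continuous_map_mult k) (auto simp: topspace_eq_carrier)
    show "inv (k (0, \<one>)) \<otimes> k (0, x) = x" if "x \<in> topspace T" for x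
      using that kc[of 0 \<one>] end0[of x] by (simp add: topspace_eq_carrier flip: m_assoc)
    show "inv (k (0, \<one>)) \<otimes> k (1, x) = b" if "x \<in> topspace T" for x
      using that end1[of x] by (simp add: topspace_eq_carrier b_def)
  qed
  then have "homotopic_with (\<lambda>x. True) T T id (\<lambda>x. b)"
    by (subst homotopic_with) auto
  then show ?thesis unfolding contractible_space_def by blast
qed

theorem theorem1p5:
  fixes G :: "('g, 'r) monoid_scheme" and T :: "'g topology"
    and X :: "'x topology" and act :: "'x \<Rightarrow> 'g \<Rightarrow> 'x"
  assumes "topological_group G T"
    and "compact_space T" and "Hausdorff_space T"
    and "carrier G \<noteq> {\<one>\<^bsub>G\<^esub>}"
    and "topspace X \<noteq> {}"
    and "compact_space X" and "Hausdorff_space X"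
    and "continuous_right_action G T X act"
    and "free_action G X act"
  shows "\<not> (\<exists>f. continuous_map (join_topology X T) T f \<and> join_equivariant G T X act f)"
proof
  assume "\<exists>f. continuous_map (join_topology X T) T f \<and> join_equivariant G T X act f"
  then have "contractible_space T"
    using continuous_right_action.join_equivariant_imp_contractible[OF assms(8)] assms(5) by blast
  moreover have "compact_group G T"
    using assms(1,2) by (simp add: compact_group_def compact_group_axioms_def)
  ultimately show False
    using compact_group.contractible_trivial assms(3,4) by blast
qed

end
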